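(* Let $\mathcal M\subseteq\mathbb R^d$ be a connected, properly embedded Riemannian manifold of intrinsic dimension $m$, and let $p$ be a smooth, strictly positive stationary probability density on $\mathcal M$ that is centered and isotropic: $\mathbb E_{Z\sim p}[Z]=0$ and $\operatorname{Cov}_{Z\sim p}(Z)=c_pI_d$ with $c_p>0$. Assume that $-D_p$ is self-adjoint in $L^2(p)$ and has discrete spectrum. Fix $t>0$ and let $\mathcal L_p$ be the alignment loss associated with the time-$t$ transition kernel $K_t$. Assume that $(\mathcal M,p)$ is linearly admissible at scale $\lambda>0$, and let $\lambda_{\mathrm{nl}}>\lambda$ be the next distinct eigenvalue of $-D_p$. Set $\rho=e^{-\lambda t}$ and $\rho_{\mathrm{nl}}=e^{-\lambda_{\mathrm{nl}}t}$. Let $h:\mathcal M\to\mathcal M$ satisfy $h_{\#}p=p$ and suppose that $$\mathcal L_p(h)\le 2dc_p(1-\rho)+\varepsilon .$$ Then there exists $A\in\mathbb R^{d\times d}$ such that $$\|h-Az\|_{L^2(p)}^2\le\frac{\varepsilon}{2(\rho-\rho_{\mathrm{nl}})}.$$ Moreover, there exists $Q\in O(d)$ such that, with $\eta=\varepsilon/[2(\rho-\rho_{\mathrm{nl}})]$, $$\|h-Qz\|_{L^2(p)}^2\le\eta+\frac{\eta^2}{c_p}.$$ The constant in the first of these two bounds is optimal at the level of the underlying spectral inequality.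
   Context: $\mathcal M\subseteq\mathbb R^d$ is an embedded Riemannian manifold; $z=(z_1,\dots,z_d)$ denotes the ambient position vector, whose components are viewed as functions on $\mathcal M$. $O(d)$ is the orthogonal group. For $u:\mathcal M\to\mathbb R^d$, $\|u\|_{L^2(p)}^2=\mathbb E_{Z\sim p}\|u(Z)\|^2$; expressions such as $h-Az$ denote the map $z\mapsto h(z)-Az$. Maps $h$ are understood to be measurable. The symbol $p$ denotes both a probability measure on $\mathcal M$ and its density with respect to Riemannian volume. The weighted Laplacian is $$D_p\phi=\Delta_{\mathcal M}\phi+\langle\nabla_{\mathcal M}\log p,\nabla_{\mathcal M}\phi\rangle_{\mathcal M}=\frac1p\operatorname{div}_{\mathcal M}(p\nabla_{\mathcal M}\phi),$$ the generator of the Langevin diffusion $dZ_s=\nabla_{\mathcal M}\log p(Z_s)\,ds+\sqrt2\,dB^{\mathcal M}_s$ on $\mathcal M$, where $B^{\mathcal M}$ is Brownian motion on $\mathcal M$ with generator $\frac12\Delta_{\mathcal M}$; $p$ is stationary for this diffusion. $K_t(z,\cdot)$ is its time-$t$ transition kernel and $T_t=e^{tD_p}$ its transition operator, $(T_t\phi)(z)=\int_{\mathcal M}\phi(z')\,K_t(z,dz')$. Alignment loss: for $h:\mathcal M\to\mathcal M$, $$\mathcal L_p(h)=\mathbb E\big[\|h(Z')-h(Z)\|^2\big],\qquad Z\sim p,\quad Z'\mid Z=z\sim K_t(z,\cdot),$$ with $\|\cdot\|$ the Euclidean norm of $\mathbb R^d$. The condition $h_{\#}p=p$ means $h(Z)\sim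 p$ when $Z\sim p$. Linearly admissible: for $\lambda>0$, $(\mathcal M,p)$ is linearly admissible at scale $\lambda$ if (1) $p(z)\propto\exp(-\frac{\lambda}{2}\|z\|^2)$ for $z\in\mathcal M$; (2) $\Delta_{\mathcal M}z=-\lambda z^\perp$, where $\Delta_{\mathcal M}$ acts componentwise on the position vector and $z^\perp$ is the component of the ambient position vector normal to $\mathcal M$; (3) the ambient coordinate functions $z_1,\dots,z_d$ span the complete first non-constant eigenspace of $-D_p$, with eigenvalue $\lambda$. Underlying spectral inequality: write $h=Az+r$, where $Az$ is the componentwise $L^2(p)$-orthogonal projection of $h$ onto $\operatorname{span}\{z_1,\dots,z_d\}$ and $r\perp\operatorname{span}\{1,z_1,\dots,z_d\}$. The spectral inequality from which the first bound is deduced is $$\mathcal L_p(h)\ge 2dc_p(1-\rho)+2(\rho-\rho_{\mathrm{nl}})\|r\|_{L^2(p)}^2 .$$ Optimality "at the level of" this inequality refers to the fact that equality holds in it when the nonlinear remainder $r$ lies entirely in the eigenspace of $-D_p$ associated with $\lambda_{\mathrm{nl}}$; it does not assert that such a remainder is feasible under the additional constraints that $h$ be $\mathcal M$-valued and satisfy $h_{\#}p=p$. *)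

theory Defs
  imports "HOL-Probability.Probability"
begin

section \<open>Smoothness and embedded submanifolds of Euclidean space\<close>

primrec times_diff_on ::
  "nat \<Rightarrow> ('a::euclidean_space \<Rightarrow> 'b::euclidean_space) \<Rightarrow> 'a set \<Rightarrow> bool" where
  "times_diff_on 0 f U \<longleftrightarrow> continuous_on U f"
| "times_diff_on (Suc k) f U \<longleftrightarrow>
     (\<forall>x\<in>U. f differentiable (at x)) \<and>
     (\<forall>v. times_diff_on k (\<lambda>x. frechet_derivative f (at x) v) U)"

definition smooth_on_open :: "('a::euclidean_space \<Rightarrow> 'b::euclidean_space) \<Rightarrow> 'a set \<Rightarrow> bool" where
  "smooth_on_open f U \<longleftrightarrow> open U \<and> (\<forall>k. times_diff_on k f U)"

text \<open>Regular local parametrizations: smooth immersions of an open subset of \<open>\<real>\<^sup>m\<close> that are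
  homeomorphisms onto relatively open subsets of \<open>M\<close>.\<close>

definition local_param ::
  "(real^'d) set \<Rightarrow> (real^'m) set \<Rightarrow> (real^'m \<Rightarrow> real^'d) \<Rightarrow> bool" where
  "local_param M W \<psi> \<longleftrightarrow>
     smooth_on_open \<psi> W \<and>
     (\<forall>x\<in>W. inj (frechet_derivative \<psi> (at x))) \<and>
     openin (top_of_set M) (\<psi> ` W) \<and>
     (\<exists>\<theta>. homeomorphism W (\<psi> ` W) \<psi> \<theta>)"

definition embedded_submanifold :: "'m::finite itself \<Rightarrow> (real^'d) set \<Rightarrow> bool" where
  "embedded_submanifold m M \<longleftrightarrow>
     (\<forall>z\<in>M. \<exists>(W::(real^'m) set) \<psi>. local_param M W \<psi> \<and> z \<in> \<psi> ` W)"

text \<open>An embedded submanifold is properly embedded iff it is a closed subset of the ambient space.\<close>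

definition properly_embedded_submanifold :: "'m::finite itself \<Rightarrow> (real^'d) set \<Rightarrow> bool" where
  "properly_embedded_submanifold m M \<longleftrightarrow> embedded_submanifold m M \<and> closed M"

definition smooth_function :: "(real^'d) set \<Rightarrow> (real^'d \<Rightarrow> real) \<Rightarrow> bool" where
  "smooth_function M f \<longleftrightarrow>
     (\<forall>z\<in>M. \<exists>U g. z \<in> U \<and> smooth_on_open g U \<and> (\<forall>x\<in>U \<inter> M. g x = f x))"

definition test_function :: "(real^'d) set \<Rightarrow> (real^'d \<Rightarrow> real) \<Rightarrow> bool" where
  "test_function M f \<longleftrightarrow>
     smooth_function M f \<and> (\<exists>C. compact C \<and> C \<subseteq> M \<and> (\<forall>z\<in>M - C. f z = 0))"


section \<open>Riemannian calculus for the metric induced by the ambient inner product\<close>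

definition tangent_space :: "(real^'d) set \<Rightarrow> real^'d \<Rightarrow> (real^'d) set" where
  "tangent_space M z =
     {v. \<exists>\<gamma> e. e > 0 \<and> smooth_on_open \<gamma> {-e<..<e::real} \<and> \<gamma> ` {-e<..<e} \<subseteq> M \<and>
           \<gamma> 0 = z \<and> (\<gamma> has_vector_derivative v) (at 0)}"

definition tangent_proj :: "(real^'d) set \<Rightarrow> real^'d \<Rightarrow> real^'d \<Rightarrow> real^'d" where
  "tangent_proj M z v = closest_point (tangent_space M z) v"

definition normal_part :: "(real^'d) set \<Rightarrow> real^'d \<Rightarrow> real^'d" where
  "normal_part M z = z - tangent_proj M z z"

text \<open>A derivative at \<open>z\<close> within \<open>M\<close> depends only on values on \<open>M\<close>. It is determined only on
  tangent vectors, so the definitions below evaluate it on tangent vectors only.\<close>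

definition gradient :: "(real^'d) set \<Rightarrow> (real^'d \<Rightarrow> real) \<Rightarrow> real^'d \<Rightarrow> real^'d" where
  "gradient M f z =
     (THE w. w \<in> tangent_space M z \<and>
        (\<forall>v\<in>tangent_space M z. w \<bullet> v = frechet_derivative f (at z within M) v))"

text \<open>The Levi-Civita derivative of a tangent field is the tangential part of its ambient
  derivative; the divergence is its trace over the tangent space, and the trace over a subspace
  with orthogonal projection \<open>\<Pi>\<close> of \<open>L\<close> is \<open>\<Sum>\<^sub>b L (\<Pi> b) \<bullet> \<Pi> b\<close> over an ambient orthonormal basis.\<close>

definition divergence :: "(real^'d) set \<Rightarrow> (real^'d \<Rightarrow> real^'d) \<Rightarrow> real^'d \<Rightarrow> real" where
  "divergence M X z =
     (\<Sum>b\<in>Basis. frechet_derivative X (at z within M) (tangent_proj M z b) \<bullet> tangent_proj M z b)"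

definition laplace_beltrami :: "(real^'d) set \<Rightarrow> (real^'d \<Rightarrow> real) \<Rightarrow> real^'d \<Rightarrow> real" where
  "laplace_beltrami M f = divergence M (gradient M f)"

definition weighted_laplacian ::
  "(real^'d) set \<Rightarrow> (real^'d \<Rightarrow> real) \<Rightarrow> (real^'d \<Rightarrow> real) \<Rightarrow> real^'d \<Rightarrow> real" where
  "weighted_laplacian M p f z =
     laplace_beltrami M f z + gradient M (\<lambda>x. ln (p x)) z \<bullet> gradient M f z"

definition volume_element :: "(real^'m \<Rightarrow> real^'d) \<Rightarrow> real^'m \<Rightarrow> real" where
  "volume_element \<psi> x =
     (let J = matrix (frechet_derivative \<psi> (at x)) in sqrt (det (transpose J ** J)))"

text \<open>The Borel space on \<open>M\<close> and the Riemannian volume measure on it. The measure is uniquely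
  determined by the area formula in local parametrizations, since countably many of these cover
  \<open>M\<close>.\<close>

abbreviation borel_on :: "'a::topological_space set \<Rightarrow> 'a measure" where
  "borel_on M \<equiv> restrict_space borel M"

definition riemannian_volume ::
  "'m::finite itself \<Rightarrow> (real^'d) set \<Rightarrow> (real^'d) measure \<Rightarrow> bool" where
  "riemannian_volume m M vol \<longleftrightarrow>
     sets vol = sets (borel_on M) \<and>
     (\<forall>(W::(real^'m) set) \<psi> B. local_param M W \<psi> \<and> B \<in> sets borel \<and> B \<subseteq> W \<longrightarrow>
        emeasure vol (\<psi> ` B) = (\<integral>\<^sup>+x\<in>B. ennreal (volume_element \<psi> x) \<partial>lborel))"


section \<open>Unbounded operators in real \<open>L\<^sup>2\<close>\<close>

text \<open>Elements of \<open>L\<^sup>2(P)\<close> are represented by functions, and an operator by its graph, a set of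
  pairs (argument, value) of such functions.\<close>

definition L2_fun :: "'a measure \<Rightarrow> ('a \<Rightarrow> real) \<Rightarrow> bool" where
  "L2_fun P f \<longleftrightarrow> f \<in> borel_measurable P \<and> integrable P (\<lambda>z. (f z)\<^sup>2)"

definition L2_normsq :: "'a measure \<Rightarrow> ('a \<Rightarrow> 'b::real_normed_vector) \<Rightarrow> real" where
  "L2_normsq P u = (\<integral>z. (norm (u z))\<^sup>2 \<partial>P)"

definition L2_inner :: "'a measure \<Rightarrow> ('a \<Rightarrow> real) \<Rightarrow> ('a \<Rightarrow> real) \<Rightarrow> real" where
  "L2_inner P f g = (\<integral>z. f z * g z \<partial>P)"

type_synonym 'a operator_graph = "(('a \<Rightarrow> real) \<times> ('a \<Rightarrow> real)) set"

definition L2_closure :: "'a measure \<Rightarrow> 'a operator_graph \<Rightarrow> 'a operator_graph" where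
  "L2_closure P G =
     {(f, g). L2_fun P f \<and> L2_fun P g \<and>
        (\<exists>\<phi> \<omega>. (\<forall>n. (\<phi> n, \<omega> n) \<in> G \<and> L2_fun P (\<phi> n) \<and> L2_fun P (\<omega> n)) \<and>
          (\<lambda>n. L2_normsq P (\<lambda>z. \<phi> n z - f z)) \<longlonglongrightarrow> 0 \<and>
          (\<lambda>n. L2_normsq P (\<lambda>z. \<omega> n z - g z)) \<longlonglongrightarrow> 0)}"

definition L2_adjoint :: "'a measure \<Rightarrow> 'a operator_graph \<Rightarrow> 'a operator_graph" where
  "L2_adjoint P G =
     {(u, v). L2_fun P u \<and> L2_fun P v \<and> (\<forall>(f, g)\<in>G. L2_inner P g u = L2_inner P f v)}"

definition densely_defined :: "'a measure \<Rightarrow> 'a operator_graph \<Rightarrow> bool" where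
  "densely_defined P G \<longleftrightarrow>
     (\<forall>u e. L2_fun P u \<and> e > 0 \<longrightarrow> (\<exists>(f, g)\<in>G. L2_normsq P (\<lambda>z. f z - u z) < e))"

definition self_adjoint :: "'a measure \<Rightarrow> 'a operator_graph \<Rightarrow> bool" where
  "self_adjoint P G \<longleftrightarrow> densely_defined P G \<and> L2_adjoint P G = G"

definition resolvent_set :: "'a measure \<Rightarrow> 'a operator_graph \<Rightarrow> real set" where
  "resolvent_set P G =
     {\<mu>. (\<forall>u. L2_fun P u \<longrightarrow> (\<exists>(f, g)\<in>G. AE z in P. g z - \<mu> * f z = u z)) \<and>
         (\<exists>C. \<forall>(f, g)\<in>G. L2_normsq P f \<le> C * L2_normsq P (\<lambda>z. g z - \<mu> * f z))}"

text \<open>Real spectral parameters suffice: the spectrum of a self-adjoint operator is real, and for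
  real parameters invertibility over the reals and after complexification agree.\<close>

definition spectrum :: "'a measure \<Rightarrow> 'a operator_graph \<Rightarrow> real set" where
  "spectrum P G = - resolvent_set P G"

definition eigenspace :: "'a measure \<Rightarrow> 'a operator_graph \<Rightarrow> real \<Rightarrow> ('a \<Rightarrow> real) set" where
  "eigenspace P G \<mu> = {f. L2_fun P f \<and> (f, \<lambda>z. \<mu> * f z) \<in> G}"

definition eigenvalue :: "'a measure \<Rightarrow> 'a operator_graph \<Rightarrow> real \<Rightarrow> bool" where
  "eigenvalue P G \<mu> \<longleftrightarrow> (\<exists>f\<in>eigenspace P G \<mu>. \<not> (AE z in P. f z = 0))"

definition finite_multiplicity :: "'a measure \<Rightarrow> 'a operator_graph \<Rightarrow> real \<Rightarrow> bool" where
  "finite_multiplicity P G \<mu> \<longleftrightarrow>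
     (\<exists>F. finite F \<and> F \<subseteq> eigenspace P G \<mu> \<and>
        (\<forall>f\<in>eigenspace P G \<mu>. \<exists>a. AE z in P. f z = (\<Sum>b\<in>F. a b * b z)))"

text \<open>Discrete spectrum in the sense of spectral theory: the essential spectrum is empty.\<close>

definition discrete_spectrum :: "'a measure \<Rightarrow> 'a operator_graph \<Rightarrow> bool" where
  "discrete_spectrum P G \<longleftrightarrow>
     (\<forall>\<mu>\<in>spectrum P G.
        \<mu> isolated_in spectrum P G \<and> eigenvalue P G \<mu> \<and> finite_multiplicity P G \<mu>)"

definition operator_uminus :: "'a operator_graph \<Rightarrow> 'a operator_graph" where
  "operator_uminus G = (\<lambda>(f, g). (f, \<lambda>z. - g z)) ` G"


section \<open>The weighted Laplacian as an operator in \<open>L\<^sup>2\<close> and the Langevin transition kernels\<close>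

text \<open>The operator in \<open>L\<^sup>2(P)\<close> given by the weighted Laplacian is the closure of its restriction to
  compactly supported smooth functions. Self-adjointness of this closure is essential
  self-adjointness on test functions, so there is then no other self-adjoint realization.\<close>

definition weighted_operator ::
  "(real^'d) set \<Rightarrow> (real^'d \<Rightarrow> real) \<Rightarrow> (real^'d) measure \<Rightarrow> (real^'d) operator_graph" where
  "weighted_operator M p P = L2_closure P {(f, weighted_laplacian M p f) | f. test_function M f}"

abbreviation neg_weighted_operator ::
  "(real^'d) set \<Rightarrow> (real^'d \<Rightarrow> real) \<Rightarrow> (real^'d) measure \<Rightarrow> (real^'d) operator_graph" where
  "neg_weighted_operator M p P \<equiv> operator_uminus (weighted_operator M p P)"

definition transition_operator :: "('a \<Rightarrow> 'a measure) \<Rightarrow> ('a \<Rightarrow> real) \<Rightarrow> 'a \<Rightarrow> real" where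
  "transition_operator k f z = (\<integral>z'. f z' \<partial>k z)"

definition markov_semigroup :: "'a measure \<Rightarrow> (real \<Rightarrow> 'a \<Rightarrow> 'a measure) \<Rightarrow> bool" where
  "markov_semigroup S K \<longleftrightarrow>
     (\<forall>s\<ge>0. K s \<in> S \<rightarrow>\<^sub>M prob_algebra S) \<and>
     (\<forall>z\<in>space S. K 0 z = return S z) \<and>
     (\<forall>r\<ge>0. \<forall>s\<ge>0. \<forall>z\<in>space S. K (r + s) z = K r z \<bind> K s)"

definition stationary :: "'a measure \<Rightarrow> (real \<Rightarrow> 'a \<Rightarrow> 'a measure) \<Rightarrow> bool" where
  "stationary P K \<longleftrightarrow> (\<forall>s\<ge>0. P \<bind> K s = P)"

definition strongly_continuous :: "'a measure \<Rightarrow> (real \<Rightarrow> 'a \<Rightarrow> 'a measure) \<Rightarrow> bool" where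
  "strongly_continuous P K \<longleftrightarrow>
     (\<forall>f. L2_fun P f \<longrightarrow>
        ((\<lambda>s. L2_normsq P (\<lambda>z. transition_operator (K s) f z - f z)) \<longlongrightarrow> 0) (at_right 0))"

definition semigroup_generator ::
  "'a measure \<Rightarrow> (real \<Rightarrow> 'a \<Rightarrow> 'a measure) \<Rightarrow> 'a operator_graph" where
  "semigroup_generator P K =
     {(f, g). L2_fun P f \<and> L2_fun P g \<and>
        ((\<lambda>s. L2_normsq P (\<lambda>z. (transition_operator (K s) f z - f z) / s - g z)) \<longlongrightarrow> 0)
          (at_right 0)}"

text \<open>The transition kernels of the Langevin diffusion: the Markov semigroup on \<open>M\<close> whose transition
  operators \<open>T\<^sub>s\<close> form the strongly continuous semigroup on \<open>L\<^sup>2(P)\<close> generated by the weighted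
  Laplacian \<open>D\<close>, i.e. \<open>T\<^sub>s = exp (s D)\<close>.\<close>

definition langevin_transition_kernels ::
  "(real^'d) set \<Rightarrow> (real^'d \<Rightarrow> real) \<Rightarrow> (real^'d) measure \<Rightarrow>
     (real \<Rightarrow> real^'d \<Rightarrow> (real^'d) measure) \<Rightarrow> bool" where
  "langevin_transition_kernels M p P K \<longleftrightarrow>
     markov_semigroup (borel_on M) K \<and> strongly_continuous P K \<and>
     semigroup_generator P K = weighted_operator M p P"


section \<open>Moments, alignment loss, linear admissibility\<close>

definition covariance_matrix :: "(real^'d) measure \<Rightarrow> real^'d^'d" where
  "covariance_matrix P =
     (\<chi> i j. \<integral>z. (z $ i - (\<integral>x. x $ i \<partial>P)) * (z $ j - (\<integral>x. x $ j \<partial>P)) \<partial>P)"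

definition centered_isotropic :: "(real^'d) measure \<Rightarrow> real \<Rightarrow> bool" where
  "centered_isotropic P c \<longleftrightarrow>
     integrable P (\<lambda>z. (norm z)\<^sup>2) \<and> (\<integral>z. z \<partial>P) = 0 \<and> covariance_matrix P = mat c"

text \<open>In \<open>alignment_loss P k h\<close>, \<open>P\<close> is the law of \<open>Z\<close> and \<open>k z\<close> the conditional law of \<open>Z'\<close> given
  \<open>Z = z\<close>.\<close>

definition alignment_loss ::
  "'a measure \<Rightarrow> ('a \<Rightarrow> 'a measure) \<Rightarrow> ('a \<Rightarrow> real^'d) \<Rightarrow> real" where
  "alignment_loss P k h = (\<integral>z. (\<integral>z'. (norm (h z' - h z))\<^sup>2 \<partial>k z) \<partial>P)"

definition ae_constant :: "'a measure \<Rightarrow> ('a \<Rightarrow> real) \<Rightarrow> bool" where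
  "ae_constant P f \<longleftrightarrow> (\<exists>a. AE z in P. f z = a)"

definition first_nonconstant_eigenvalue :: "'a measure \<Rightarrow> 'a operator_graph \<Rightarrow> real \<Rightarrow> bool" where
  "first_nonconstant_eigenvalue P G \<mu> \<longleftrightarrow>
     (\<exists>f\<in>eigenspace P G \<mu>. \<not> ae_constant P f) \<and>
     (\<forall>\<nu><\<mu>. \<forall>f\<in>eigenspace P G \<nu>. ae_constant P f)"

definition next_eigenvalue :: "'a measure \<Rightarrow> 'a operator_graph \<Rightarrow> real \<Rightarrow> real \<Rightarrow> bool" where
  "next_eigenvalue P G \<mu> \<nu> \<longleftrightarrow>
     \<mu> < \<nu> \<and> eigenvalue P G \<nu> \<and> (\<forall>\<kappa>. \<mu> < \<kappa> \<and> \<kappa> < \<nu> \<longrightarrow> \<not> eigenvalue P G \<kappa>)"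

definition linearly_admissible ::
  "(real^'d) set \<Rightarrow> (real^'d \<Rightarrow> real) \<Rightarrow> (real^'d) measure \<Rightarrow> real \<Rightarrow> bool" where
  "linearly_admissible M p P l \<longleftrightarrow>
     (\<exists>C. \<forall>z\<in>M. p z = C * exp (- (l / 2) * (norm z)\<^sup>2)) \<and>
     (\<forall>z\<in>M. \<forall>i. laplace_beltrami M (\<lambda>x. x $ i) z = - l * normal_part M z $ i) \<and>
     first_nonconstant_eigenvalue P (neg_weighted_operator M p P) l \<and>
     (\<forall>i. (\<lambda>z. z $ i) \<in> eigenspace P (neg_weighted_operator M p P) l) \<and>
     (\<forall>f\<in>eigenspace P (neg_weighted_operator M p P) l. \<exists>a. AE z in P. f z = a \<bullet> z)"

text \<open>The decomposition \<open>h = Az + r\<close> with \<open>r \<perp> span {1, z\<^sub>1, \<dots>, z\<^sub>d}\<close> componentwise in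
  \<open>L\<^sup>2(P)\<close>, for square-integrable \<open>h : M \<rightarrow> \<real>\<^sup>d\<close> (here \<open>space P = M\<close>).\<close>

definition spectral_decomposition ::
  "(real^'d) measure \<Rightarrow> (real^'d \<Rightarrow> real^'d) \<Rightarrow> real^'d^'d \<Rightarrow> (real^'d \<Rightarrow> real^'d) \<Rightarrow> bool" where
  "spectral_decomposition P h A r \<longleftrightarrow>
     h \<in> borel_measurable P \<and> integrable P (\<lambda>z. (norm (h z))\<^sup>2) \<and>
     (\<forall>z\<in>space P. h z = A *v z + r z) \<and>
     (\<forall>i. L2_inner P (\<lambda>z. r z $ i) (\<lambda>z. 1) = 0) \<and>
     (\<forall>i j. L2_inner P (\<lambda>z. r z $ i) (\<lambda>z. z $ j) = 0)"

end

theory Submission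
  imports Defs
begin

text \<open>
  Write \<open>D\<close> for the generator and \<open>T\<^sub>t = e\<^sup>t\<^sup>D\<close>. By stationarity the alignment loss of \<open>g\<close> is
  \<open>2 \<parallel>g\<parallel>\<^sup>2 - 2 \<Sum>\<^sub>i \<langle>T\<^sub>t g\<^sub>i, g\<^sub>i\<rangle>\<close>, so the spectral inequality amounts to \<open>\<parallel>T\<^sub>t r\<parallel> \<le> e\<^sup>-\<^sup>\<lambda>\<^sup>'\<^sup>t \<parallel>r\<parallel>\<close> on
  \<open>V = {1, z\<^sub>1, \<dots>, z\<^sub>d}\<^sup>\<bottom>\<close>, where \<open>\<lambda>'\<close> is the next eigenvalue. Differentiating \<open>\<parallel>T\<^sub>t r\<parallel>\<^sup>2\<close> reduces this to
  \<open>-D \<ge> \<lambda>'\<close> on \<open>V\<close>.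

  No spectral theorem is needed for the latter. If \<open>(a, b)\<close> lies in the resolvent set of a
  self-adjoint \<open>H\<close>, then \<open>(H - a)(H - b) \<ge> 0\<close>: otherwise the infimum \<open>k\<^sup>2\<close> of \<open>\<parallel>(H - m) f\<parallel>\<^sup>2 / \<parallel>f\<parallel>\<^sup>2\<close>,
  \<open>m = (a + b) / 2\<close>, is below \<open>((b - a) / 2)\<^sup>2\<close>, so that \<open>(H - m)\<^sup>2 - k\<^sup>2 \<ge> 0\<close> has a bounded inverse, and
  Cauchy--Schwarz for its quadratic form contradicts the choice of \<open>k\<close>. If moreover \<open>H \<ge> a\<close> on \<open>V\<close>
  and \<open>a\<close> has no eigenvector in \<open>V\<close>, then \<open>H - a\<close> has dense range in \<open>V\<close>, and a further use of
  Cauchy--Schwarz gives \<open>H \<ge> b\<close> on \<open>V\<close>. Since the spectrum consists of eigenvalues, this applies to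
  the gaps \<open>(0, \<lambda>)\<close> and \<open>(\<lambda>, \<lambda>')\<close>.

  For the orthogonal approximation, \<open>h\<^sub># p = p\<close> gives \<open>I - A A\<^sup>T = Cov r / c\<close>, whose Frobenius norm is at
  most its trace \<open>\<parallel>r\<parallel>\<^sup>2 / c\<close>, and the orthogonal polar factor \<open>Q\<close> of \<open>A\<close> satisfies
  \<open>\<parallel>A - Q\<parallel> \<le> \<parallel>I - A A\<^sup>T\<parallel>\<close>.
\<close>


section \<open>Square-integrable functions\<close>

lemma L2_fun_add:
  assumes "L2_fun P f" "L2_fun P g"
  shows "L2_fun P (\<lambda>z. f z + g z)"
proof -
  have [measurable]: "f \<in> borel_measurable P" "g \<in> borel_measurable P"
    using assms by (auto simp: L2_fun_def)
  have "integrable P (\<lambda>z. 2 * (f z)\<^sup>2 + 2 * (g z)\<^sup>2)"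
    using assms by (auto simp: L2_fun_def)
  then have "integrable P (\<lambda>z. (f z + g z)\<^sup>2)"
  proof (rule Bochner_Integration.integrable_bound)
    show "AE z in P. norm ((f z + g z)\<^sup>2) \<le> norm (2 * (f z)\<^sup>2 + 2 * (g z)\<^sup>2)"
    proof (intro AE_I2)
      fix z
      have "(f z + g z)\<^sup>2 \<le> 2 * (f z)\<^sup>2 + 2 * (g z)\<^sup>2"
        using sum_squares_bound[of "f z" "g z"] by (simp add: power2_sum)
      then show "norm ((f z + g z)\<^sup>2) \<le> norm (2 * (f z)\<^sup>2 + 2 * (g z)\<^sup>2)"
        by simp
    qed
  qed simp
  then show ?thesis by (simp add: L2_fun_def)
qed

lemma L2_fun_scale: "L2_fun P f \<Longrightarrow> L2_fun P (\<lambda>z. a * f z)"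
  by (auto simp: L2_fun_def power_mult_distrib)

lemma L2_fun_uminus: "L2_fun P f \<Longrightarrow> L2_fun P (\<lambda>z. - f z)"
  using L2_fun_scale[of P f "-1"] by simp

lemma L2_fun_diff: "L2_fun P f \<Longrightarrow> L2_fun P g \<Longrightarrow> L2_fun P (\<lambda>z. f z - g z)"
  using L2_fun_add[of P f "\<lambda>z. - g z"] L2_fun_uminus[of P g] by simp

lemma L2_fun_divide: "L2_fun P f \<Longrightarrow> L2_fun P (\<lambda>z. f z / a)"
  using L2_fun_scale[of P f "inverse a"] by (simp add: field_simps)

lemma L2_fun_zero: "L2_fun P (\<lambda>z. 0)"
  by (simp add: L2_fun_def)

lemma L2_fun_sum: "(\<And>i. i \<in> I \<Longrightarrow> L2_fun P (f i)) \<Longrightarrow> L2_fun P (\<lambda>z. \<Sum>i\<in>I. f i z)"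
  by (induction I rule: infinite_finite_induct) (auto intro: L2_fun_zero L2_fun_add)

lemmas L2_fun_intros =
  L2_fun_add L2_fun_scale L2_fun_uminus L2_fun_diff L2_fun_divide L2_fun_zero L2_fun_sum

lemma (in finite_measure) L2_fun_const: "L2_fun M (\<lambda>z. a)"
  by (simp add: L2_fun_def)

lemma L2_fun_cong_AE:
  assumes "L2_fun P f" "AE z in P. f z = g z" "g \<in> borel_measurable P"
  shows "L2_fun P g"
proof -
  have "integrable P (\<lambda>z. (g z)\<^sup>2)"
    using assms by (subst integrable_cong_AE[where g="\<lambda>z. (f z)\<^sup>2"]) (auto simp: L2_fun_def)
  then show ?thesis using assms by (simp add: L2_fun_def)
qed

text \<open>Polarization writes the product as a combination of three integrable squares.\<close>

lemma L2_fun_integrable_mult: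
  assumes "L2_fun P f" "L2_fun P g"
  shows "integrable P (\<lambda>z. f z * g z)"
proof -
  have "integrable P (\<lambda>z. ((f z + g z)\<^sup>2 - (f z)\<^sup>2 - (g z)\<^sup>2) / 2)"
    using assms L2_fun_add[OF assms] by (auto simp: L2_fun_def)
  moreover have "(\<lambda>z. ((f z + g z)\<^sup>2 - (f z)\<^sup>2 - (g z)\<^sup>2) / 2) = (\<lambda>z. f z * g z)"
    by (auto simp: power2_sum)
  ultimately show ?thesis by simp
qed

lemma (in finite_measure) L2_fun_integrable: "L2_fun M f \<Longrightarrow> integrable M f"
  using L2_fun_integrable_mult[OF _ L2_fun_const[of 1], of f] by simp

section \<open>The inner product and its bilinear calculus\<close>

lemma L2_inner_commute: "L2_inner P f g = L2_inner P g f"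
  by (simp add: L2_inner_def mult.commute)

lemma L2_inner_add_left:
  "L2_fun P f \<Longrightarrow> L2_fun P g \<Longrightarrow> L2_fun P h \<Longrightarrow>
    L2_inner P (\<lambda>z. f z + g z) h = L2_inner P f h + L2_inner P g h"
  by (simp add: L2_inner_def L2_fun_integrable_mult distrib_right)

lemma L2_inner_scale_left: "L2_inner P (\<lambda>z. a * f z) h = a * L2_inner P f h"
  by (simp add: L2_inner_def mult.assoc)

lemma L2_inner_uminus_left: "L2_inner P (\<lambda>z. - f z) h = - L2_inner P f h"
  using L2_inner_scale_left[of P "-1" f h] by simp

lemma L2_inner_diff_left:
  "L2_fun P f \<Longrightarrow> L2_fun P g \<Longrightarrow> L2_fun P h \<Longrightarrow>
    L2_inner P (\<lambda>z. f z - g z) h = L2_inner P f h - L2_inner P g h"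
  by (simp add: L2_inner_def L2_fun_integrable_mult left_diff_distrib)

lemma L2_inner_divide_left: "L2_inner P (\<lambda>z. f z / a) h = L2_inner P f h / a"
  by (simp add: L2_inner_def)

lemma L2_inner_zero_left: "L2_inner P (\<lambda>z. 0) h = 0"
  by (simp add: L2_inner_def)

lemma L2_inner_sum_left:
  "(\<And>i. i \<in> I \<Longrightarrow> L2_fun P (f i)) \<Longrightarrow> L2_fun P h \<Longrightarrow>
    L2_inner P (\<lambda>z. \<Sum>i\<in>I. f i z) h = (\<Sum>i\<in>I. L2_inner P (f i) h)"
  by (simp add: L2_inner_def sum_distrib_right L2_fun_integrable_mult)

lemma L2_inner_add_right:
  "L2_fun P f \<Longrightarrow> L2_fun P g \<Longrightarrow> L2_fun P h \<Longrightarrow>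
    L2_inner P h (\<lambda>z. f z + g z) = L2_inner P h f + L2_inner P h g"
  by (simp add: L2_inner_commute[of P h] L2_inner_add_left)

lemma L2_inner_scale_right: "L2_inner P h (\<lambda>z. a * f z) = a * L2_inner P h f"
  by (simp add: L2_inner_commute[of P h] L2_inner_scale_left)

lemma L2_inner_uminus_right: "L2_inner P h (\<lambda>z. - f z) = - L2_inner P h f"
  by (simp add: L2_inner_commute[of P h] L2_inner_uminus_left)

lemma L2_inner_diff_right:
  "L2_fun P f \<Longrightarrow> L2_fun P g \<Longrightarrow> L2_fun P h \<Longrightarrow>
    L2_inner P h (\<lambda>z. f z - g z) = L2_inner P h f - L2_inner P h g"
  by (simp add: L2_inner_commute[of P h] L2_inner_diff_left)

lemma L2_inner_divide_right: "L2_inner P h (\<lambda>z. f z / a) = L2_inner P h f / a"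
  by (simp add: L2_inner_commute[of P h] L2_inner_divide_left)

lemma L2_inner_zero_right: "L2_inner P h (\<lambda>z. 0) = 0"
  by (simp add: L2_inner_def)

lemma L2_inner_sum_right:
  "(\<And>i. i \<in> I \<Longrightarrow> L2_fun P (f i)) \<Longrightarrow> L2_fun P h \<Longrightarrow>
    L2_inner P h (\<lambda>z. \<Sum>i\<in>I. f i z) = (\<Sum>i\<in>I. L2_inner P h (f i))"
  by (simp add: L2_inner_commute[of P h] L2_inner_sum_left)

lemmas L2_inner_linear =
  L2_inner_add_left L2_inner_scale_left L2_inner_uminus_left L2_inner_diff_left
  L2_inner_divide_left L2_inner_zero_left L2_inner_sum_left
  L2_inner_add_right L2_inner_scale_right L2_inner_uminus_right L2_inner_diff_right
  L2_inner_divide_right L2_inner_zero_right L2_inner_sum_right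

lemma L2_inner_cong_AE:
  assumes "AE z in P. f z = f' z" "AE z in P. g z = g' z"
    "f \<in> borel_measurable P" "f' \<in> borel_measurable P"
    "g \<in> borel_measurable P" "g' \<in> borel_measurable P"
  shows "L2_inner P f g = L2_inner P f' g'"
  unfolding L2_inner_def
proof (rule integral_cong_AE)
  show "AE z in P. f z * g z = f' z * g' z"
    using assms(1,2) by eventually_elim simp
qed (use assms in auto)

lemma L2_normsq_eq_inner: "L2_normsq P f = L2_inner P f f"
  by (simp add: L2_normsq_def L2_inner_def power2_eq_square)

lemma L2_inner_self_nonneg: "L2_inner P f f \<ge> 0"
  by (simp add: L2_inner_def)

lemma L2_inner_self_eq_0_iff:
  assumes "L2_fun P f"
  shows "L2_inner P f f = 0 \<longleftrightarrow> (AE z in P. f z = 0)"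
  using integral_nonneg_eq_0_iff_AE[OF L2_fun_integrable_mult[OF assms assms]]
  by (simp add: L2_inner_def)

text \<open>This is Cauchy-Schwarz with the form stripped away: a nonnegative quadratic form
  evaluated along a line gives such a polynomial, so operators can be handled without setting up
  their forms first. For c > 0 the minimum is at -b / c; c < 0 is ruled out by a large argument.
  With a = 0 the bound forces b = 0.\<close>

lemma discriminant_bound:
  fixes a b c :: real
  assumes "\<And>x. a + 2 * b * x + c * x\<^sup>2 \<ge> 0"
  shows "b\<^sup>2 \<le> a * c"
proof (cases "c = 0")
  case True
  have "b = 0"
  proof (rule ccontr)
    assume "b \<noteq> 0"
    then show False using assms[of "- (a + 1) / (2 * b)"] True by (simp add: field_simps)
  qed
  then show ?thesis using True by simp
next
  case False
  have "c \<ge> 0"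
  proof (rule ccontr)
    assume "\<not> c \<ge> 0"
    \<comment> \<open>The quotient makes -c x exceed |a| + 2 |b| + 1 and the summand 1 makes x at
      least 1, so that the square outweighs the constant and the linear term.\<close>
    define x where "x = (\<bar>a\<bar> + 2 * \<bar>b\<bar> + 1) / (- c) + 1"
    have x1: "x \<ge> 1" and cx: "- c * x \<ge> \<bar>a\<bar> + 2 * \<bar>b\<bar> + 1"
      using \<open>\<not> c \<ge> 0\<close> by (auto simp: x_def field_simps)
    have "- c * x\<^sup>2 \<ge> (\<bar>a\<bar> + 2 * \<bar>b\<bar> + 1) * x"
      using mult_right_mono[OF cx, of x] x1 by (simp add: power2_eq_square mult.assoc)
    moreover have "(\<bar>a\<bar> + 2 * \<bar>b\<bar> + 1) * x = \<bar>a\<bar> * x + 2 * (\<bar>b\<bar> * x) + x"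
      by (simp add: algebra_simps)
    moreover have "\<bar>a\<bar> * x \<ge> a" using mult_left_mono[OF x1, of "\<bar>a\<bar>"] by simp
    moreover have "\<bar>b\<bar> * x \<ge> b * x" using x1 by (intro mult_right_mono) auto
    moreover have "0 \<le> a + 2 * b * x + c * x\<^sup>2" by (rule assms)
    moreover have "2 * b * x = 2 * (b * x)" by simp
    ultimately show False using x1 by linarith
  qed
  then have "c > 0" using False by simp
  have "a + 2 * b * (- b / c) + c * (- b / c)\<^sup>2 = a - b\<^sup>2 / c"
    using \<open>c > 0\<close> by (simp add: power2_eq_square field_simps)
  then have "a - b\<^sup>2 / c \<ge> 0" using assms[of "- b / c"] by simp
  then show ?thesis using \<open>c > 0\<close> by (simp add: field_simps)
qed

lemma L2_inner_add_scale_self: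
  assumes "L2_fun P f" "L2_fun P g"
  shows "L2_inner P (\<lambda>z. f z + x * g z) (\<lambda>z. f z + x * g z)
    = L2_inner P f f + 2 * x * L2_inner P f g + x\<^sup>2 * L2_inner P g g"
  using assms
  by (simp add: L2_inner_linear L2_fun_intros L2_inner_commute[of P g f] power2_eq_square algebra_simps)

lemma L2_Cauchy_Schwarz:
  assumes "L2_fun P f" "L2_fun P g"
  shows "(L2_inner P f g)\<^sup>2 \<le> L2_inner P f f * L2_inner P g g"
proof (rule discriminant_bound)
  fix x
  have "0 \<le> L2_inner P (\<lambda>z. f z + x * g z) (\<lambda>z. f z + x * g z)" by (rule L2_inner_self_nonneg)
  also have "\<dots> = L2_inner P f f + 2 * L2_inner P f g * x + L2_inner P g g * x\<^sup>2"
    using assms by (simp add: L2_inner_add_scale_self)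
  finally show "0 \<le> L2_inner P f f + 2 * L2_inner P f g * x + L2_inner P g g * x\<^sup>2" .
qed

section \<open>Mean-square convergence, completeness and projection\<close>

lemma L2_inner_add_self_le:
  assumes "L2_fun P f" "L2_fun P g"
  shows "L2_inner P (\<lambda>z. f z + g z) (\<lambda>z. f z + g z) \<le> 2 * L2_inner P f f + 2 * L2_inner P g g"
proof -
  have "0 \<le> L2_inner P (\<lambda>z. f z - g z) (\<lambda>z. f z - g z)" by (rule L2_inner_self_nonneg)
  then show ?thesis
    using assms by (simp add: L2_inner_linear L2_fun_intros L2_inner_commute[of P g f])
qed

text \<open>Membership in L2 is demanded eventually because a non-integrable square has Bochner
  integral 0, so the limit alone would not control such terms. The filter is arbitrary to serve
  sequences as well as times approaching a point.\<close>

definition L2_tendsto :: "'a measure \<Rightarrow> ('b \<Rightarrow> 'a \<Rightarrow> real) \<Rightarrow> ('a \<Rightarrow> real) \<Rightarrow> 'b filter \<Rightarrow> bool" where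
  "L2_tendsto P u f F \<longleftrightarrow> L2_fun P f \<and> (\<forall>\<^sub>F n in F. L2_fun P (u n)) \<and>
     ((\<lambda>n. L2_inner P (\<lambda>z. u n z - f z) (\<lambda>z. u n z - f z)) \<longlongrightarrow> 0) F"

lemma L2_tendsto_squeeze:
  assumes "L2_fun P f" "\<forall>\<^sub>F n in F. L2_fun P (u n)"
    "\<forall>\<^sub>F n in F. L2_inner P (\<lambda>z. u n z - f z) (\<lambda>z. u n z - f z) \<le> b n" "(b \<longlongrightarrow> 0) F"
  shows "L2_tendsto P u f F"
  unfolding L2_tendsto_def
  using assms(1,2) tendsto_sandwich[OF _ assms(3) tendsto_const assms(4)]
  by (simp add: L2_inner_self_nonneg)

lemma L2_tendsto_const: "L2_fun P f \<Longrightarrow> L2_tendsto P (\<lambda>n. f) f F"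
  by (simp add: L2_tendsto_def L2_inner_zero_left)

lemma L2_tendsto_add:
  assumes "L2_tendsto P u f F" "L2_tendsto P v g F"
  shows "L2_tendsto P (\<lambda>n z. u n z + v n z) (\<lambda>z. f z + g z) F"
proof (rule L2_tendsto_squeeze)
  let ?b = "\<lambda>n. 2 * L2_inner P (\<lambda>z. u n z - f z) (\<lambda>z. u n z - f z)
      + 2 * L2_inner P (\<lambda>z. v n z - g z) (\<lambda>z. v n z - g z)"
  have ev: "\<forall>\<^sub>F n in F. L2_fun P (u n) \<and> L2_fun P (v n)"
    using assms by (auto simp: L2_tendsto_def intro: eventually_conj)
  show "L2_fun P (\<lambda>z. f z + g z)" using assms by (auto simp: L2_tendsto_def intro: L2_fun_add)
  show "\<forall>\<^sub>F n in F. L2_fun P (\<lambda>z. u n z + v n z)"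
    using ev by eventually_elim (auto intro: L2_fun_add)
  show "\<forall>\<^sub>F n in F. L2_inner P (\<lambda>z. u n z + v n z - (f z + g z)) (\<lambda>z. u n z + v n z - (f z + g z)) \<le> ?b n"
    using ev
  proof eventually_elim
    case (elim n)
    have "(\<lambda>z. u n z + v n z - (f z + g z)) = (\<lambda>z. (u n z - f z) + (v n z - g z))" by auto
    then show ?case
      using L2_inner_add_self_le[of P "\<lambda>z. u n z - f z" "\<lambda>z. v n z - g z"] elim assms
      by (auto simp: L2_tendsto_def L2_fun_intros)
  qed
  have "(?b \<longlongrightarrow> 2 * 0 + 2 * 0) F"
    using assms by (intro tendsto_intros) (auto simp: L2_tendsto_def)
  then show "(?b \<longlongrightarrow> 0) F" by simp
qed

lemma L2_tendsto_inner:
  assumes "L2_tendsto P u f F" "L2_tendsto P v g F"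
  shows "((\<lambda>n. L2_inner P (u n) (v n)) \<longlongrightarrow> L2_inner P f g) F"
proof -
  have fg: "L2_fun P f" "L2_fun P g" using assms by (auto simp: L2_tendsto_def)
  define a where "a n = L2_inner P (\<lambda>z. u n z - f z) (\<lambda>z. u n z - f z)" for n
  define b where "b n = L2_inner P (\<lambda>z. v n z - g z) (\<lambda>z. v n z - g z)" for n
  have lim: "(a \<longlongrightarrow> 0) F" "(b \<longlongrightarrow> 0) F"
    using assms by (auto simp: L2_tendsto_def a_def[abs_def] b_def[abs_def])
  \<comment> \<open>Cauchy-Schwarz bounds for <u - f, v - g>, <u - f, g> and <f, v - g>, whose sum
    is the difference of the inner products.\<close>
  let ?e = "\<lambda>n. sqrt (a n * b n) + sqrt (a n * L2_inner P g g) + sqrt (L2_inner P f f * b n)"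
  have ev: "\<forall>\<^sub>F n in F. L2_fun P (u n) \<and> L2_fun P (v n)"
    using assms by (auto simp: L2_tendsto_def intro: eventually_conj)
  have "(?e \<longlongrightarrow> sqrt (0 * 0) + sqrt (0 * L2_inner P g g) + sqrt (L2_inner P f f * 0)) F"
    by (intro tendsto_intros lim)
  then have lim_e: "(?e \<longlongrightarrow> 0) F" by simp
  have "((\<lambda>n. L2_inner P (u n) (v n) - L2_inner P f g) \<longlongrightarrow> 0) F"
  proof (rule Lim_null_comparison[OF _ lim_e])
    show "\<forall>\<^sub>F n in F. norm (L2_inner P (u n) (v n) - L2_inner P f g) \<le> ?e n"
      using ev
    proof eventually_elim
      case (elim n)
      have *: "\<bar>L2_inner P x y\<bar> \<le> sqrt (L2_inner P x x * L2_inner P y y)"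
        if "L2_fun P x" "L2_fun P y" for x y
        using L2_Cauchy_Schwarz[OF that] by (simp add: real_le_rsqrt)
      have d: "L2_fun P (\<lambda>z. u n z - f z)" "L2_fun P (\<lambda>z. v n z - g z)"
        using elim fg by (auto intro: L2_fun_diff)
      have "L2_inner P (u n) (v n) - L2_inner P f g =
         L2_inner P (\<lambda>z. u n z - f z) (\<lambda>z. v n z - g z) + L2_inner P (\<lambda>z. u n z - f z) g
          + L2_inner P f (\<lambda>z. v n z - g z)"
        using elim fg by (simp add: L2_inner_linear L2_fun_intros)
      then show ?case
        using *[OF d] *[OF d(1) fg(2)] *[OF fg(1) d(2)] by (simp add: a_def b_def)
    qed
  qed
  then show ?thesis by (simp add: LIM_zero_iff)
qed

text \<open>The scalars may vary along the filter: later they are inner products converging to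
  projection coefficients, or time increments tending to 0.\<close>

lemma L2_tendsto_scale:
  assumes "L2_tendsto P u f F" "(a \<longlongrightarrow> b) F"
  shows "L2_tendsto P (\<lambda>n z. a n * u n z) (\<lambda>z. b * f z) F"
  unfolding L2_tendsto_def
proof (intro conjI)
  have f: "L2_fun P f" using assms by (simp add: L2_tendsto_def)
  have ev: "\<forall>\<^sub>F n in F. L2_fun P (u n)" using assms by (simp add: L2_tendsto_def)
  show "L2_fun P (\<lambda>z. b * f z)" using f by (rule L2_fun_scale)
  show "\<forall>\<^sub>F n in F. L2_fun P (\<lambda>z. a n * u n z)"
    using ev by eventually_elim (rule L2_fun_scale)
  have "((\<lambda>n. (a n)\<^sup>2 * L2_inner P (u n) (u n) - 2 * a n * b * L2_inner P (u n) f + b\<^sup>2 * L2_inner P f f)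
     \<longlongrightarrow> b\<^sup>2 * L2_inner P f f - 2 * b * b * L2_inner P f f + b\<^sup>2 * L2_inner P f f) F"
    using assms f by (intro tendsto_intros L2_tendsto_inner) (auto intro: L2_tendsto_const)
  then have "((\<lambda>n. (a n)\<^sup>2 * L2_inner P (u n) (u n) - 2 * a n * b * L2_inner P (u n) f + b\<^sup>2 * L2_inner P f f)
     \<longlongrightarrow> 0) F" by (simp add: power2_eq_square)
  then show "((\<lambda>n. L2_inner P (\<lambda>z. a n * u n z - b * f z) (\<lambda>z. a n * u n z - b * f z)) \<longlongrightarrow> 0) F"
  proof (rule Lim_transform_eventually)
    show "\<forall>\<^sub>F n in F. (a n)\<^sup>2 * L2_inner P (u n) (u n) - 2 * a n * b * L2_inner P (u n) f + b\<^sup>2 * L2_inner P f f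
       = L2_inner P (\<lambda>z. a n * u n z - b * f z) (\<lambda>z. a n * u n z - b * f z)"
      using ev
    proof eventually_elim
      case (elim n)
      then show ?case
        by (simp add: f L2_inner_linear L2_fun_intros L2_inner_commute[of P f "u n"] power2_eq_square
            algebra_simps)
    qed
  qed
qed

lemma L2_tendsto_diff:
  assumes "L2_tendsto P u f F" "L2_tendsto P v g F"
  shows "L2_tendsto P (\<lambda>n z. u n z - v n z) (\<lambda>z. f z - g z) F"
  using L2_tendsto_add[OF assms(1) L2_tendsto_scale[OF assms(2) tendsto_const[of "-1"]]] by simp

lemma L2_tendsto_sum:
  assumes "finite I" "\<And>i. i \<in> I \<Longrightarrow> L2_tendsto P (u i) (f i) F"
  shows "L2_tendsto P (\<lambda>n z. \<Sum>i\<in>I. u i n z) (\<lambda>z. \<Sum>i\<in>I. f i z) F"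
  using assms
  by (induction I rule: finite_induct) (auto intro: L2_tendsto_const L2_fun_zero L2_tendsto_add)

lemma L2_tendsto_cong_AE:
  assumes "L2_tendsto P u f F" "AE z in P. f z = g z" "L2_fun P g"
  shows "L2_tendsto P u g F"
  unfolding L2_tendsto_def
proof (intro conjI)
  have f: "L2_fun P f" and ev: "\<forall>\<^sub>F n in F. L2_fun P (u n)"
    and lim: "((\<lambda>n. L2_inner P (\<lambda>z. u n z - f z) (\<lambda>z. u n z - f z)) \<longlongrightarrow> 0) F"
    using assms by (auto simp: L2_tendsto_def)
  show "\<forall>\<^sub>F n in F. L2_fun P (u n)" by (rule ev)
  show "((\<lambda>n. L2_inner P (\<lambda>z. u n z - g z) (\<lambda>z. u n z - g z)) \<longlongrightarrow> 0) F"
  proof (rule Lim_transform_eventually[OF lim])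
    show "\<forall>\<^sub>F n in F. L2_inner P (\<lambda>z. u n z - f z) (\<lambda>z. u n z - f z)
        = L2_inner P (\<lambda>z. u n z - g z) (\<lambda>z. u n z - g z)"
      using ev
    proof eventually_elim
      case (elim n)
      then have "u n \<in> borel_measurable P" "f \<in> borel_measurable P" "g \<in> borel_measurable P"
        using f assms(3) by (auto simp: L2_fun_def)
      then show ?case using assms(2) by (intro L2_inner_cong_AE) auto
    qed
  qed
qed (rule assms)

text \<open>Semigroup identities hold only almost everywhere and for nonnegative times, so
  difference quotients are replaced in this weakened sense.\<close>

lemma L2_tendsto_cong_eventually:
  assumes "L2_tendsto P u f F"
    "\<forall>\<^sub>F n in F. (AE z in P. u n z = v n z) \<and> v n \<in> borel_measurable P"
  shows "L2_tendsto P v f F"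
  unfolding L2_tendsto_def
proof (intro conjI)
  have f: "L2_fun P f" and ev: "\<forall>\<^sub>F n in F. L2_fun P (u n)"
    and lim: "((\<lambda>n. L2_inner P (\<lambda>z. u n z - f z) (\<lambda>z. u n z - f z)) \<longlongrightarrow> 0) F"
    using assms by (auto simp: L2_tendsto_def)
  show "L2_fun P f" by (rule f)
  show "\<forall>\<^sub>F n in F. L2_fun P (v n)"
    using ev assms(2) by eventually_elim (auto intro: L2_fun_cong_AE)
  show "((\<lambda>n. L2_inner P (\<lambda>z. v n z - f z) (\<lambda>z. v n z - f z)) \<longlongrightarrow> 0) F"
  proof (rule Lim_transform_eventually[OF lim])
    show "\<forall>\<^sub>F n in F. L2_inner P (\<lambda>z. u n z - f z) (\<lambda>z. u n z - f z)
        = L2_inner P (\<lambda>z. v n z - f z) (\<lambda>z. v n z - f z)"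
      using ev assms(2)
    proof eventually_elim
      case (elim n)
      then have "u n \<in> borel_measurable P" "f \<in> borel_measurable P" "v n \<in> borel_measurable P"
        using f by (auto simp: L2_fun_def)
      then show ?case using elim by (intro L2_inner_cong_AE) auto
    qed
  qed
qed

text \<open>The Riesz-Fischer argument: a subsequence with summable increments converges almost
  everywhere, because on a probability space the L1 norm is at most the L2 norm, and Fatou's lemma
  carries the Cauchy estimate over to the limit.\<close>

theorem (in prob_space) L2_complete:
  assumes u: "\<And>n::nat. L2_fun M (u n)"
    and cauchy: "\<And>e. e > 0 \<Longrightarrow> \<exists>N. \<forall>m\<ge>N. \<forall>n\<ge>N. L2_inner M (\<lambda>z. u m z - u n z) (\<lambda>z. u m z - u n z) < e"
  shows "\<exists>f. L2_tendsto M u f sequentially"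
proof -
  have [measurable]: "u n \<in> borel_measurable M" for n using u by (simp add: L2_fun_def)
  \<comment> \<open>Squared distances below (1/4)^k give increments of norm at most (1/2)^k, which
    are summable.\<close>
  have "\<forall>k. \<exists>N. \<forall>m\<ge>N. \<forall>n\<ge>N. L2_inner M (\<lambda>z. u m z - u n z) (\<lambda>z. u m z - u n z) < (1/4)^k"
    by (intro allI cauchy) simp
  then obtain N where N: "\<And>k m n. m \<ge> N k \<Longrightarrow> n \<ge> N k \<Longrightarrow>
      L2_inner M (\<lambda>z. u m z - u n z) (\<lambda>z. u m z - u n z) < (1/4)^k"
    by metis
  \<comment> \<open>Partial sums make \<open>r\<close> nondecreasing and at least
    \<open>N k\<close>, and the successor gives \<open>r k \<ge> k\<close>, so the subsequence
    passes every index in the Fatou step.\<close>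
  define r where "r k = (\<Sum>i\<le>k. Suc (N i))" for k
  have r_N: "r k \<ge> N k" for k
    using member_le_sum[of k "{..k}" "\<lambda>i. Suc (N i)"] by (simp add: r_def)
  have r_Suc: "r (Suc k) \<ge> r k" "r k \<ge> k" for k
    unfolding r_def by (auto, induction k, auto)
  define d where "d k z = \<bar>u (r (Suc k)) z - u (r k) z\<bar>" for k z
  have [measurable]: "d k \<in> borel_measurable M" for k unfolding d_def[abs_def] by measurable
  have d_L2: "L2_fun M (d k)" for k
    using L2_fun_diff[OF u u, of "r (Suc k)" "r k"] by (simp add: L2_fun_def d_def[abs_def])
  have d_le: "integral\<^sup>L M (d k) \<le> (1/2)^k" for k
  proof -
    have "(L2_inner M (d k) (\<lambda>z. 1))\<^sup>2 \<le> L2_inner M (d k) (d k) * L2_inner M (\<lambda>z. 1) (\<lambda>z. 1)"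
      by (intro L2_Cauchy_Schwarz d_L2 L2_fun_const)
    also have "L2_inner M (d k) (d k)
        = L2_inner M (\<lambda>z. u (r (Suc k)) z - u (r k) z) (\<lambda>z. u (r (Suc k)) z - u (r k) z)"
      by (simp add: L2_inner_def d_def abs_mult_self_eq)
    also have "\<dots> * L2_inner M (\<lambda>z. 1) (\<lambda>z. 1) < (1/4)^k"
      using N[of k "r (Suc k)" "r k"] r_N[of k] r_Suc(1)[of k] by (simp add: L2_inner_def prob_space)
    finally have "(integral\<^sup>L M (d k))\<^sup>2 \<le> ((1/2)^k)\<^sup>2"
      by (simp add: L2_inner_def power2_eq_square flip: power_mult_distrib)
    then show ?thesis by (rule power2_le_imp_le) simp
  qed
  have "(\<integral>\<^sup>+z. (\<Sum>k. ennreal (d k z)) \<partial>M) = (\<Sum>k. \<integral>\<^sup>+z. ennreal (d k z) \<partial>M)"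
    by (rule nn_integral_suminf) simp
  also have "\<dots> \<le> (\<Sum>k. ennreal ((1/2)^k))"
  proof (rule suminf_le)
    fix k
    have "(\<integral>\<^sup>+z. ennreal (d k z) \<partial>M) = ennreal (integral\<^sup>L M (d k))"
      by (intro nn_integral_eq_integral L2_fun_integrable d_L2) (simp add: d_def)
    then show "(\<integral>\<^sup>+z. ennreal (d k z) \<partial>M) \<le> ennreal ((1/2)^k)" using d_le[of k] by (simp add: ennreal_leI)
  qed auto
  also have "\<dots> = ennreal 2"
    using geometric_sums[of "1/2::real"] by (intro suminf_ennreal_eq) simp_all
  finally have "(\<integral>\<^sup>+z. (\<Sum>k. ennreal (d k z)) \<partial>M) < \<infinity>" by (simp add: le_less_trans)
  then have "AE z in M. (\<Sum>k. ennreal (d k z)) \<noteq> \<infinity>"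
    by (intro nn_integral_PInf_AE) auto
  then have conv: "AE z in M. (\<lambda>k. u (r k) z) \<longlonglongrightarrow> lim (\<lambda>k. u (r k) z)"
  proof eventually_elim
    case (elim z)
    have "0 \<le> d k z" for k by (simp add: d_def)
    then have "summable (\<lambda>k. d k z)"
      using elim unfolding infinity_ennreal_def by (rule summable_suminf_not_top)
    then have "summable (\<lambda>k. u (r (Suc k)) z - u (r k) z)"
      by (subst summable_rabs_cancel) (simp_all add: d_def)
    then have "convergent (\<lambda>n. \<Sum>k<n. u (r (Suc k)) z - u (r k) z)"
      by (simp add: summable_iff_convergent)
    then have "convergent (\<lambda>n. u (r n) z - u (r 0) z)" by (simp add: sum_lessThan_telescope[of "\<lambda>k. u (r k) z"])
    then have "convergent (\<lambda>n. u (r n) z)" by (simp add: convergent_diff_const_right_iff)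
    then show ?case by (simp add: convergent_LIMSEQ_iff)
  qed
  define f where "f z = lim (\<lambda>k. u (r k) z)" for z
  have [measurable]: "f \<in> borel_measurable M"
    unfolding f_def[abs_def] by (rule borel_measurable_lim_metric) simp
  have fatou: "L2_fun M (\<lambda>z. u m z - f z) \<and> L2_inner M (\<lambda>z. u m z - f z) (\<lambda>z. u m z - f z) \<le> e"
    if e: "\<forall>n\<ge>K. L2_inner M (\<lambda>z. u m z - u n z) (\<lambda>z. u m z - u n z) \<le> e" "e \<ge> 0" for m K e
  proof -
    have "(\<integral>\<^sup>+z. ennreal ((u m z - f z)\<^sup>2) \<partial>M) = (\<integral>\<^sup>+z. liminf (\<lambda>k. ennreal ((u m z - u (r k) z)\<^sup>2)) \<partial>M)"
    proof (rule nn_integral_cong_AE)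
      show "AE z in M. ennreal ((u m z - f z)\<^sup>2) = liminf (\<lambda>k. ennreal ((u m z - u (r k) z)\<^sup>2))"
        using conv
      proof eventually_elim
        case (elim z)
        then have "(\<lambda>k. ennreal ((u m z - u (r k) z)\<^sup>2)) \<longlonglongrightarrow> ennreal ((u m z - f z)\<^sup>2)"
          unfolding f_def by (intro tendsto_intros tendsto_ennrealI)
        then show ?case by (rule lim_imp_Liminf[OF sequentially_bot, symmetric])
      qed
    qed
    also have "\<dots> \<le> liminf (\<lambda>k. \<integral>\<^sup>+z. ennreal ((u m z - u (r k) z)\<^sup>2) \<partial>M)"
      by (rule nn_integral_liminf) simp
    also have "\<dots> \<le> ennreal e"
    proof (rule Liminf_le)
      show "\<forall>\<^sub>F k in sequentially. (\<integral>\<^sup>+z. ennreal ((u m z - u (r k) z)\<^sup>2) \<partial>M) \<le> ennreal e"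
        using eventually_ge_at_top[of K]
      proof eventually_elim
        case (elim k)
        have "(\<integral>\<^sup>+z. ennreal ((u m z - u (r k) z)\<^sup>2) \<partial>M) = ennreal (\<integral>z. (u m z - u (r k) z)\<^sup>2 \<partial>M)"
          using L2_fun_diff[OF u u] by (intro nn_integral_eq_integral) (auto simp: L2_fun_def)
        also have "\<dots> \<le> ennreal e"
          using e(1)[rule_format, of "r k"] elim r_Suc(2)[of k]
          by (intro ennreal_leI) (simp add: L2_inner_def power2_eq_square)
        finally show ?case .
      qed
    qed simp
    finally have le: "(\<integral>\<^sup>+z. ennreal ((u m z - f z)\<^sup>2) \<partial>M) \<le> ennreal e" .
    then have "integrable M (\<lambda>z. (u m z - f z)\<^sup>2)"
      by (intro integrableI_nonneg) (auto simp: le_less_trans)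
    then show ?thesis
      using le e(2) by (simp add: L2_fun_def L2_inner_def nn_integral_eq_integral flip: power2_eq_square)
  qed
  have "L2_tendsto M u f sequentially"
    unfolding L2_tendsto_def
  proof (intro conjI)
    obtain K where "\<forall>m\<ge>K. \<forall>n\<ge>K. L2_inner M (\<lambda>z. u m z - u n z) (\<lambda>z. u m z - u n z) < 1"
      using cauchy[of 1] by auto
    then have "L2_fun M (\<lambda>z. u K z - f z)" using fatou[of K K 1] by (auto intro: less_imp_le)
    from L2_fun_diff[OF u[of K] this] show "L2_fun M f" by simp
    show "(\<lambda>n. L2_inner M (\<lambda>z. u n z - f z) (\<lambda>z. u n z - f z)) \<longlonglongrightarrow> 0"
    proof (rule LIMSEQ_I)
      fix e :: real assume "e > 0"
      then obtain K where K: "\<forall>m\<ge>K. \<forall>n\<ge>K. L2_inner M (\<lambda>z. u m z - u n z) (\<lambda>z. u m z - u n z) < e / 2"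
        using cauchy[of "e / 2"] by auto
      have "norm (L2_inner M (\<lambda>z. u m z - f z) (\<lambda>z. u m z - f z) - 0) < e" if "m \<ge> K" for m
        using fatou[of K m "e / 2"] K that \<open>e > 0\<close> L2_inner_self_nonneg[of M "\<lambda>z. u m z - f z"]
        by (fastforce intro: less_imp_le)
      then show "\<exists>no. \<forall>n\<ge>no. norm (L2_inner M (\<lambda>z. u n z - f z) (\<lambda>z. u n z - f z) - 0) < e" by blast
    qed
  qed (simp add: u)
  then show ?thesis by blast
qed

text \<open>Projection onto the closure of the subspace \<open>S\<close>: a minimizing sequence is
  Cauchy by the parallelogram law, and the residual \<open>g\<close> is orthogonal to
  \<open>S\<close> because moving the limit along a vector of \<open>S\<close> cannot shorten the
  residual. The sequence is part of the conclusion since only its members are known to have the form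
  that defines \<open>S\<close>.\<close>

theorem (in prob_space) L2_projection_exists:
  assumes S: "\<And>s. s \<in> S \<Longrightarrow> L2_fun M s" "S \<noteq> {}"
    "\<And>s s' a. s \<in> S \<Longrightarrow> s' \<in> S \<Longrightarrow> (\<lambda>z. s z + a * s' z) \<in> S"
    and u: "L2_fun M u"
  shows "\<exists>s g. (\<forall>n. s n \<in> S) \<and> L2_tendsto M s (\<lambda>z. u z - g z) sequentially \<and> L2_fun M g
      \<and> (\<forall>v\<in>S. L2_inner M g v = 0)"
proof -
  define q where "q s = L2_inner M (\<lambda>z. u z - s z) (\<lambda>z. u z - s z)" for s
  define \<delta> where "\<delta> = (INF s\<in>S. q s)"
  have q0: "q s \<ge> 0" for s by (simp add: q_def L2_inner_self_nonneg)
  have bdd: "bdd_below (q ` S)" by (rule bdd_belowI2[of _ 0]) (rule q0)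
  have \<delta>_le: "\<delta> \<le> q s" if "s \<in> S" for s unfolding \<delta>_def by (rule cINF_lower[OF bdd that])
  have "\<exists>s\<in>S. q s < \<delta> + 1 / Suc n" for n
    using cINF_less_iff[OF S(2) bdd, of "\<delta> + 1 / Suc n"] by (simp add: \<delta>_def)
  then obtain s where s: "\<And>n. s n \<in> S" "\<And>n. q (s n) < \<delta> + 1 / Suc n" by metis
  have s_L2: "L2_fun M (s n)" for n using s S by blast
  have half: "(\<lambda>z. (s m z + s n z) / 2) \<in> S" for m n
  proof -
    have 0: "(\<lambda>z. 0) \<in> S" using S(3)[OF s(1) s(1), of m "-1" m] by simp
    have "(\<lambda>z. s m z + 1 * s n z) \<in> S" by (intro S(3) s)
    from S(3)[OF 0 this, of "1/2"] show ?thesis by simp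
  qed
  have close: "L2_inner M (\<lambda>z. s m z - s n z) (\<lambda>z. s m z - s n z) \<le> 2 * (1 / Suc m) + 2 * (1 / Suc n)" for m n
  proof -
    \<comment> \<open>The parallelogram law around \<open>u\<close>; the midpoint lies in
      \<open>S\<close>, so its squared distance is at least \<delta>.\<close>
    have "L2_inner M (\<lambda>z. s m z - s n z) (\<lambda>z. s m z - s n z)
       = 2 * q (s m) + 2 * q (s n) - 4 * q (\<lambda>z. (s m z + s n z) / 2)"
      using s_L2 u
      by (simp add: q_def L2_inner_linear L2_fun_intros L2_inner_commute[of M "s _" u]
          L2_inner_commute[of M "s n" "s m"])
        (simp add: field_simps)
    also have "\<dots> \<le> 2 * (\<delta> + 1 / Suc m) + 2 * (\<delta> + 1 / Suc n) - 4 * \<delta>"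
      using \<delta>_le[OF half, of m n] s(2)[of m] s(2)[of n] by argo
    finally show ?thesis by simp
  qed
  have "\<exists>f. L2_tendsto M s f sequentially"
  proof (rule L2_complete[OF s_L2])
    fix e :: real assume "e > 0"
    then obtain N where N: "1 / Suc N < e / 4"
      using nat_approx_posE[of "e / 4"] by (metis zero_less_divide_iff zero_less_numeral)
    have "L2_inner M (\<lambda>z. s m z - s n z) (\<lambda>z. s m z - s n z) < e" if "m \<ge> N" "n \<ge> N" for m n
    proof -
      have "1 / real (Suc m) \<le> 1 / Suc N" "1 / real (Suc n) \<le> 1 / Suc N"
        using that by (auto simp: frac_le)
      then show ?thesis using close[of m n] N by linarith
    qed
    then show "\<exists>N. \<forall>m\<ge>N. \<forall>n\<ge>N. L2_inner M (\<lambda>z. s m z - s n z) (\<lambda>z. s m z - s n z) < e" by blast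
  qed
  then obtain f where f: "L2_tendsto M s f sequentially" by blast
  have f_L2: "L2_fun M f" using f by (simp add: L2_tendsto_def)
  define g where "g z = u z - f z" for z
  have g_L2: "L2_fun M g" unfolding g_def[abs_def] by (intro L2_fun_intros u f_L2)
  have lim_q: "(\<lambda>n. q (s n)) \<longlonglongrightarrow> L2_inner M g g"
    unfolding q_def g_def[abs_def]
    by (intro L2_tendsto_inner L2_tendsto_diff L2_tendsto_const u f)
  have "(\<lambda>n. \<delta> + 1 / Suc n) \<longlonglongrightarrow> \<delta> + 0"
    by (intro tendsto_intros LIMSEQ_Suc lim_1_over_n)
  then have gg: "L2_inner M g g \<le> \<delta>"
    using LIMSEQ_le[OF lim_q] less_imp_le[OF s(2)] by auto
  have "L2_inner M g v = 0" if v: "v \<in> S" for v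
  proof -
    have v_L2: "L2_fun M v" using v S by blast
    \<comment> \<open>The increment of the squared residual along \<open>v\<close>: minimality makes
      it nonnegative for all \<open>x\<close>, and its zero constant term forces the linear
      coefficient to vanish.\<close>
    have "0 + 2 * L2_inner M g v * x + L2_inner M v v * x\<^sup>2 \<ge> 0" for x
    proof -
      have "(\<lambda>n. q (\<lambda>z. s n z + (- x) * v z)) \<longlonglongrightarrow> L2_inner M (\<lambda>z. u z - (f z + (-x) * v z)) (\<lambda>z. u z - (f z + (-x) * v z))"
        unfolding q_def
        by (intro L2_tendsto_inner L2_tendsto_diff L2_tendsto_add L2_tendsto_const u f L2_fun_intros v_L2)
      moreover have "\<delta> \<le> q (\<lambda>z. s n z + (- x) * v z)" for n by (intro \<delta>_le S(3) s v)
      ultimately have "\<delta> \<le> L2_inner M (\<lambda>z. u z - (f z + (-x) * v z)) (\<lambda>z. u z - (f z + (-x) * v z))"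
        by (intro LIMSEQ_le_const) auto
      also have "(\<lambda>z. u z - (f z + (-x) * v z)) = (\<lambda>z. g z + x * v z)" by (auto simp: g_def)
      also have "L2_inner M (\<lambda>z. g z + x * v z) (\<lambda>z. g z + x * v z)
          = L2_inner M g g + 2 * L2_inner M g v * x + L2_inner M v v * x\<^sup>2"
        using g_L2 v_L2 by (simp add: L2_inner_add_scale_self)
      finally show ?thesis using gg by simp
    qed
    then have "(L2_inner M g v)\<^sup>2 \<le> 0 * L2_inner M v v" by (rule discriminant_bound)
    then show ?thesis by simp
  qed
  moreover have "(\<lambda>z. u z - g z) = f" by (auto simp: g_def)
  ultimately show ?thesis using s f g_L2 by (intro exI[of _ s] exI[of _ g]) auto
qed

section \<open>Gaps in the spectrum of a self-adjoint operator\<close>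

locale L2_self_adjoint = prob_space +
  fixes G
  assumes self_adjoint: "self_adjoint M G"
begin

text \<open>Equality with the adjoint turns symmetry into a membership criterion: a pair of L2
  functions belongs to the graph as soon as it satisfies the symmetry identity against every pair of
  the graph. Linearity, independence of representatives and the eigenvector in the gap argument are
  all obtained this way.\<close>

lemma graph_iff:
  "(u, v) \<in> G \<longleftrightarrow> L2_fun M u \<and> L2_fun M v \<and> (\<forall>(f, g)\<in>G. L2_inner M g u = L2_inner M f v)"
proof -
  have "L2_adjoint M G = G" using self_adjoint by (simp add: self_adjoint_def)
  then have "(u, v) \<in> G \<longleftrightarrow> (u, v) \<in> L2_adjoint M G" by simp
  then show ?thesis by (simp add: L2_adjoint_def)
qed

lemma graph_L2: "(f, g) \<in> G \<Longrightarrow> L2_fun M f" "(f, g) \<in> G \<Longrightarrow> L2_fun M g"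
  by (simp_all add: graph_iff[of f g])

lemma graph_symmetric: "(f, g) \<in> G \<Longrightarrow> (f', g') \<in> G \<Longrightarrow> L2_inner M g f' = L2_inner M f g'"
  using graph_iff[of f' g'] by blast

lemma graph_linear:
  assumes "(f, g) \<in> G" "(f', g') \<in> G"
  shows "(\<lambda>z. f z + a * f' z, \<lambda>z. g z + a * g' z) \<in> G"
proof -
  have "L2_inner M y (\<lambda>z. f z + a * f' z) = L2_inner M x (\<lambda>z. g z + a * g' z)" if "(x, y) \<in> G" for x y
    using graph_symmetric[OF that assms(1)] graph_symmetric[OF that assms(2)] graph_L2[OF that]
      graph_L2[OF assms(1)] graph_L2[OF assms(2)]
    by (simp add: L2_inner_linear L2_fun_intros)
  then show ?thesis
    using graph_L2[OF assms(1)] graph_L2[OF assms(2)]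
    by (subst graph_iff) (auto intro: L2_fun_intros)
qed

lemma graph_sum:
  assumes "(f, g) \<in> G" "finite I" "\<And>i. i \<in> I \<Longrightarrow> (e i, e' i) \<in> G"
  shows "(\<lambda>z. f z + (\<Sum>i\<in>I. a i * e i z), \<lambda>z. g z + (\<Sum>i\<in>I. a i * e' i z)) \<in> G"
  using assms(2,3)
proof (induction I rule: finite_induct)
  case (insert i I)
  then have "(\<lambda>z. f z + (\<Sum>i\<in>I. a i * e i z), \<lambda>z. g z + (\<Sum>i\<in>I. a i * e' i z)) \<in> G" by simp
  from graph_linear[OF this insert(4)[of i], of "a i"] insert(1,2) show ?case
    by (simp add: ac_simps)
qed (simp add: assms)

lemma graph_cong_AE:
  assumes "(f, g) \<in> G" "AE z in M. f z = f' z" "AE z in M. g z = g' z"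
    "f' \<in> borel_measurable M" "g' \<in> borel_measurable M"
  shows "(f', g') \<in> G"
proof -
  have "L2_inner M y f' = L2_inner M x g'" if "(x, y) \<in> G" for x y
  proof -
    have "L2_inner M y f = L2_inner M y f'" "L2_inner M x g = L2_inner M x g'"
      using graph_L2[OF that] graph_L2[OF assms(1)] assms
      by (auto intro!: L2_inner_cong_AE simp: L2_fun_def)
    then show ?thesis using graph_symmetric[OF that assms(1)] by simp
  qed
  then show ?thesis
    using graph_L2[OF assms(1)] assms by (subst graph_iff) (auto intro: L2_fun_cong_AE)
qed

text \<open>The range condition holds only almost everywhere; another representative of the value
  makes it an equation between functions, so that resolvents compose by plain rewriting.\<close>

lemma resolvent_solution:
  assumes "\<mu> \<in> resolvent_set M G" "L2_fun M u"
  obtains f where "(f, \<lambda>z. u z + \<mu> * f z) \<in> G"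
proof -
  obtain f g where fg: "(f, g) \<in> G" "AE z in M. g z - \<mu> * f z = u z"
    using assms by (auto simp: resolvent_set_def)
  have [measurable]: "f \<in> borel_measurable M" "u \<in> borel_measurable M"
    using graph_L2[OF fg(1)] assms by (auto simp: L2_fun_def)
  have "AE z in M. g z = u z + \<mu> * f z" using fg(2) by eventually_elim auto
  then have "(f, \<lambda>z. u z + \<mu> * f z) \<in> G" by (intro graph_cong_AE[OF fg(1)]) auto
  then show ?thesis by (rule that)
qed

lemma resolvent_bound:
  assumes "\<mu> \<in> resolvent_set M G"
  obtains C where "C > 0" "\<And>f g. (f, g) \<in> G \<Longrightarrow>
    L2_inner M f f \<le> C * L2_inner M (\<lambda>z. g z - \<mu> * f z) (\<lambda>z. g z - \<mu> * f z)"
proof -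
  obtain C where C: "\<And>f g. (f, g) \<in> G \<Longrightarrow>
    L2_inner M f f \<le> C * L2_inner M (\<lambda>z. g z - \<mu> * f z) (\<lambda>z. g z - \<mu> * f z)"
    using assms by (fastforce simp: resolvent_set_def L2_normsq_eq_inner)
  have "L2_inner M f f \<le> max C 1 * L2_inner M (\<lambda>z. g z - \<mu> * f z) (\<lambda>z. g z - \<mu> * f z)"
    if "(f, g) \<in> G" for f g
    using C[OF that] by (rule order_trans) (intro mult_right_mono L2_inner_self_nonneg, simp)
  then show ?thesis by (intro that[of "max C 1"]) auto
qed

text \<open>Let H be the operator with graph \<open>G\<close>. With midpoint \<open>m\<close> and
  half-length \<open>r\<close> of the gap, (H - a)(H - b) = (H - m)^2 - r^2, so the claim is ||(H -
  m) f||^2 >= r^2 ||f||^2. A smaller infimum k^2 of the quotient would put m + k and m - k into the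
  resolvent set, and the two bounded inverses would then improve that infimum.\<close>

theorem resolvent_gap:
  assumes ab: "a < b" "{a<..<b} \<subseteq> resolvent_set M G" and fg: "(f, g) \<in> G"
  shows "0 \<le> L2_inner M (\<lambda>z. g z - a * f z) (\<lambda>z. g z - b * f z)"
proof -
  define m where "m = (a + b) / 2"
  define r where "r = (b - a) / 2"
  have r0: "r > 0" using ab by (simp add: r_def)
  define Q where "Q f g = L2_inner M (\<lambda>z. g z - m * f z) (\<lambda>z. g z - m * f z)" for f g
  have Q0: "Q f g \<ge> 0" for f g by (simp add: Q_def L2_inner_self_nonneg)
  have main: "r\<^sup>2 * L2_inner M f f \<le> Q f g" if "(f, g) \<in> G" for f g
  proof (rule ccontr)
    \<comment> \<open>\<open>R\<close> is the quotient to be minimized and \<open>D\<close> the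
      pairs whose argument is nonzero in L2; the assumed counterexample makes \<open>D\<close>
      nonempty.\<close>
    define R where "R = (\<lambda>(f, g). Q f g / L2_inner M f f)"
    define D where "D = {(f, g). (f, g) \<in> G \<and> L2_inner M f f > 0}"
    assume "\<not> r\<^sup>2 * L2_inner M f f \<le> Q f g"
    then have less: "Q f g < r\<^sup>2 * L2_inner M f f" by simp
    then have pos: "L2_inner M f f > 0"
      using Q0[of f g] L2_inner_self_nonneg[of M f] by (cases "L2_inner M f f = 0") auto
    define \<kappa> where "\<kappa> = (INF x\<in>D. R x)"
    have D: "(f, g) \<in> D" using that pos by (simp add: D_def)
    have "R x \<ge> 0" if "x \<in> D" for x
      using that Q0 by (auto simp: R_def D_def)
    then have bdd: "bdd_below (R ` D)" and \<kappa>0: "\<kappa> \<ge> 0"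
      using D by (auto intro!: bdd_belowI2[of _ 0] cINF_greatest simp: \<kappa>_def)
    have "\<kappa> \<le> R (f, g)" unfolding \<kappa>_def by (rule cINF_lower[OF bdd D])
    also have "\<dots> < r\<^sup>2" using less pos by (simp add: R_def field_simps)
    finally have \<kappa>r: "\<kappa> < r\<^sup>2" .
    have \<kappa>Q: "\<kappa> * L2_inner M f f \<le> Q f g" if "(f, g) \<in> G" for f g
    proof (cases "L2_inner M f f > 0")
      case True
      then have "\<kappa> \<le> R (f, g)"
        unfolding \<kappa>_def using that by (intro cINF_lower[OF bdd]) (simp add: D_def)
      then show ?thesis using True by (simp add: R_def field_simps)
    next
      case False
      then have "L2_inner M f f = 0" using L2_inner_self_nonneg[of M f] by simp
      then show ?thesis using Q0 by simp
    qed
    define k where "k = sqrt \<kappa>"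
    have k: "k \<ge> 0" "k\<^sup>2 = \<kappa>" "k < r"
      using \<kappa>0 \<kappa>r r0 by (auto simp: k_def real_less_lsqrt)
    have mem: "m + k \<in> resolvent_set M G" "m - k \<in> resolvent_set M G"
      using ab(2) k by (auto simp: m_def r_def subset_iff field_simps)
    obtain C1 where C1: "C1 > 0" "\<And>f g. (f, g) \<in> G \<Longrightarrow>
        L2_inner M f f \<le> C1 * L2_inner M (\<lambda>z. g z - (m + k) * f z) (\<lambda>z. g z - (m + k) * f z)"
      using resolvent_bound[OF mem(1)] by metis
    obtain C2 where C2: "C2 > 0" "\<And>f g. (f, g) \<in> G \<Longrightarrow>
        L2_inner M f f \<le> C2 * L2_inner M (\<lambda>z. g z - (m - k) * f z) (\<lambda>z. g z - (m - k) * f z)"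
      using resolvent_bound[OF mem(2)] by metis
    \<comment> \<open>A bound for the norm of the product of both resolvents, since
      \<open>C1\<close> and \<open>C2\<close> bound the squares of their norms.\<close>
    define C where "C = sqrt (C1 * C2)"
    have C: "C > 0" using C1 C2 by (simp add: C_def)
    have improved: "(\<kappa> + 1 / C) \<le> R (f, g)" if "(f, g) \<in> D" for f g
    proof -
      from that have fg: "(f, g) \<in> G" and pos: "L2_inner M f f > 0" by (auto simp: D_def)
      note f = graph_L2[OF fg]
      \<comment> \<open>Two successive resolvents: (H - m - k) \<open>w1\<close> = \<open>f\<close>
        and (H - m + k) \<open>w\<close> = \<open>w1\<close>, so \<open>w\<close> solves ((H - m)^2
        - \<kappa>) \<open>w\<close> = \<open>f\<close>.\<close>
      obtain w1 where w1: "(w1, \<lambda>z. f z + (m + k) * w1 z) \<in> G"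
        using resolvent_solution[OF mem(1) f(1)] .
      obtain w where w: "(w, \<lambda>z. w1 z + (m - k) * w z) \<in> G"
        using resolvent_solution[OF mem(2) graph_L2(1)[OF w1]] .
      note L2 = f graph_L2(1)[OF w1] graph_L2(1)[OF w]
      have "L2_inner M w w \<le> C2 * L2_inner M w1 w1" using C2(2)[OF w] by simp
      also have "\<dots> \<le> C2 * (C1 * L2_inner M f f)"
        using C1(2)[OF w1] C2(1) by (intro mult_left_mono) simp_all
      finally have ww: "L2_inner M w w \<le> C\<^sup>2 * L2_inner M f f" using C1 C2 by (simp add: C_def mult_ac)
      have "(L2_inner M w f)\<^sup>2 \<le> L2_inner M w w * L2_inner M f f"
        by (intro L2_Cauchy_Schwarz L2)
      also have "\<dots> \<le> C\<^sup>2 * L2_inner M f f * L2_inner M f f"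
        using ww pos by (intro mult_right_mono) simp_all
      also have "\<dots> = (C * L2_inner M f f)\<^sup>2" by (simp add: power2_eq_square)
      finally have wf: "L2_inner M w f \<le> C * L2_inner M f f"
        by (rule power2_le_imp_le) (use C pos in simp)
      \<comment> \<open>Symmetry between the three pairs evaluates the inner products that appear
        when the form of (H - m)^2 - \<kappa> is expanded at \<open>f\<close> + x
        \<open>w\<close>.\<close>
      have S1: "L2_inner M g w = L2_inner M f w1 + (m - k) * L2_inner M f w"
        using graph_symmetric[OF fg w] L2 by (simp add: L2_inner_linear L2_fun_intros)
      have S2: "L2_inner M g w1 = L2_inner M f f + (m + k) * L2_inner M f w1"
        using graph_symmetric[OF fg w1] L2 by (simp add: L2_inner_linear L2_fun_intros)
      have S3: "L2_inner M w1 w1 + (m - k) * L2_inner M w w1 = L2_inner M w f + (m + k) * L2_inner M w w1"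
        using graph_symmetric[OF w w1] L2 by (simp add: L2_inner_linear L2_fun_intros)
      \<comment> \<open>The form ||(H - m) v||^2 - \<kappa> ||v||^2 at v = \<open>f\<close> + x
        \<open>w\<close>, nonnegative by the choice of \<kappa>; the equation for \<open>w\<close>
        makes its linear coefficient 2 ||f||^2 and its quadratic one <w, f>.\<close>
      have "(Q f g - \<kappa> * L2_inner M f f) + 2 * L2_inner M f f * x + L2_inner M w f * x\<^sup>2 \<ge> 0" for x
      proof -
        have "0 \<le> Q (\<lambda>z. f z + x * w z) (\<lambda>z. g z + x * (w1 z + (m - k) * w z))
            - \<kappa> * L2_inner M (\<lambda>z. f z + x * w z) (\<lambda>z. f z + x * w z)"
          using \<kappa>Q[OF graph_linear[OF fg w]] by simp
        also have "Q (\<lambda>z. f z + x * w z) (\<lambda>z. g z + x * (w1 z + (m - k) * w z))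
          = L2_inner M (\<lambda>z. (g z - m * f z) + x * (w1 z - k * w z)) (\<lambda>z. (g z - m * f z) + x * (w1 z - k * w z))"
          unfolding Q_def by (simp add: algebra_simps)
        also have "\<dots> = Q f g + 2 * x * L2_inner M (\<lambda>z. g z - m * f z) (\<lambda>z. w1 z - k * w z)
            + x\<^sup>2 * L2_inner M (\<lambda>z. w1 z - k * w z) (\<lambda>z. w1 z - k * w z)"
          using L2 by (simp add: Q_def L2_inner_add_scale_self L2_fun_intros)
        also have "L2_inner M (\<lambda>z. g z - m * f z) (\<lambda>z. w1 z - k * w z) = L2_inner M f f + \<kappa> * L2_inner M f w"
          using L2 by (simp add: L2_inner_linear L2_fun_intros S1 S2 power2_eq_square algebra_simps flip: k(2))
        also have "L2_inner M (\<lambda>z. w1 z - k * w z) (\<lambda>z. w1 z - k * w z) = L2_inner M w f + \<kappa> * L2_inner M w w"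
          using L2 S3 by (simp add: L2_inner_linear L2_fun_intros L2_inner_commute[of M w1 w]
              power2_eq_square algebra_simps flip: k(2))
        also have "L2_inner M (\<lambda>z. f z + x * w z) (\<lambda>z. f z + x * w z)
            = L2_inner M f f + 2 * x * L2_inner M f w + x\<^sup>2 * L2_inner M w w"
          using L2 by (simp add: L2_inner_add_scale_self)
        finally show ?thesis by (simp add: algebra_simps)
      qed
      then have "(L2_inner M f f)\<^sup>2 \<le> (Q f g - \<kappa> * L2_inner M f f) * L2_inner M w f"
        by (rule discriminant_bound)
      also have "\<dots> \<le> (Q f g - \<kappa> * L2_inner M f f) * (C * L2_inner M f f)"
        using wf \<kappa>Q[OF fg] by (intro mult_left_mono) auto
      finally have "L2_inner M f f * L2_inner M f f \<le> ((Q f g - \<kappa> * L2_inner M f f) * C) * L2_inner M f f"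
        by (simp add: power2_eq_square mult_ac)
      then have "L2_inner M f f \<le> (Q f g - \<kappa> * L2_inner M f f) * C"
        using pos by (rule mult_right_le_imp_le)
      then show ?thesis using pos C by (simp add: R_def field_simps)
    qed
    have "\<kappa> + 1 / C \<le> \<kappa>"
      unfolding \<kappa>_def using D improved[unfolded \<kappa>_def] by (intro cINF_greatest) auto
    then show False using C by simp
  qed
  have "L2_inner M (\<lambda>z. g z - a * f z) (\<lambda>z. g z - b * f z) = Q f g - r\<^sup>2 * L2_inner M f f"
    unfolding Q_def m_def r_def using graph_L2[OF fg]
    by (simp add: L2_inner_linear L2_fun_intros L2_inner_commute[of M f g])
      (simp add: power2_eq_square field_simps)
  then show ?thesis using main[OF fg] by simp
qed

end

section \<open>The orthogonal complement of finitely many eigenvectors\<close>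

locale L2_eigensystem = L2_self_adjoint +
  fixes I :: "'i set" and e :: "'i \<Rightarrow> 'a \<Rightarrow> real" and \<nu> :: "'i \<Rightarrow> real"
  assumes finite_index: "finite I"
    and eigen: "i \<in> I \<Longrightarrow> (e i, \<lambda>z. \<nu> i * e i z) \<in> G"
    and orthonormal: "i \<in> I \<Longrightarrow> j \<in> I \<Longrightarrow> L2_inner M (e i) (e j) = (if i = j then 1 else 0)"
begin

definition orth :: "('a \<Rightarrow> real) \<Rightarrow> bool" where
  "orth f \<longleftrightarrow> L2_fun M f \<and> (\<forall>i\<in>I. L2_inner M f (e i) = 0)"

text \<open>The orthogonal projection onto the complement of the eigenvectors, written as a sum with
  negative coefficients so that \<open>graph_sum\<close> applies to it directly.\<close>

definition remainder :: "('a \<Rightarrow> real) \<Rightarrow> 'a \<Rightarrow> real" where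
  "remainder f z = f z + (\<Sum>i\<in>I. - L2_inner M f (e i) * e i z)"

lemma e_L2: "i \<in> I \<Longrightarrow> L2_fun M (e i)"
  using graph_L2(1)[OF eigen] .

lemma inner_graph_eigen: "(f, g) \<in> G \<Longrightarrow> i \<in> I \<Longrightarrow> L2_inner M g (e i) = \<nu> i * L2_inner M f (e i)"
  using graph_symmetric[OF _ eigen, of f g i] by (simp add: L2_inner_linear)

lemma orth_L2: "orth f \<Longrightarrow> L2_fun M f"
  by (simp add: orth_def)

lemma orth_linear: "orth f \<Longrightarrow> orth g \<Longrightarrow> orth (\<lambda>z. f z + a * g z)"
  by (auto simp: orth_def L2_fun_intros L2_inner_linear e_L2)

lemma orth_graph: "(f, g) \<in> G \<Longrightarrow> orth f \<Longrightarrow> orth g"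
  using graph_L2[of f g] by (auto simp: orth_def inner_graph_eigen)

lemma orth_diff_scale: "orth f \<Longrightarrow> orth g \<Longrightarrow> orth (\<lambda>z. f z - a * g z)"
  using orth_linear[of f g "-a"] by simp

lemma remainder_L2: "L2_fun M f \<Longrightarrow> L2_fun M (remainder f)"
  unfolding remainder_def[abs_def] by (intro L2_fun_intros e_L2)

lemma orth_remainder:
  assumes "L2_fun M f"
  shows "orth (remainder f)"
  unfolding orth_def
proof (intro conjI ballI remainder_L2 assms)
  fix j assume j: "j \<in> I"
  have "L2_inner M (remainder f) (e j)
      = L2_inner M f (e j) + (\<Sum>i\<in>I. - L2_inner M f (e i) * L2_inner M (e i) (e j))"
    unfolding remainder_def[abs_def] using j assms
    by (simp only: L2_inner_add_left L2_inner_sum_left L2_inner_scale_left e_L2 L2_fun_intros)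
  also have "(\<Sum>i\<in>I. - L2_inner M f (e i) * L2_inner M (e i) (e j))
      = (\<Sum>i\<in>I. if i = j then - L2_inner M f (e j) else 0)"
    using j by (intro sum.cong) (auto simp: orthonormal)
  also have "\<dots> = - L2_inner M f (e j)" using j finite_index by simp
  finally show "L2_inner M (remainder f) (e j) = 0" by simp
qed

lemma remainder_graph:
  "(f, g) \<in> G \<Longrightarrow>
    (remainder f, \<lambda>z. g z + (\<Sum>i\<in>I. - L2_inner M f (e i) * (\<nu> i * e i z))) \<in> G"
  unfolding remainder_def[abs_def] by (intro graph_sum finite_index eigen)

text \<open>Approximants can be moved into the complement without changing the limit, since their
  coefficients tend to those of \<open>f\<close>, which are 0.\<close>

lemma remainder_tendsto:
  assumes "L2_tendsto M u f F" "orth f"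
  shows "L2_tendsto M (\<lambda>n. remainder (u n)) f F"
proof -
  have "L2_tendsto M (\<lambda>n z. u n z + (\<Sum>i\<in>I. - L2_inner M (u n) (e i) * e i z))
      (\<lambda>z. f z + (\<Sum>i\<in>I. - L2_inner M f (e i) * e i z)) F"
    using assms
    by (intro L2_tendsto_add L2_tendsto_sum L2_tendsto_scale L2_tendsto_inner L2_tendsto_const
        finite_index e_L2 tendsto_minus)
  then show ?thesis using assms(2) by (simp add: remainder_def[abs_def] orth_def)
qed

text \<open>Pairing the resolvent equation with \<open>e i\<close> gives (\<nu> i - \<mu>) <f, e i>
  = 0, and \<open>\<nu> i\<close> differs from \<mu> because the resolvent bound excludes an
  eigenvector at \<mu>.\<close>

lemma orth_resolvent:
  assumes "\<mu> \<in> resolvent_set M G" "(f, \<lambda>z. u z + \<mu> * f z) \<in> G" "orth u"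
  shows "orth f"
proof -
  have "L2_inner M f (e i) = 0" if i: "i \<in> I" for i
  proof -
    obtain C where C: "\<And>f g. (f, g) \<in> G \<Longrightarrow>
        L2_inner M f f \<le> C * L2_inner M (\<lambda>z. g z - \<mu> * f z) (\<lambda>z. g z - \<mu> * f z)"
      using resolvent_bound[OF assms(1)] by metis
    have "\<nu> i \<noteq> \<mu>"
      using C[OF eigen[OF i]] i by (auto simp: orthonormal L2_inner_zero_left)
    moreover have "\<nu> i * L2_inner M f (e i) = \<mu> * L2_inner M f (e i)"
      using inner_graph_eigen[OF assms(2) i] assms(3) i graph_L2(1)[OF assms(2)]
      by (auto simp: L2_inner_linear L2_fun_intros e_L2 orth_def)
    ultimately show ?thesis by auto
  qed
  then show ?thesis using graph_L2(1)[OF assms(2)] by (simp add: orth_def)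
qed

text \<open>A lower bound \<open>a\<close> on the complement jumps to the far end \<open>b\<close>
  of a spectral gap. This is proved first for arguments in the range of H - a, where the gap
  inequality and Cauchy-Schwarz for H - a combine. That range is dense in the complement because
  \<open>a\<close> has no eigenvector there, and the resolvent at an interior point turns density
  into approximation of both \<open>f\<close> and \<open>g\<close>.\<close>

theorem lower_bound_gap:
  assumes ab: "a < b" "{a<..<b} \<subseteq> resolvent_set M G"
    and lower: "\<And>f g. (f, g) \<in> G \<Longrightarrow> orth f \<Longrightarrow> a * L2_inner M f f \<le> L2_inner M g f"
    and ker: "\<And>f. (f, \<lambda>z. a * f z) \<in> G \<Longrightarrow> orth f \<Longrightarrow> AE z in M. f z = 0"
    and fg: "(f, g) \<in> G" "orth f"
  shows "b * L2_inner M f f \<le> L2_inner M g f"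
proof -
  \<comment> \<open>For f = (H - a) w the gap inequality reads (b - a) <f, w> <= ||f||^2, and
    Cauchy-Schwarz for the nonnegative form of H - a gives ||f||^4 <= <f, w> q with q the form at f;
    together they yield q >= (b - a) ||f||^2.\<close>
  have range: "(b - a) * L2_inner M f f \<le> L2_inner M x f - a * L2_inner M f f"
    if wv: "(w, v) \<in> G" "orth w" and f_def: "f = (\<lambda>z. v z - a * w z)" and fx: "(f, x) \<in> G" for w v f x
  proof -
    note L2 = graph_L2[OF wv(1)] graph_L2[OF fx]
    have f_orth: "orth f" unfolding f_def by (intro orth_diff_scale orth_graph[OF wv(1)] wv)
    let ?q = "L2_inner M x f - a * L2_inner M f f"
    have q0: "?q \<ge> 0" using lower[OF fx f_orth] by simp
    have vw: "L2_inner M v w - a * L2_inner M w w = L2_inner M f w"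
      using L2 by (simp add: f_def L2_inner_linear L2_fun_intros)
    have vf: "L2_inner M v f - a * L2_inner M w f = L2_inner M f f"
    proof -
      have "L2_inner M f f = L2_inner M (\<lambda>z. v z - a * w z) f" by (simp add: f_def)
      then show ?thesis using L2 by (simp add: L2_inner_linear L2_fun_intros)
    qed
    have xw: "L2_inner M x w = L2_inner M v f"
      using graph_symmetric[OF fx wv(1)] by (simp add: L2_inner_commute)
    have gap: "(b - a) * L2_inner M f w \<le> L2_inner M f f"
    proof -
      have "0 \<le> L2_inner M (\<lambda>z. v z - a * w z) (\<lambda>z. v z - b * w z)"
        by (rule resolvent_gap[OF ab wv(1)])
      also have "(\<lambda>z. v z - b * w z) = (\<lambda>z. f z - (b - a) * w z)" by (auto simp: f_def algebra_simps)
      also have "(\<lambda>z. v z - a * w z) = f" by (simp add: f_def)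
      finally show ?thesis using L2 by (simp add: L2_inner_linear L2_fun_intros)
    qed
    have "L2_inner M f w + 2 * L2_inner M f f * y + ?q * y\<^sup>2 \<ge> 0" for y
    proof -
      have "a * L2_inner M (\<lambda>z. w z + y * f z) (\<lambda>z. w z + y * f z)
          \<le> L2_inner M (\<lambda>z. v z + y * x z) (\<lambda>z. w z + y * f z)"
        by (intro lower graph_linear wv fx orth_linear f_orth)
      also have "\<dots> = L2_inner M v w + y * L2_inner M v f + y * L2_inner M x w + y\<^sup>2 * L2_inner M x f"
        using L2 by (simp add: L2_inner_linear L2_fun_intros power2_eq_square algebra_simps)
      also have "L2_inner M (\<lambda>z. w z + y * f z) (\<lambda>z. w z + y * f z)
          = L2_inner M w w + 2 * y * L2_inner M w f + y\<^sup>2 * L2_inner M f f"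
        using L2 by (simp add: L2_inner_add_scale_self)
      finally show ?thesis
        using xw by (simp add: algebra_simps flip: vw vf)
    qed
    then have cs: "(L2_inner M f f)\<^sup>2 \<le> L2_inner M f w * ?q" by (rule discriminant_bound)
    show ?thesis
    proof (cases "L2_inner M f f = 0")
      case True
      then show ?thesis using q0 by simp
    next
      case False
      then have pos: "L2_inner M f f > 0" using L2_inner_self_nonneg[of M f] by simp
      have "((b - a) * L2_inner M f f) * L2_inner M f f \<le> (b - a) * (L2_inner M f w * ?q)"
        using cs ab by (simp add: power2_eq_square)
      also have "\<dots> = (b - a) * L2_inner M f w * ?q" by simp
      also have "\<dots> \<le> L2_inner M f f * ?q" by (intro mult_right_mono gap q0)
      finally have "((b - a) * L2_inner M f f) * L2_inner M f f \<le> ?q * L2_inner M f f"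
        by (simp add: mult.commute)
      then show ?thesis using pos by (rule mult_right_le_imp_le)
    qed
  qed
  \<comment> \<open>Any interior point would do; it supplies a bounded inverse of H - m, so that it
    suffices to approximate \<open>u\<close> = (H - m) \<open>f\<close>.\<close>
  define m where "m = (a + b) / 2"
  have m: "m \<in> resolvent_set M G" using ab by (auto simp: m_def subset_iff)
  note f_L2 = graph_L2[OF fg(1)]
  define u where "u z = g z - m * f z" for z
  have u: "orth u" unfolding u_def[abs_def] by (intro orth_diff_scale orth_graph[OF fg(1)] fg)
  \<comment> \<open>The range of H - a on domain vectors in the complement, to be shown dense
    there.\<close>
  define S where "S = {\<lambda>z. v z - a * w z | w v. (w, v) \<in> G \<and> orth w}"
  have S_I: "(\<lambda>z. v z - a * w z) \<in> S" if "(w, v) \<in> G" "orth w" for w v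
    using that unfolding S_def by blast
  have S_orth: "orth s" if s: "s \<in> S" for s
  proof -
    from s obtain w v where "s = (\<lambda>z. v z - a * w z)" "(w, v) \<in> G" "orth w" by (auto simp: S_def)
    then show ?thesis by (auto intro: orth_diff_scale orth_graph)
  qed
  have S_linear: "(\<lambda>z. s z + c * s' z) \<in> S" if s: "s \<in> S" "s' \<in> S" for s s' c
  proof -
    from s(1) obtain w v where 1: "s = (\<lambda>z. v z - a * w z)" "(w, v) \<in> G" "orth w" by (auto simp: S_def)
    from s(2) obtain w' v' where 2: "s' = (\<lambda>z. v' z - a * w' z)" "(w', v') \<in> G" "orth w'" by (auto simp: S_def)
    have "(\<lambda>z. s z + c * s' z) = (\<lambda>z. (v z + c * v' z) - a * (w z + c * w' z))"
      by (auto simp: 1 2 algebra_simps)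
    moreover have "(\<lambda>z. w z + c * w' z, \<lambda>z. v z + c * v' z) \<in> G" "orth (\<lambda>z. w z + c * w' z)"
      using 1 2 by (auto intro: graph_linear orth_linear)
    ultimately show ?thesis using S_I by metis
  qed
  have "S \<noteq> {}" using fg by (auto simp: S_def)
  from L2_projection_exists[OF orth_L2[OF S_orth] this S_linear orth_L2[OF u]]
  obtain s p where s: "\<And>n. s n \<in> S" and lim: "L2_tendsto M s (\<lambda>z. u z - p z) sequentially"
    and p: "L2_fun M p" "\<And>v. v \<in> S \<Longrightarrow> L2_inner M p v = 0"
    by blast
  have p_orth: "orth p"
    unfolding orth_def
  proof (intro conjI ballI p(1))
    fix i assume i: "i \<in> I"
    have "(\<lambda>n. L2_inner M (s n) (e i)) \<longlonglongrightarrow> L2_inner M (\<lambda>z. u z - p z) (e i)"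
      by (intro L2_tendsto_inner lim L2_tendsto_const e_L2 i)
    moreover have "L2_inner M (s n) (e i) = 0" for n using S_orth[OF s] i by (simp add: orth_def)
    ultimately have "L2_inner M (\<lambda>z. u z - p z) (e i) = 0" by (simp add: LIMSEQ_const_iff)
    then show "L2_inner M p (e i) = 0"
      using p u i by (simp add: L2_inner_linear L2_fun_intros e_L2 orth_def)
  qed
  have "(p, \<lambda>z. a * p z) \<in> G"
  proof -
    have "L2_inner M v p = L2_inner M w (\<lambda>z. a * p z)" if wv: "(w, v) \<in> G" for w v
    proof -
      \<comment> \<open>Elements of \<open>S\<close> come only from orthogonal arguments, so an
        arbitrary pair is first stripped of its eigencomponents; pairing with \<open>p\<close> does
        not notice this, as \<open>p\<close> lies in the complement.\<close>
      define v' where "v' z = v z + (\<Sum>i\<in>I. - L2_inner M w (e i) * (\<nu> i * e i z))" for z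
      have "(\<lambda>z. v' z - a * remainder w z) \<in> S"
        unfolding v'_def[abs_def]
        by (intro S_I remainder_graph wv orth_remainder graph_L2(1)[OF wv])
      then have "L2_inner M p (\<lambda>z. v' z - a * remainder w z) = 0" by (rule p)
      moreover have "L2_inner M p v' = L2_inner M p v"
        unfolding v'_def[abs_def] using p_orth graph_L2[OF wv]
        by (simp add: L2_inner_linear L2_fun_intros e_L2 orth_def)
      moreover have "L2_inner M p (remainder w) = L2_inner M p w"
        unfolding remainder_def[abs_def] using p_orth graph_L2[OF wv]
        by (simp add: L2_inner_linear L2_fun_intros e_L2 orth_def)
      moreover have "L2_fun M v'"
        unfolding v'_def[abs_def] by (intro L2_fun_intros graph_L2[OF wv] e_L2)
      ultimately show ?thesis
        using p graph_L2[OF wv]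
        by (simp add: L2_inner_linear L2_fun_intros remainder_L2 L2_inner_commute[of M _ p])
    qed
    then show ?thesis using p by (subst graph_iff) (auto intro: L2_fun_intros)
  qed
  from ker[OF this p_orth] have "AE z in M. u z - p z = u z" by eventually_elim simp
  from L2_tendsto_cong_AE[OF lim this orth_L2[OF u]] have lim: "L2_tendsto M s u sequentially" .
  have "\<exists>w v. s n = (\<lambda>z. v z - a * w z) \<and> (w, v) \<in> G \<and> orth w" for n
    using s[of n] by (auto simp: S_def)
  then obtain w v where sn: "\<And>n. s n = (\<lambda>z. v n z - a * w n z)"
    and wv: "\<And>n. (w n, v n) \<in> G" "\<And>n. orth (w n)" by metis
  have "\<exists>y. (y, \<lambda>z. w n z + m * y z) \<in> G" for n
    using resolvent_solution[OF m graph_L2(1)[OF wv(1)]] by metis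
  then obtain y where y: "\<And>n. (y n, \<lambda>z. w n z + m * y n z) \<in> G" by metis
  have y_orth: "orth (y n)" for n by (rule orth_resolvent[OF m y wv(2)])
  \<comment> \<open>This is (H - a) \<open>y n\<close>, with \<open>y n\<close> the resolvent at
    \<open>m\<close> of \<open>w n\<close>, so it lies in the range treated above. It is also the
    resolvent at \<open>m\<close> of \<open>s n\<close>, so it converges to \<open>f\<close> as
    \<open>s n\<close> converges to \<open>u\<close>.\<close>
  define f' where "f' n z = w n z + (m - a) * y n z" for n z
  define g' where "g' n z = v n z + (m - a) * (w n z + m * y n z)" for n z
  have f'g': "(f' n, g' n) \<in> G" for n
    unfolding f'_def[abs_def] g'_def[abs_def] by (intro graph_linear wv y)
  note f'_L2 = graph_L2[OF f'g']
  have bound: "(b - a) * L2_inner M (f' n) (f' n) \<le> L2_inner M (g' n) (f' n) - a * L2_inner M (f' n) (f' n)" for n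
    by (rule range[OF y y_orth _ f'g']) (auto simp: f'_def algebra_simps)
  have g'_eq: "g' n z = s n z + m * f' n z" for n z
    by (simp add: sn f'_def g'_def algebra_simps)
  obtain C where C: "\<And>f g. (f, g) \<in> G \<Longrightarrow>
      L2_inner M f f \<le> C * L2_inner M (\<lambda>z. g z - m * f z) (\<lambda>z. g z - m * f z)"
    using resolvent_bound[OF m] by metis
  have lim_f: "L2_tendsto M f' f sequentially"
  proof (rule L2_tendsto_squeeze)
    show "\<forall>\<^sub>F n in sequentially. L2_inner M (\<lambda>z. f' n z - f z) (\<lambda>z. f' n z - f z)
        \<le> C * L2_inner M (\<lambda>z. s n z - u z) (\<lambda>z. s n z - u z)"
    proof (intro always_eventually allI)
      fix n
      have "(\<lambda>z. f' n z - f z, \<lambda>z. g' n z - g z) \<in> G"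
        using graph_linear[OF f'g' fg(1), of n "-1"] by simp
      from C[OF this] show "L2_inner M (\<lambda>z. f' n z - f z) (\<lambda>z. f' n z - f z)
        \<le> C * L2_inner M (\<lambda>z. s n z - u z) (\<lambda>z. s n z - u z)"
        by (simp add: g'_eq u_def algebra_simps)
    qed
    have "(\<lambda>n. C * L2_inner M (\<lambda>z. s n z - u z) (\<lambda>z. s n z - u z)) \<longlonglongrightarrow> C * 0"
      using lim by (intro tendsto_intros) (simp add: L2_tendsto_def)
    then show "(\<lambda>n. C * L2_inner M (\<lambda>z. s n z - u z) (\<lambda>z. s n z - u z)) \<longlonglongrightarrow> 0" by simp
  qed (simp_all add: f_L2 f'_L2)
  have "L2_tendsto M (\<lambda>n z. s n z + m * f' n z) (\<lambda>z. u z + m * f z) sequentially"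
    by (intro L2_tendsto_add lim L2_tendsto_scale lim_f tendsto_const)
  then have lim_g: "L2_tendsto M g' g sequentially" by (simp add: g'_eq[abs_def] u_def)
  have "(b - a) * L2_inner M f f \<le> L2_inner M g f - a * L2_inner M f f"
  proof (rule LIMSEQ_le)
    show "(\<lambda>n. (b - a) * L2_inner M (f' n) (f' n)) \<longlonglongrightarrow> (b - a) * L2_inner M f f"
      by (intro tendsto_intros L2_tendsto_inner lim_f)
    show "(\<lambda>n. L2_inner M (g' n) (f' n) - a * L2_inner M (f' n) (f' n))
        \<longlonglongrightarrow> L2_inner M g f - a * L2_inner M f f"
      by (intro tendsto_intros L2_tendsto_inner lim_f lim_g)
  qed (use bound in auto)
  then show ?thesis by (simp add: algebra_simps)
qed

end

section \<open>Stationary Markov semigroups\<close>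

text \<open>Fubini for a kernel and a signed integrand: the nonnegative version is applied to both
  parts and to the absolute value, whose finiteness gives integrability under almost every
  \<open>k z\<close>. It serves invariance, with \<open>M\<close> the stationary law, and the
  Chapman-Kolmogorov equation, with \<open>M\<close> the kernel at a point.\<close>

lemma integral_bind_kernel:
  fixes F :: "'b \<Rightarrow> real"
  assumes k[measurable]: "k \<in> M \<rightarrow>\<^sub>M subprob_algebra N" and ne: "space M \<noteq> {}"
    and F: "integrable (M \<bind> k) F"
  shows "AE z in M. integrable (k z) F"
    and "integrable M (transition_operator k F)"
    and "integral\<^sup>L M (transition_operator k F) = integral\<^sup>L (M \<bind> k) F"
proof -
  have "(M \<bind> k) \<rightarrow>\<^sub>M borel = N \<rightarrow>\<^sub>M (borel :: real measure)"
    by (intro measurable_cong_sets sets_bind[OF sets_kernel[OF k] ne] refl)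
  then have F_meas[measurable]: "F \<in> borel_measurable N"
    using borel_measurable_integrable[OF F] by blast
  have k_meas: "F \<in> borel_measurable (k z)" if "z \<in> space M" for z
    using F_meas sets_kernel[OF k that] by (simp cong: measurable_cong_sets)
  define a where "a z = (\<integral>\<^sup>+x. ennreal (F x) \<partial>k z)" for z
  define b where "b z = (\<integral>\<^sup>+x. ennreal (- F x) \<partial>k z)" for z
  note [measurable] = measurable_compose[OF k nn_integral_measurable_subprob_algebra]
  have [measurable]: "a \<in> borel_measurable M" "b \<in> borel_measurable M"
    unfolding a_def[abs_def] b_def[abs_def] by measurable
  have T_meas[measurable]: "transition_operator k F \<in> borel_measurable M"
    unfolding transition_operator_def[abs_def]
    by (rule measurable_compose[OF k integral_measurable_subprob_algebra]) simp
  have int_a: "(\<integral>\<^sup>+x. ennreal (F x) \<partial>(M \<bind> k)) = (\<integral>\<^sup>+z. a z \<partial>M)"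
    unfolding a_def by (rule nn_integral_bind[OF _ k]) simp
  have int_b: "(\<integral>\<^sup>+x. ennreal (- F x) \<partial>(M \<bind> k)) = (\<integral>\<^sup>+z. b z \<partial>M)"
    unfolding b_def by (rule nn_integral_bind[OF _ k]) simp
  have norm_eq: "(\<integral>\<^sup>+x. ennreal (norm (F x)) \<partial>(M \<bind> k)) = (\<integral>\<^sup>+z. \<integral>\<^sup>+x. ennreal (norm (F x)) \<partial>k z \<partial>M)"
    by (rule nn_integral_bind[OF _ k]) simp
  have fin: "(\<integral>\<^sup>+z. \<integral>\<^sup>+x. ennreal (norm (F x)) \<partial>k z \<partial>M) < \<infinity>"
    using F unfolding norm_eq[symmetric] integrable_iff_bounded by blast
  then have "AE z in M. (\<integral>\<^sup>+x. ennreal (norm (F x)) \<partial>k z) \<noteq> \<infinity>"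
    by (intro nn_integral_PInf_AE) auto
  then show int: "AE z in M. integrable (k z) F"
    using AE_space
    by eventually_elim (auto simp: integrable_iff_bounded k_meas less_top)
  show "integrable M (transition_operator k F)"
    unfolding integrable_iff_bounded
  proof
    have "(\<integral>\<^sup>+z. ennreal (norm (transition_operator k F z)) \<partial>M)
        \<le> (\<integral>\<^sup>+z. \<integral>\<^sup>+x. ennreal (norm (F x)) \<partial>k z \<partial>M)"
    proof (rule nn_integral_mono_AE)
      show "AE z in M. ennreal (norm (transition_operator k F z)) \<le> (\<integral>\<^sup>+x. ennreal (norm (F x)) \<partial>k z)"
        using int unfolding transition_operator_def
        by eventually_elim (rule integral_norm_bound_ennreal)
    qed
    then show "(\<integral>\<^sup>+z. ennreal (norm (transition_operator k F z)) \<partial>M) < \<infinity>"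
      using fin by (rule le_less_trans)
  qed simp
  have fin_ab: "integral\<^sup>N M a < \<infinity>" "integral\<^sup>N M b < \<infinity>"
    using F by (auto simp: real_integrable_def less_top int_a int_b)
  have AE_ab: "AE z in M. a z \<noteq> \<infinity>" "AE z in M. b z \<noteq> \<infinity>"
    using fin_ab by (intro nn_integral_PInf_AE; simp)+
  have real_int: "integrable M (\<lambda>z. enn2real (c z)) \<and> integral\<^sup>L M (\<lambda>z. enn2real (c z)) = enn2real (integral\<^sup>N M c)"
    if [measurable]: "c \<in> borel_measurable M" and c: "AE z in M. c z \<noteq> \<infinity>" "integral\<^sup>N M c < \<infinity>" for c
  proof -
    have eq: "(\<integral>\<^sup>+z. ennreal (enn2real (c z)) \<partial>M) = integral\<^sup>N M c"
    proof (rule nn_integral_cong_AE)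
      show "AE z in M. ennreal (enn2real (c z)) = c z"
        using c(1) by eventually_elim (simp add: less_top)
    qed
    have "integrable M (\<lambda>z. enn2real (c z))"
      using c(2) by (intro integrableI_nonneg) (simp_all add: eq)
    then show ?thesis by (simp add: integral_eq_nn_integral eq)
  qed
  have "integral\<^sup>L M (transition_operator k F) = integral\<^sup>L M (\<lambda>z. enn2real (a z) - enn2real (b z))"
  proof (rule integral_cong_AE)
    show "AE z in M. transition_operator k F z = enn2real (a z) - enn2real (b z)"
      using int by eventually_elim (simp add: transition_operator_def real_lebesgue_integral_def a_def b_def)
  qed simp_all
  also have "\<dots> = enn2real (integral\<^sup>N M a) - enn2real (integral\<^sup>N M b)"
    using real_int[OF _ AE_ab(1) fin_ab(1)] real_int[OF _ AE_ab(2) fin_ab(2)] by simp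
  also have "\<dots> = integral\<^sup>L (M \<bind> k) F"
    using F by (simp add: real_lebesgue_integral_def int_a int_b)
  finally show "integral\<^sup>L M (transition_operator k F) = integral\<^sup>L (M \<bind> k) F" .
qed

section \<open>The transition operator of a stationary kernel\<close>

locale stationary_kernel = prob_space +
  fixes k
  assumes kernel: "k \<in> M \<rightarrow>\<^sub>M prob_algebra M" and invariant: "M \<bind> k = M"
begin

abbreviation T :: "('a \<Rightarrow> real) \<Rightarrow> 'a \<Rightarrow> real" where
  "T \<equiv> transition_operator k"

lemma kernel_subprob[measurable]: "k \<in> M \<rightarrow>\<^sub>M subprob_algebra M"
  using kernel by (rule measurable_prob_algebraD)

lemma kernel_prob: "z \<in> space M \<Longrightarrow> prob_space (k z)"
  using measurable_space[OF kernel] by (auto simp: space_prob_algebra)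

lemma kernel_sets: "z \<in> space M \<Longrightarrow> sets (k z) = sets M"
  using measurable_space[OF kernel] by (auto simp: space_prob_algebra)

lemma kernel_measurable: "f \<in> borel_measurable M \<Longrightarrow> z \<in> space M \<Longrightarrow> f \<in> borel_measurable (k z)"
  using kernel_sets[of z] by (simp cong: measurable_cong_sets)

lemma T_measurable[measurable]:
  "f \<in> borel_measurable M \<Longrightarrow> T f \<in> borel_measurable M"
  unfolding transition_operator_def[abs_def]
  by (rule measurable_compose[OF kernel_subprob integral_measurable_subprob_algebra])

lemma T_integral:
  assumes "integrable M F"
  shows "AE z in M. integrable (k z) F" "integrable M (T F)" "integral\<^sup>L M (T F) = integral\<^sup>L M F"
  using integral_bind_kernel[OF kernel_subprob not_empty, of F] assms by (simp_all add: invariant)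

text \<open>A null set is null under the mixture of the kernels, which is the invariant law itself,
  hence under almost every kernel. This lets the transition operator act on classes of almost
  everywhere equal functions.\<close>

lemma AE_kernel:
  assumes "AE z in M. Q z"
  shows "AE z in M. AE y in k z. Q y"
proof -
  from assms obtain N where N: "N \<in> null_sets M" "{z\<in>space M. \<not> Q z} \<subseteq> N"
    by (auto elim: AE_E simp: null_sets_def)
  have "AE z in M \<bind> k. z \<notin> N" unfolding invariant by (rule AE_not_in[OF N(1)])
  moreover have "Measurable.pred M (\<lambda>z. z \<notin> N)" using N(1) by (auto simp: null_sets_def)
  ultimately have "AE z in M. AE y in k z. y \<notin> N"
    using AE_bind[OF kernel_subprob] by simp
  then show ?thesis
    using AE_space
  proof eventually_elim
    case (elim z)
    have sp: "space (k z) = space M" using elim(2) kernel_sets[of z] by (simp cong: sets_eq_imp_space_eq)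
    show ?case using elim(1) AE_space
      by eventually_elim (use N(2) sp in auto)
  qed
qed

lemma T_cong_AE:
  assumes "AE z in M. f z = g z" "f \<in> borel_measurable M" "g \<in> borel_measurable M"
  shows "AE z in M. T f z = T g z"
  using AE_kernel[OF assms(1)] AE_space
proof eventually_elim
  case (elim z)
  then show ?case
    unfolding transition_operator_def using assms by (intro integral_cong_AE kernel_measurable)
qed

text \<open>Jensen's inequality for the square, obtained from Cauchy-Schwarz against the constant 1
  under \<open>k z\<close>, followed by invariance of the law.\<close>

lemma T_L2:
  assumes f: "L2_fun M f"
  shows "L2_fun M (T f)" "L2_inner M (T f) (T f) \<le> L2_inner M f f"
    and "AE z in M. integrable (k z) (\<lambda>y. (f y)\<^sup>2)"
proof -
  have [measurable]: "f \<in> borel_measurable M" and int: "integrable M (\<lambda>z. (f z)\<^sup>2)"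
    using f by (auto simp: L2_fun_def)
  note Tf2 = T_integral[OF int]
  show "AE z in M. integrable (k z) (\<lambda>y. (f y)\<^sup>2)" by (rule Tf2)
  have jensen: "AE z in M. (T f z)\<^sup>2 \<le> T (\<lambda>y. (f y)\<^sup>2) z"
    using Tf2(1) AE_space
  proof eventually_elim
    case (elim z)
    interpret kz: prob_space "k z" using kernel_prob elim by simp
    have L2: "L2_fun (k z) f" using elim by (simp add: L2_fun_def kernel_measurable)
    from L2_Cauchy_Schwarz[OF L2 kz.L2_fun_const[of 1]] show ?case
      by (simp add: L2_inner_def transition_operator_def power2_eq_square kz.prob_space)
  qed
  have int_T: "integrable M (\<lambda>z. (T f z)\<^sup>2)"
    by (rule Bochner_Integration.integrable_bound[OF Tf2(2)]) (use jensen in auto)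
  then show "L2_fun M (T f)" by (simp add: L2_fun_def)
  have "(\<integral>z. (T f z)\<^sup>2 \<partial>M) \<le> integral\<^sup>L M (T (\<lambda>y. (f y)\<^sup>2))"
    by (rule integral_mono_AE[OF int_T Tf2(2) jensen])
  also have "\<dots> = (\<integral>z. (f z)\<^sup>2 \<partial>M)" by (rule Tf2(3))
  finally show "L2_inner M (T f) (T f) \<le> L2_inner M f f"
    by (simp add: L2_inner_def power2_eq_square)
qed

lemma T_linear:
  assumes "L2_fun M f" "L2_fun M g"
  shows "AE z in M. T (\<lambda>y. f y + a * g y) z = T f z + a * T g z"
  using T_integral(1)[OF L2_fun_integrable[OF assms(1)]] T_integral(1)[OF L2_fun_integrable[OF assms(2)]]
  by eventually_elim (simp add: transition_operator_def)

lemma T_diff: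
  assumes "L2_fun M f" "L2_fun M g"
  shows "AE z in M. T (\<lambda>y. f y - g y) z = T f z - T g z"
  using T_linear[OF assms, of "-1"] by simp

lemma T_diff_le:
  assumes "L2_fun M f" "L2_fun M g"
  shows "L2_inner M (\<lambda>z. T f z - T g z) (\<lambda>z. T f z - T g z) \<le> L2_inner M (\<lambda>z. f z - g z) (\<lambda>z. f z - g z)"
proof -
  note L2 = assms T_L2(1)[OF assms(1)] T_L2(1)[OF assms(2)] L2_fun_diff[OF assms]
  have "L2_inner M (\<lambda>z. T f z - T g z) (\<lambda>z. T f z - T g z)
      = L2_inner M (T (\<lambda>y. f y - g y)) (T (\<lambda>y. f y - g y))"
    using T_diff[OF assms] L2 T_L2(1)[OF L2(5)]
    by (intro L2_inner_cong_AE) (auto simp: L2_fun_def)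
  also have "\<dots> \<le> L2_inner M (\<lambda>z. f z - g z) (\<lambda>z. f z - g z)"
    by (rule T_L2(2)[OF L2(5)])
  finally show ?thesis .
qed

lemma T_tendsto:
  assumes "L2_tendsto M u f F"
  shows "L2_tendsto M (\<lambda>n. T (u n)) (T f) F"
proof (rule L2_tendsto_squeeze)
  have f: "L2_fun M f" and ev: "\<forall>\<^sub>F n in F. L2_fun M (u n)"
    and lim: "((\<lambda>n. L2_inner M (\<lambda>z. u n z - f z) (\<lambda>z. u n z - f z)) \<longlongrightarrow> 0) F"
    using assms by (auto simp: L2_tendsto_def)
  show "L2_fun M (T f)" by (rule T_L2(1)[OF f])
  show "\<forall>\<^sub>F n in F. L2_fun M (T (u n))" using ev by eventually_elim (rule T_L2(1))
  show "\<forall>\<^sub>F n in F. L2_inner M (\<lambda>z. T (u n) z - T f z) (\<lambda>z. T (u n) z - T f z)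
      \<le> L2_inner M (\<lambda>z. u n z - f z) (\<lambda>z. u n z - f z)"
    using ev by eventually_elim (intro T_diff_le f)
  show "((\<lambda>n. L2_inner M (\<lambda>z. u n z - f z) (\<lambda>z. u n z - f z)) \<longlongrightarrow> 0) F" by (rule lim)
qed

end

text \<open>The product rule: the difference quotient splits into the quotient of \<open>u\<close>
  paired with \<open>v x\<close> and \<open>u s\<close> paired with the quotient of
  \<open>v\<close>, and each part converges by joint continuity of the inner product.\<close>

lemma L2_inner_has_real_derivative:
  assumes u: "L2_tendsto P (\<lambda>x z. (u x z - u s z) / (x - s)) u' (at s within S)"
    and v: "L2_tendsto P (\<lambda>x z. (v x z - v s z) / (x - s)) v' (at s within S)"
    and L2: "\<And>x. x \<in> S \<Longrightarrow> L2_fun P (u x)" "\<And>x. x \<in> S \<Longrightarrow> L2_fun P (v x)" and s: "s \<in> S"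
  shows "((\<lambda>x. L2_inner P (u x) (v x)) has_real_derivative L2_inner P u' (v s) + L2_inner P (u s) v')
    (at s within S)"
  unfolding has_field_derivative_iff
proof -
  have ev: "\<forall>\<^sub>F x in at s within S. x \<in> S \<and> x \<noteq> s"
    by (auto simp: eventually_at_filter)
  \<comment> \<open>Continuity of \<open>v\<close> at \<open>s\<close> is recovered from its
    differentiability, as (x - s) times the quotient.\<close>
  have "L2_tendsto P (\<lambda>x z. (x - s) * ((v x z - v s z) / (x - s)) + v s z) (\<lambda>z. 0 * v' z + v s z) (at s within S)"
    by (intro L2_tendsto_add L2_tendsto_scale v L2_tendsto_const L2 s) (auto intro!: tendsto_eq_intros)
  then have v_cont: "L2_tendsto P v (v s) (at s within S)"
  proof (simp only: mult_zero_left add_0_left, elim L2_tendsto_cong_eventually)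
    show "\<forall>\<^sub>F x in at s within S. (AE z in P. (x - s) * ((v x z - v s z) / (x - s)) + v s z = v x z)
        \<and> v x \<in> borel_measurable P"
      using ev by eventually_elim (use L2 in \<open>auto simp: L2_fun_def\<close>)
  qed
  have "((\<lambda>x. L2_inner P (\<lambda>z. (u x z - u s z) / (x - s)) (v x) + L2_inner P (u s) (\<lambda>z. (v x z - v s z) / (x - s)))
      \<longlongrightarrow> L2_inner P u' (v s) + L2_inner P (u s) v') (at s within S)"
    by (intro tendsto_add L2_tendsto_inner u v v_cont L2_tendsto_const L2 s)
  then show "((\<lambda>x. (L2_inner P (u x) (v x) - L2_inner P (u s) (v s)) / (x - s))
      \<longlongrightarrow> L2_inner P u' (v s) + L2_inner P (u s) v') (at s within S)"
  proof (rule Lim_transform_eventually)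
    show "\<forall>\<^sub>F x in at s within S. L2_inner P (\<lambda>z. (u x z - u s z) / (x - s)) (v x)
        + L2_inner P (u s) (\<lambda>z. (v x z - v s z) / (x - s))
      = (L2_inner P (u x) (v x) - L2_inner P (u s) (v s)) / (x - s)"
      using ev
      by eventually_elim
        (use L2 s in \<open>simp add: L2_inner_linear L2_fun_intros flip: add_divide_distrib\<close>)
  qed
qed

section \<open>The Markov semigroup generated by minus a self-adjoint operator\<close>

locale L2_semigroup = L2_self_adjoint M G for M :: "'a measure" and G +
  fixes K
  assumes markov: "markov_semigroup M K" and stationary: "stationary M K"
    and continuous: "strongly_continuous M K"
    and generator: "G = operator_uminus (semigroup_generator M K)"
begin

abbreviation T :: "real \<Rightarrow> ('a \<Rightarrow> real) \<Rightarrow> 'a \<Rightarrow> real" where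
  "T s \<equiv> transition_operator (K s)"

lemma stationary_kernel: "s \<ge> 0 \<Longrightarrow> stationary_kernel M (K s)"
  using markov stationary
  by unfold_locales (auto simp: markov_semigroup_def stationary_def)

lemma T_L2: "s \<ge> 0 \<Longrightarrow> L2_fun M f \<Longrightarrow> L2_fun M (T s f)"
  using stationary_kernel.T_L2(1)[OF stationary_kernel] .

lemma T_measurable: "s \<ge> 0 \<Longrightarrow> L2_fun M f \<Longrightarrow> T s f \<in> borel_measurable M"
  using T_L2 by (auto simp: L2_fun_def)

lemma T_0:
  assumes "L2_fun M f"
  shows "AE z in M. T 0 f z = f z"
proof (rule AE_I2)
  fix z assume z: "z \<in> space M"
  have "K 0 z = return M z" using markov z by (auto simp: markov_semigroup_def)
  then show "T 0 f z = f z"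
    using z assms by (simp add: transition_operator_def integral_return L2_fun_def)
qed

text \<open>Chapman-Kolmogorov at a point \<open>z\<close>, valid wherever the kernel at time r + s
  integrates \<open>f\<close>.\<close>

lemma T_add:
  assumes rs: "r \<ge> 0" "s \<ge> 0" and f: "L2_fun M f"
  shows "AE z in M. T (r + s) f z = T r (T s f) z"
proof -
  interpret r: stationary_kernel M "K r" by (rule stationary_kernel[OF rs(1)])
  interpret s: stationary_kernel M "K s" by (rule stationary_kernel[OF rs(2)])
  interpret rs: stationary_kernel M "K (r + s)" by (rule stationary_kernel) (use rs in simp)
  show ?thesis
    using rs.T_integral(1)[OF L2_fun_integrable[OF f]] AE_space
  proof eventually_elim
    case (elim z)
    have eq: "K (r + s) z = K r z \<bind> K s" using markov rs elim by (auto simp: markov_semigroup_def)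
    have "K r z \<rightarrow>\<^sub>M subprob_algebra M = M \<rightarrow>\<^sub>M subprob_algebra M"
      by (intro measurable_cong_sets r.kernel_sets elim refl)
    then have "K s \<in> K r z \<rightarrow>\<^sub>M subprob_algebra M" using s.kernel_subprob by simp
    moreover have "space (K r z) \<noteq> {}"
      using r.kernel_prob[of z] elim by (simp add: prob_space.not_empty)
    ultimately show ?case
      using integral_bind_kernel(3)[of "K s" "K r z" M f] elim(1)
      by (simp add: eq transition_operator_def[of "K r"] transition_operator_def[of "K (r + s)"])
  qed
qed

lemma graph_iff_tendsto:
  "(f, g) \<in> G \<longleftrightarrow> L2_fun M f \<and> L2_tendsto M (\<lambda>s z. (T s f z - f z) / s) (\<lambda>z. - g z) (at_right 0)"
proof -
  have "(f, g) \<in> G \<longleftrightarrow> (f, \<lambda>z. - g z) \<in> semigroup_generator M K"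
    unfolding generator operator_uminus_def
    by (auto simp: image_iff intro!: bexI[of _ "(f, \<lambda>z. - g z)"])
  moreover have "\<forall>\<^sub>F s in at_right 0. L2_fun M (\<lambda>z. (T s f z - f z) / s)" if "L2_fun M f"
    using eventually_at_right_less[of 0]
    by eventually_elim (intro L2_fun_intros T_L2 that; simp)
  ultimately show ?thesis
    by (auto simp: semigroup_generator_def L2_tendsto_def L2_normsq_eq_inner)
qed

text \<open>The contraction \<open>T s\<close> may be applied to the difference quotients defining
  the generator, and it commutes with \<open>T x\<close>.\<close>

lemma T_graph:
  assumes fg: "(f, g) \<in> G" and s: "s \<ge> 0"
  shows "(T s f, T s g) \<in> G"
proof -
  interpret s: stationary_kernel M "K s" by (rule stationary_kernel[OF s])
  note L2 = graph_L2[OF fg]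
  have "L2_tendsto M (\<lambda>x. T s (\<lambda>z. (T x f z - f z) / x)) (T s (\<lambda>z. - g z)) (at_right 0)"
    using fg unfolding graph_iff_tendsto by (intro s.T_tendsto) simp
  then have "L2_tendsto M (\<lambda>x z. (T x (T s f) z - T s f z) / x) (T s (\<lambda>z. - g z)) (at_right 0)"
  proof (rule L2_tendsto_cong_eventually)
    show "\<forall>\<^sub>F x in at_right 0. (AE z in M. T s (\<lambda>z. (T x f z - f z) / x) z = (T x (T s f) z - T s f z) / x)
        \<and> (\<lambda>z. (T x (T s f) z - T s f z) / x) \<in> borel_measurable M"
      using eventually_at_right_less[of 0]
    proof eventually_elim
      case (elim x)
      then have x: "x \<ge> 0" by simp
      have quot: "T s (\<lambda>z. (T x f z - f z) / x) z = T s (\<lambda>z. T x f z - f z) z / x" for z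
        by (simp add: transition_operator_def)
      have "AE z in M. T s (\<lambda>z. (T x f z - f z) / x) z = (T x (T s f) z - T s f z) / x"
        using T_add[OF x s L2(1)] T_add[OF s x L2(1)] s.T_diff[OF T_L2[OF x L2(1)] L2(1)]
        by eventually_elim (simp add: quot add.commute)
      moreover have "L2_fun M (\<lambda>z. (T x (T s f) z - T s f z) / x)"
        by (intro L2_fun_intros T_L2 L2 x s)
      ultimately show ?case by (simp add: L2_fun_def)
    qed
  qed
  moreover have "T s (\<lambda>z. - g z) = (\<lambda>z. - T s g z)"
    by (simp add: transition_operator_def[abs_def])
  ultimately show ?thesis using T_L2[OF s L2(1)] by (simp add: graph_iff_tendsto)
qed

text \<open>Membership in the graph gives only a right derivative at 0. Both one-sided quotients at
  \<open>s\<close> are a transition operator applied to a quotient at 0; contractivity controls its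
  error, and strong continuity the shift of base point.\<close>

lemma T_derivative:
  assumes fg: "(f, g) \<in> G" and s: "s \<ge> 0"
  shows "L2_tendsto M (\<lambda>x z. (T x f z - T s f z) / (x - s)) (\<lambda>z. - T s g z) (at s within {0..})"
proof -
  note L2 = graph_L2[OF fg]
  define \<alpha> where "\<alpha> \<delta> = L2_inner M (\<lambda>z. (T \<delta> f z - f z) / \<delta> - - g z) (\<lambda>z. (T \<delta> f z - f z) / \<delta> - - g z)" for \<delta>
  define \<beta> where "\<beta> \<delta> = L2_inner M (\<lambda>z. T \<delta> g z - g z) (\<lambda>z. T \<delta> g z - g z)" for \<delta>
  have \<alpha>: "(\<alpha> \<longlongrightarrow> 0) (at_right 0)"
    using fg unfolding graph_iff_tendsto by (simp add: L2_tendsto_def \<alpha>_def[abs_def])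
  have \<beta>: "(\<beta> \<longlongrightarrow> 0) (at_right 0)"
    using continuous L2 by (simp add: strongly_continuous_def L2_normsq_eq_inner \<beta>_def[abs_def])
  have ev: "\<forall>\<^sub>F x in at s within {0..}. x \<in> {0..} \<and> x \<noteq> s"
    by (auto simp: eventually_at_filter)
  have dist: "filterlim (\<lambda>x. \<bar>x - s\<bar>) (at_right 0) (at s within {0..})"
    unfolding filterlim_at
  proof
    show "\<forall>\<^sub>F x in at s within {0..}. \<bar>x - s\<bar> \<in> {0<..} \<and> \<bar>x - s\<bar> \<noteq> 0"
      using ev by eventually_elim simp
    show "((\<lambda>x. \<bar>x - s\<bar>) \<longlongrightarrow> 0) (at s within {0..})" by (auto intro!: tendsto_eq_intros)
  qed
  show ?thesis
  proof (rule L2_tendsto_squeeze)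
    show "L2_fun M (\<lambda>z. - T s g z)" by (intro L2_fun_intros T_L2 s L2)
    show "\<forall>\<^sub>F x in at s within {0..}. L2_fun M (\<lambda>z. (T x f z - T s f z) / (x - s))"
      using ev by eventually_elim (intro L2_fun_intros T_L2 s L2, simp)
    have "((\<lambda>x. 2 * \<alpha> \<bar>x - s\<bar> + 2 * \<beta> \<bar>x - s\<bar>) \<longlongrightarrow> 2 * 0 + 2 * 0) (at s within {0..})"
      by (intro tendsto_intros filterlim_compose[OF \<alpha> dist] filterlim_compose[OF \<beta> dist])
    then show "((\<lambda>x. 2 * \<alpha> \<bar>x - s\<bar> + 2 * \<beta> \<bar>x - s\<bar>) \<longlongrightarrow> 0) (at s within {0..})" by simp
    show "\<forall>\<^sub>F x in at s within {0..}.
        L2_inner M (\<lambda>z. (T x f z - T s f z) / (x - s) - - T s g z) (\<lambda>z. (T x f z - T s f z) / (x - s) - - T s g z)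
        \<le> 2 * \<alpha> \<bar>x - s\<bar> + 2 * \<beta> \<bar>x - s\<bar>"
      using ev
    proof eventually_elim
      case (elim x)
      \<comment> \<open>The smaller of the two times is factored out; for x < s numerator and
        denominator both change sign, so one formula covers both sides.\<close>
      define m where "m = min x s"
      define \<delta> where "\<delta> = \<bar>x - s\<bar>"
      have m: "m \<ge> 0" and \<delta>: "\<delta> > 0" "\<delta> \<ge> 0" and x: "x \<ge> 0" using elim s by (auto simp: m_def \<delta>_def)
      interpret m: stationary_kernel M "K m" by (rule stationary_kernel[OF m])
      define q where "q z = (T \<delta> f z - f z) / \<delta>" for z
      have q: "L2_fun M q" unfolding q_def[abs_def] by (intro L2_fun_intros T_L2 L2 \<delta>)
      have split: "AE z in M. T (m + \<delta>) k z = T m (T \<delta> k) z" if "L2_fun M k" for k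
        by (rule T_add[OF m \<delta>(2) that])
      have Tq: "T m q z = T m (\<lambda>y. T \<delta> f y - f y) z / \<delta>" for z
        by (simp add: q_def[abs_def] transition_operator_def)
      have quot: "AE z in M. (T x f z - T s f z) / (x - s) = T m q z"
        using split[OF L2(1)] m.T_diff[OF T_L2[OF \<delta>(2) L2(1)] L2(1)]
      proof eventually_elim
        case (elim z)
        show ?case
        proof (cases "s \<le> x")
          case True
          then have "m = s" "x = m + \<delta>" "x - s = \<delta>" by (auto simp: m_def \<delta>_def)
          then show ?thesis using elim Tq[of z] by simp
        next
          case False
          then have "m = x" "s = m + \<delta>" "x - s = - \<delta>" by (auto simp: m_def \<delta>_def)
          then show ?thesis using elim Tq[of z] by (simp add: minus_divide_left)
        qed
      qed
      have \<beta>_bound: "L2_inner M (\<lambda>z. T s g z - T m g z) (\<lambda>z. T s g z - T m g z) \<le> \<beta> \<delta>"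
      proof (cases "s \<le> x")
        case True
        then show ?thesis by (simp add: m_def \<beta>_def L2_inner_zero_left L2_inner_self_nonneg)
      next
        case False
        then have "s = m + \<delta>" by (simp add: m_def \<delta>_def)
        then have "AE z in M. T s g z = T m (T \<delta> g) z" using split[OF L2(2)] by simp
        then have "L2_inner M (\<lambda>z. T s g z - T m g z) (\<lambda>z. T s g z - T m g z)
            = L2_inner M (\<lambda>z. T m (T \<delta> g) z - T m g z) (\<lambda>z. T m (T \<delta> g) z - T m g z)"
          using T_measurable[OF s L2(2)] T_measurable[OF m L2(2)] T_measurable[OF m T_L2[OF \<delta>(2) L2(2)]]
          by (intro L2_inner_cong_AE) auto
        also have "\<dots> \<le> \<beta> \<delta>" unfolding \<beta>_def by (intro m.T_diff_le T_L2 \<delta> L2)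
        finally show ?thesis .
      qed
      have \<alpha>_bound: "L2_inner M (\<lambda>z. T m q z + T m g z) (\<lambda>z. T m q z + T m g z) \<le> \<alpha> \<delta>"
        using m.T_diff_le[OF q L2_fun_uminus[OF L2(2)]]
        by (simp add: \<alpha>_def q_def transition_operator_def[of "K m" "\<lambda>z. - g z"]
            flip: transition_operator_def[of "K m" g])
      have "L2_inner M (\<lambda>z. (T x f z - T s f z) / (x - s) - - T s g z) (\<lambda>z. (T x f z - T s f z) / (x - s) - - T s g z)
        = L2_inner M (\<lambda>z. (T m q z + T m g z) + (T s g z - T m g z)) (\<lambda>z. (T m q z + T m g z) + (T s g z - T m g z))"
      proof -
        have "AE z in M. (T x f z - T s f z) / (x - s) - - T s g z = (T m q z + T m g z) + (T s g z - T m g z)"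
          using quot by eventually_elim simp
        moreover have [measurable]: "T x f \<in> borel_measurable M" "T s f \<in> borel_measurable M"
          "T s g \<in> borel_measurable M" "T m q \<in> borel_measurable M" "T m g \<in> borel_measurable M"
          by (intro T_measurable x s m L2 q)+
        ultimately show ?thesis by (intro L2_inner_cong_AE) auto
      qed
      also have "\<dots> \<le> 2 * L2_inner M (\<lambda>z. T m q z + T m g z) (\<lambda>z. T m q z + T m g z)
          + 2 * L2_inner M (\<lambda>z. T s g z - T m g z) (\<lambda>z. T s g z - T m g z)"
        by (intro L2_inner_add_self_le L2_fun_intros T_L2 m s L2 q)
      also have "\<dots> \<le> 2 * \<alpha> \<delta> + 2 * \<beta> \<delta>" using \<alpha>_bound \<beta>_bound by simp
      finally show ?case by (simp add: \<delta>_def)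
    qed
  qed
qed

lemma inner_derivative:
  assumes "(f, g) \<in> G" "L2_fun M h" "s \<ge> 0"
  shows "((\<lambda>x. L2_inner M (T x f) h) has_real_derivative - L2_inner M (T s g) h) (at s within {0..})"
proof -
  have "((\<lambda>x. L2_inner M (T x f) h) has_real_derivative
      L2_inner M (\<lambda>z. - T s g z) h + L2_inner M (T s f) (\<lambda>z. 0)) (at s within {0..})"
  proof (rule L2_inner_has_real_derivative[OF T_derivative[OF assms(1,3)]])
    show "L2_tendsto M (\<lambda>x z. (h z - h z) / (x - s)) (\<lambda>z. 0) (at s within {0..})"
      by (simp add: L2_tendsto_const L2_fun_zero)
  qed (use assms graph_L2[OF assms(1)] in \<open>auto intro: T_L2\<close>)
  then show ?thesis by (simp add: L2_inner_linear)
qed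

text \<open>The pairing solves y' = -\<mu> y, so its product with the growing exponential is
  constant. Stating the eigenvalue relation for the pairing alone covers an eigenfunction in the
  first slot as well as one in the second.\<close>

lemma inner_exponential:
  assumes fg: "(f, g) \<in> G" and h: "L2_fun M h" and t: "t \<ge> 0"
    and eq: "\<And>s. s \<ge> 0 \<Longrightarrow> L2_inner M (T s g) h = \<mu> * L2_inner M (T s f) h"
  shows "L2_inner M (T t f) h = exp (- \<mu> * t) * L2_inner M f h"
proof -
  have "\<exists>c. \<forall>x\<in>{0..}. exp (\<mu> * x) * L2_inner M (T x f) h = c"
  proof (rule has_field_derivative_zero_constant)
    fix x :: real assume x: "x \<in> {0..}"
    have "((\<lambda>x. exp (\<mu> * x) * L2_inner M (T x f) h) has_real_derivative
        exp (\<mu> * x) * - L2_inner M (T x g) h + \<mu> * exp (\<mu> * x) * L2_inner M (T x f) h) (at x within {0..})"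
      using x by (auto intro!: derivative_eq_intros inner_derivative[OF fg h])
    then show "((\<lambda>x. exp (\<mu> * x) * L2_inner M (T x f) h) has_real_derivative 0) (at x within {0..})"
      using eq[of x] x by simp
  qed simp
  then obtain c where "\<And>x. x \<in> {0..} \<Longrightarrow> exp (\<mu> * x) * L2_inner M (T x f) h = c" by blast
  from this[of t] this[of 0] t have "exp (\<mu> * t) * L2_inner M (T t f) h = L2_inner M (T 0 f) h" by simp
  also have "\<dots> = L2_inner M f h"
    using T_0[OF graph_L2(1)[OF fg]] graph_L2[OF fg] h T_measurable[of 0 f]
    by (intro L2_inner_cong_AE) (auto simp: L2_fun_def)
  finally show ?thesis by (simp add: exp_minus field_simps)
qed

text \<open>Testing with the error \<open>w\<close> itself yields <w, w> = 0.\<close>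

lemma T_eigenfunction:
  assumes f: "(f, \<lambda>z. \<mu> * f z) \<in> G" and t: "t \<ge> 0"
  shows "AE z in M. T t f z = exp (- \<mu> * t) * f z"
proof -
  note f_L2 = graph_L2(1)[OF f]
  define w where "w z = T t f z - exp (- \<mu> * t) * f z" for z
  have w: "L2_fun M w" unfolding w_def[abs_def] by (intro L2_fun_intros T_L2 t f_L2)
  have "L2_inner M (T t f) w = exp (- \<mu> * t) * L2_inner M f w"
  proof (rule inner_exponential[OF f w t])
    fix s :: real
    have "T s (\<lambda>z. \<mu> * f z) = (\<lambda>z. \<mu> * T s f z)" by (simp add: transition_operator_def[abs_def])
    then show "L2_inner M (T s (\<lambda>z. \<mu> * f z)) w = \<mu> * L2_inner M (T s f) w"
      by (simp add: L2_inner_scale_left)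
  qed
  moreover have "L2_inner M w w = L2_inner M (T t f) w - exp (- \<mu> * t) * L2_inner M f w"
    using L2_inner_diff_left[OF T_L2[OF t f_L2] L2_fun_scale[OF f_L2] w, of "exp (- \<mu> * t)"]
    by (simp add: w_def[abs_def] L2_inner_scale_left)
  ultimately have "AE z in M. w z = 0" using L2_inner_self_eq_0_iff[OF w] by simp
  then show ?thesis by eventually_elim (simp add: w_def)
qed

text \<open>Contractivity gives <T s f, f> <= <f, f>, so the difference quotients paired with
  \<open>f\<close> are nonpositive, and so is their limit -<g, f>.\<close>

lemma graph_nonneg:
  assumes fg: "(f, g) \<in> G"
  shows "0 \<le> L2_inner M g f"
proof -
  note L2 = graph_L2[OF fg]
  have "((\<lambda>s. L2_inner M (\<lambda>z. (T s f z - f z) / s) f) \<longlongrightarrow> L2_inner M (\<lambda>z. - g z) f) (at_right 0)"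
    using fg unfolding graph_iff_tendsto by (intro L2_tendsto_inner L2_tendsto_const) auto
  moreover have "\<forall>\<^sub>F s in at_right 0. L2_inner M (\<lambda>z. (T s f z - f z) / s) f \<le> 0"
    using eventually_at_right_less[of 0]
  proof eventually_elim
    case (elim s)
    then have s: "s \<ge> 0" by simp
    have "(L2_inner M (T s f) f)\<^sup>2 \<le> L2_inner M (T s f) (T s f) * L2_inner M f f"
      by (intro L2_Cauchy_Schwarz T_L2 s L2)
    also have "\<dots> \<le> L2_inner M f f * L2_inner M f f"
      by (intro mult_right_mono L2_inner_self_nonneg stationary_kernel.T_L2(2)[OF stationary_kernel] s L2)
    finally have "(L2_inner M (T s f) f)\<^sup>2 \<le> (L2_inner M f f)\<^sup>2" by (simp add: power2_eq_square)
    then have "L2_inner M (T s f) f \<le> L2_inner M f f"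
      by (rule power2_le_imp_le) (rule L2_inner_self_nonneg)
    then show ?case using elim L2 T_L2[OF s L2(1)]
      by (simp add: L2_inner_linear L2_fun_intros divide_le_0_iff)
  qed
  ultimately have "L2_inner M (\<lambda>z. - g z) f \<le> 0"
    by (intro tendsto_upperbound) auto
  then show ?thesis by (simp add: L2_inner_uminus_left)
qed

lemma const_graph: "(\<lambda>z. a, \<lambda>z. 0) \<in> G"
proof -
  have "L2_tendsto M (\<lambda>s z. 0) (\<lambda>z. - 0) (at_right 0)"
    by (simp add: L2_tendsto_const L2_fun_zero)
  then have "L2_tendsto M (\<lambda>s z. (T s (\<lambda>z. a) z - a) / s) (\<lambda>z. - 0) (at_right 0)"
  proof (rule L2_tendsto_cong_eventually)
    show "\<forall>\<^sub>F s in at_right 0. (AE z in M. 0 = (T s (\<lambda>z. a) z - a) / s)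
        \<and> (\<lambda>z. (T s (\<lambda>z. a) z - a) / s) \<in> borel_measurable M"
      using eventually_at_right_less[of 0]
    proof eventually_elim
      case (elim s)
      then interpret s: stationary_kernel M "K s" by (intro stationary_kernel) simp
      have "AE z in M. 0 = (T s (\<lambda>z. a) z - a) / s"
        by (rule AE_I2) (simp add: transition_operator_def prob_space.prob_space[OF s.kernel_prob])
      then show ?case using s.T_measurable[of "\<lambda>z. a"] by simp
    qed
  qed
  then show ?thesis by (simp add: graph_iff_tendsto L2_fun_const)
qed

end

section \<open>Exponential decay on the complement\<close>

locale L2_semigroup_eigensystem = L2_semigroup M G K + L2_eigensystem M G I e \<nu>
  for M :: "'a measure" and G K and I :: "'i set" and e \<nu> +
  fixes \<kappa>
  assumes lower_bound: "(f, g) \<in> G \<Longrightarrow> orth f \<Longrightarrow> \<kappa> * L2_inner M f f \<le> L2_inner M g f"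
begin

text \<open>Each coefficient along an eigenvector evolves by an exponential factor, so a zero
  coefficient stays zero.\<close>

lemma T_orth_graph:
  assumes fg: "(f, g) \<in> G" "orth f" and t: "t \<ge> 0"
  shows "orth (T t f)"
  unfolding orth_def
proof (intro conjI ballI T_L2 t graph_L2(1)[OF fg(1)])
  fix i assume i: "i \<in> I"
  have "L2_inner M (T t f) (e i) = exp (- \<nu> i * t) * L2_inner M f (e i)"
    by (rule inner_exponential[OF fg(1) e_L2[OF i] t])
      (rule inner_graph_eigen[OF T_graph[OF fg(1)] i])
  then show "L2_inner M (T t f) (e i) = 0" using fg(2) i by (simp add: orth_def)
qed

text \<open>A Gronwall argument: exp(2 \<kappa> x) ||T x f||^2 has nonpositive derivative by the
  lower bound applied to \<open>T x f\<close>, which stays in the domain and in the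
  complement.\<close>

lemma T_decay_graph:
  assumes fg: "(f, g) \<in> G" "orth f" and t: "t > 0"
  shows "L2_inner M (T t f) (T t f) \<le> (exp (- \<kappa> * t))\<^sup>2 * L2_inner M f f"
proof -
  note L2 = graph_L2[OF fg(1)]
  define \<phi> where "\<phi> x = L2_inner M (T x f) (T x f)" for x
  define \<psi> where "\<psi> x = exp (2 * \<kappa> * x) * \<phi> x" for x
  have \<phi>: "(\<phi> has_real_derivative - 2 * L2_inner M (T x g) (T x f)) (at x within {0..})" if x: "x \<ge> 0" for x
  proof -
    have "(\<phi> has_real_derivative L2_inner M (\<lambda>z. - T x g z) (T x f) + L2_inner M (T x f) (\<lambda>z. - T x g z)) (at x within {0..})"
      unfolding \<phi>_def[abs_def]
      by (rule L2_inner_has_real_derivative[OF T_derivative[OF fg(1) x] T_derivative[OF fg(1) x]])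
        (use x L2 in \<open>auto intro: T_L2\<close>)
    then show ?thesis by (simp add: L2_inner_linear L2_inner_commute[of M "T x f" "T x g"])
  qed
  have \<psi>: "(\<psi> has_real_derivative exp (2 * \<kappa> * x) * (2 * \<kappa> * \<phi> x - 2 * L2_inner M (T x g) (T x f))) (at x within {0..})"
    if x: "x \<ge> 0" for x
    unfolding \<psi>_def[abs_def]
    by (auto intro!: derivative_eq_intros \<phi>[OF x] simp: algebra_simps)
  have "\<psi> t \<le> \<psi> 0"
  proof (rule DERIV_nonpos_imp_decreasing_open[OF less_imp_le[OF t]])
    fix x :: real assume x: "0 < x" "x < t"
    then have "at x within {0..} = at x" by (intro at_within_interior) simp
    then have "(\<psi> has_real_derivative exp (2 * \<kappa> * x) * (2 * \<kappa> * \<phi> x - 2 * L2_inner M (T x g) (T x f))) (at x)"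
      using \<psi>[of x] x by simp
    moreover have "exp (2 * \<kappa> * x) * (2 * \<kappa> * \<phi> x - 2 * L2_inner M (T x g) (T x f)) \<le> 0"
      using lower_bound[OF T_graph[OF fg(1)] T_orth_graph[OF fg]] x
      by (intro mult_nonneg_nonpos) (auto simp: \<phi>_def)
    ultimately show "\<exists>y. DERIV \<psi> x :> y \<and> y \<le> 0" by blast
  next
    have "continuous_on {0..} \<psi>"
      by (rule DERIV_continuous_on[OF \<psi>]) simp
    then show "continuous_on {0..t} \<psi>" by (rule continuous_on_subset) auto
  qed
  moreover have "\<phi> 0 = L2_inner M f f"
    unfolding \<phi>_def using T_0[OF L2(1)] T_measurable[of 0 f] L2
    by (intro L2_inner_cong_AE) (auto simp: L2_fun_def)
  ultimately have "exp (2 * \<kappa> * t) * \<phi> t \<le> L2_inner M f f" by (simp add: \<psi>_def)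
  then have "(exp (- \<kappa> * t) ^ 2 * exp (2 * \<kappa> * t)) * \<phi> t \<le> exp (- \<kappa> * t) ^ 2 * L2_inner M f f"
    unfolding mult.assoc by (intro mult_left_mono) auto
  moreover have "exp (- \<kappa> * t) ^ 2 * exp (2 * \<kappa> * t) = 1"
    by (simp add: power2_eq_square flip: exp_add)
  ultimately show ?thesis by (simp only: \<phi>_def mult_1_left)
qed

text \<open>Both claims pass from the domain to the whole complement by density; the approximants
  are projected with \<open>remainder\<close> so that the statements for the domain apply to
  them.\<close>

theorem T_orth:
  assumes f: "orth f" and t: "t > 0"
  shows "orth (T t f)" and "L2_inner M (T t f) (T t f) \<le> (exp (- \<kappa> * t))\<^sup>2 * L2_inner M f f"
proof -
  have t0: "t \<ge> 0" using t by simp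
  have "\<exists>a b. (a, b) \<in> G \<and> L2_inner M (\<lambda>z. a z - f z) (\<lambda>z. a z - f z) < 1 / Suc n" for n
  proof -
    have "densely_defined M G" using self_adjoint by (simp add: self_adjoint_def)
    moreover have "1 / real (Suc n) > 0" by simp
    ultimately have "\<exists>(a, b)\<in>G. L2_normsq M (\<lambda>z. a z - f z) < 1 / real (Suc n)"
      unfolding densely_defined_def using orth_L2[OF f] by blast
    then show ?thesis by (auto simp: L2_normsq_eq_inner)
  qed
  then obtain a b where ab: "\<And>n. (a n, b n) \<in> G"
    and close: "\<And>n. L2_inner M (\<lambda>z. a n z - f z) (\<lambda>z. a n z - f z) < 1 / Suc n" by metis
  have "L2_tendsto M a f sequentially"
  proof (rule L2_tendsto_squeeze)
    show "(\<lambda>n. 1 / real (Suc n)) \<longlonglongrightarrow> 0" by (intro LIMSEQ_Suc lim_1_over_n)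
    show "L2_fun M f" by (rule orth_L2[OF f])
    show "\<forall>\<^sub>F n in sequentially. L2_fun M (a n)"
      using graph_L2(1)[OF ab] by simp
    show "\<forall>\<^sub>F n in sequentially. L2_inner M (\<lambda>z. a n z - f z) (\<lambda>z. a n z - f z) \<le> 1 / real (Suc n)"
      using less_imp_le[OF close] by (intro always_eventually allI)
  qed
  then have lim: "L2_tendsto M (\<lambda>n. remainder (a n)) f sequentially" by (rule remainder_tendsto[OF _ f])
  then have lim_T: "L2_tendsto M (\<lambda>n. T t (remainder (a n))) (T t f) sequentially" by (rule stationary_kernel.T_tendsto[OF stationary_kernel[OF t0]])
  note rem = remainder_graph[OF ab] orth_remainder[OF graph_L2(1)[OF ab]]
  show "orth (T t f)"
    unfolding orth_def
  proof (intro conjI ballI T_L2 orth_L2[OF f] t0)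
    fix i assume i: "i \<in> I"
    have "(\<lambda>n. L2_inner M (T t (remainder (a n))) (e i)) \<longlonglongrightarrow> L2_inner M (T t f) (e i)"
      by (intro L2_tendsto_inner lim_T L2_tendsto_const e_L2 i)
    moreover have "L2_inner M (T t (remainder (a n))) (e i) = 0" for n
      using T_orth_graph[OF rem, of t n] t i by (simp add: orth_def)
    ultimately show "L2_inner M (T t f) (e i) = 0" by (simp add: LIMSEQ_const_iff)
  qed
  show "L2_inner M (T t f) (T t f) \<le> (exp (- \<kappa> * t))\<^sup>2 * L2_inner M f f"
  proof (rule LIMSEQ_le)
    show "(\<lambda>n. L2_inner M (T t (remainder (a n))) (T t (remainder (a n)))) \<longlonglongrightarrow> L2_inner M (T t f) (T t f)"
      by (intro L2_tendsto_inner lim_T)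
    show "(\<lambda>n. (exp (- \<kappa> * t))\<^sup>2 * L2_inner M (remainder (a n)) (remainder (a n)))
        \<longlonglongrightarrow> (exp (- \<kappa> * t))\<^sup>2 * L2_inner M f f"
      by (intro tendsto_mult_left L2_tendsto_inner lim)
  qed (use T_decay_graph[OF rem t] in blast)
qed

end

section \<open>The orthogonal Procrustes problem\<close>

lemma matrix_inner_sum: "A \<bullet> B = (\<Sum>i\<in>UNIV. \<Sum>j\<in>UNIV. A $ i $ j * B $ i $ j)" for A B :: "real^'n^'m"
  by (simp add: inner_vec_def)

lemma matrix_mult_inner_left: "(Q ** X) \<bullet> Y = X \<bullet> (transpose Q ** Y)"
  for Q :: "real^'n^'m" and X :: "real^'k^'n"
proof -
  have "(Q ** X) \<bullet> Y = (\<Sum>i\<in>UNIV. \<Sum>j\<in>UNIV. \<Sum>k\<in>UNIV. Q $ i $ k * X $ k $ j * Y $ i $ j)"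
    by (simp add: matrix_inner_sum matrix_matrix_mult_def sum_distrib_right)
  also have "\<dots> = (\<Sum>i\<in>UNIV. \<Sum>k\<in>UNIV. \<Sum>j\<in>UNIV. Q $ i $ k * X $ k $ j * Y $ i $ j)"
    by (intro sum.cong refl sum.swap)
  also have "\<dots> = (\<Sum>k\<in>UNIV. \<Sum>i\<in>UNIV. \<Sum>j\<in>UNIV. Q $ i $ k * X $ k $ j * Y $ i $ j)"
    by (rule sum.swap)
  also have "\<dots> = (\<Sum>k\<in>UNIV. \<Sum>j\<in>UNIV. \<Sum>i\<in>UNIV. Q $ i $ k * X $ k $ j * Y $ i $ j)"
    by (intro sum.cong refl sum.swap)
  also have "\<dots> = X \<bullet> (transpose Q ** Y)"
    by (simp add: matrix_inner_sum matrix_matrix_mult_def transpose_def sum_distrib_left mult_ac)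
  finally show ?thesis .
qed

lemma norm_orthogonal_mult_left:
  fixes Q X :: "real^'n^'n"
  shows "orthogonal_matrix Q \<Longrightarrow> norm (Q ** X) = norm X"
  by (simp add: norm_eq_sqrt_inner matrix_mult_inner_left matrix_mul_assoc orthogonal_matrix_def)

lemma norm_transpose: "norm (transpose X) = norm X" for X :: "real^'n^'m"
proof -
  have "transpose X \<bullet> transpose X = X \<bullet> X"
    unfolding matrix_inner_sum transpose_def by (subst sum.swap) simp
  then show ?thesis by (simp add: norm_eq_sqrt_inner)
qed

lemma norm_orthogonal_mult_right:
  fixes Q X :: "real^'n^'n"
  assumes "orthogonal_matrix Q"
  shows "norm (X ** transpose Q) = norm X"
proof -
  have "norm (X ** transpose Q) = norm (transpose (Q ** transpose X))"
    by (simp add: matrix_transpose_mul)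
  then show ?thesis using norm_orthogonal_mult_left[OF assms] by (simp add: norm_transpose)
qed

section \<open>Traces, reflections and the polar factor\<close>

lemma matrix_inner_linear_map:
  fixes f :: "real^'n \<Rightarrow> real^'n" and H :: "real^'n^'n"
  shows "matrix f \<bullet> H = (\<Sum>j\<in>UNIV. f (axis j 1) \<bullet> (H *v axis j 1))"
proof -
  have "matrix f \<bullet> H = (\<Sum>j\<in>UNIV. \<Sum>i\<in>UNIV. f (axis j 1) $ i * H $ i $ j)"
    unfolding matrix_inner_sum matrix_def by (subst sum.swap) simp
  then show ?thesis
    by (simp add: inner_vec_def matrix_vector_mult_basis column_def)
qed

text \<open>The left side is the trace of a rank one map against \<open>H\<close>; such terms are
  what reflections contribute to a trace.\<close>

lemma sum_axis_mult: "(\<Sum>j\<in>UNIV. (axis j 1 \<bullet> v) * (u \<bullet> (H *v axis j 1))) = u \<bullet> (H *v v)"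
  for u v :: "real^'n" and H :: "real^'n^'n"
proof -
  have "u \<bullet> (H *v v) = (\<Sum>i\<in>UNIV. \<Sum>j\<in>UNIV. u $ i * (H $ i $ j * v $ j))"
    by (simp add: inner_vec_def matrix_vector_mult_def sum_distrib_left)
  also have "\<dots> = (\<Sum>j\<in>UNIV. \<Sum>i\<in>UNIV. u $ i * (H $ i $ j * v $ j))" by (rule sum.swap)
  also have "\<dots> = (\<Sum>j\<in>UNIV. (axis j 1 \<bullet> v) * (u \<bullet> (H *v axis j 1)))"
  proof (intro sum.cong refl)
    fix j
    have "axis j 1 \<bullet> v = v $ j" by (simp add: inner_axis')
    moreover have "u \<bullet> (H *v axis j 1) = (\<Sum>i\<in>UNIV. u $ i * H $ i $ j)"
      by (simp add: inner_vec_def matrix_vector_mult_basis column_def)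
    ultimately show "(\<Sum>i\<in>UNIV. u $ i * (H $ i $ j * v $ j)) = (axis j 1 \<bullet> v) * (u \<bullet> (H *v axis j 1))"
      by (simp add: sum_distrib_left mult_ac)
  qed
  finally show ?thesis by simp
qed

definition householder :: "real^'n \<Rightarrow> real^'n \<Rightarrow> real^'n" where
  "householder v x = x - (2 * (x \<bullet> v) / (v \<bullet> v)) *\<^sub>R v"

lemma orthogonal_transformation_householder:
  "v \<noteq> 0 \<Longrightarrow> orthogonal_transformation (householder v)"
  unfolding orthogonal_transformation_def
proof (intro conjI allI linearI)
  fix x y and r :: real
  assume v: "v \<noteq> 0"
  show "householder v (x + y) = householder v x + householder v y"
    by (simp add: householder_def algebra_simps add_divide_distrib)
  show "householder v (r *\<^sub>R x) = r *\<^sub>R householder v x"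
    by (simp add: householder_def algebra_simps)
  show "householder v x \<bullet> householder v y = x \<bullet> y"
    using v by (simp add: householder_def inner_diff_left inner_diff_right inner_commute[of v y])
qed

text \<open>The orthogonal polar factor, obtained as the maximizer of \<open>tr (Q\<^sup>T A)\<close> over \<open>O(n)\<close>: comparing
  it with products of one and of two reflections shows that \<open>Q\<^sup>T A\<close> is positive semidefinite and
  symmetric.\<close>

lemma polar_factor_exists:
  fixes A :: "real^'n^'n"
  obtains Q where "orthogonal_matrix Q" "transpose (transpose Q ** A) = transpose Q ** A"
    "\<And>v. 0 \<le> v \<bullet> ((transpose Q ** A) *v v)"
proof -
  let ?O = "{Q :: real^'n^'n. orthogonal_matrix Q}"
  have "compact ?O"
    unfolding compact_eq_bounded_closed
  proof
    have "norm Q = norm (mat 1 :: real^'n^'n)" if "orthogonal_matrix Q" for Q :: "real^'n^'n"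
      using norm_orthogonal_mult_left[OF that, of "mat 1"] by simp
    then show "bounded ?O" by (intro boundedI[of _ "norm (mat 1 :: real^'n^'n)"]) auto
    have "continuous_on UNIV (\<lambda>Q :: real^'n^'n. transpose Q ** Q)"
      unfolding matrix_matrix_mult_def transpose_def by (auto intro!: continuous_intros)
    then have "closed ((\<lambda>Q :: real^'n^'n. transpose Q ** Q) -` {mat 1})"
      by (simp add: closed_vimage)
    moreover have "?O = (\<lambda>Q. transpose Q ** Q) -` {mat 1}" by (auto simp: orthogonal_matrix)
    ultimately show "closed ?O" by simp
  qed
  moreover have "?O \<noteq> {}" using orthogonal_matrix_id by auto
  moreover have "continuous_on ?O (\<lambda>Q. Q \<bullet> A)" by (intro continuous_intros)
  ultimately obtain Q where Q: "orthogonal_matrix Q"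
    and max: "\<And>R. orthogonal_matrix R \<Longrightarrow> R \<bullet> A \<le> Q \<bullet> A"
    using continuous_attains_sup[of ?O "\<lambda>Q. Q \<bullet> A"] by auto
  define H where "H = transpose Q ** A"
  define tr where "tr = (\<Sum>j\<in>UNIV. axis j 1 \<bullet> (H *v axis j 1))"
  \<comment> \<open>\<open>Q\<close> composed with \<open>f\<close> competes in the maximization,
    and moving \<open>Q\<close> over to \<open>A\<close> turns this into a comparison of traces
    against \<open>H\<close>.\<close>
  have tr_max: "(\<Sum>j\<in>UNIV. f (axis j 1) \<bullet> (H *v axis j 1)) \<le> tr" if f: "orthogonal_transformation f" for f :: "real^'n \<Rightarrow> real^'n"
  proof -
    have "orthogonal_matrix (matrix f)" using f by (simp add: orthogonal_transformation_matrix)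
    then have "(Q ** matrix f) \<bullet> A \<le> Q \<bullet> A" by (intro max orthogonal_matrix_mul Q)
    also have "Q \<bullet> A = (Q ** matrix (\<lambda>x. x)) \<bullet> A" by (simp add: matrix_id_mat_1 flip: id_def)
    finally show ?thesis
      by (simp add: matrix_mult_inner_left matrix_inner_linear_map tr_def H_def)
  qed
  \<comment> \<open>One reflection changes the trace by -2 <v, H v> / <v, v>, which cannot be
    positive.\<close>
  have psd: "0 \<le> v \<bullet> (H *v v)" for v
  proof (cases "v = 0")
    case False
    have "(\<Sum>j\<in>UNIV. householder v (axis j 1) \<bullet> (H *v axis j 1))
        = tr - 2 / (v \<bullet> v) * (\<Sum>j\<in>UNIV. (axis j 1 \<bullet> v) * (v \<bullet> (H *v axis j 1)))"
      by (simp add: householder_def tr_def inner_diff_left sum_subtractf sum_distrib_left mult.assoc)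
    then have "0 \<le> 2 / (v \<bullet> v) * (v \<bullet> (H *v v))"
      using tr_max[OF orthogonal_transformation_householder[OF False]] by (simp add: sum_axis_mult)
    moreover have "2 / (v \<bullet> v) > 0" using False by simp
    ultimately show ?thesis by (metis mult_le_cancel_left_pos mult_zero_right)
  qed simp
  \<comment> \<open>Under two reflections the trace changes by the two single contributions plus a
    cross term carrying <u, H v>, the only quantity that sees asymmetry.\<close>
  have two: "2 * (u \<bullet> v) * (u \<bullet> (H *v v)) \<le> (u \<bullet> u) * (v \<bullet> (H *v v)) + (v \<bullet> v) * (u \<bullet> (H *v u))"
    if "u \<noteq> 0" "v \<noteq> 0" for u v
  proof -
    have pos: "u \<bullet> u > 0" "v \<bullet> v > 0" using that by simp_all
    let ?a = "2 / (u \<bullet> u)" and ?b = "2 / (v \<bullet> v)"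
    have "householder u (householder v x) \<bullet> y
        = x \<bullet> y - ?b * ((x \<bullet> v) * (v \<bullet> y)) - ?a * ((x \<bullet> u) * (u \<bullet> y)) + ?a * ?b * (u \<bullet> v) * ((x \<bullet> v) * (u \<bullet> y))"
      for x y
      using pos by (simp add: householder_def inner_diff_left inner_commute[of v u])
        (simp add: field_simps)
    then have "(\<Sum>j\<in>UNIV. (householder u \<circ> householder v) (axis j 1) \<bullet> (H *v axis j 1))
        = tr - ?b * (v \<bullet> (H *v v)) - ?a * (u \<bullet> (H *v u)) + ?a * ?b * (u \<bullet> v) * (u \<bullet> (H *v v))"
      by (simp add: tr_def sum_subtractf sum.distrib sum_axis_mult del: times_divide_eq_left
          flip: sum_distrib_left)
    moreover have "(\<Sum>j\<in>UNIV. (householder u \<circ> householder v) (axis j 1) \<bullet> (H *v axis j 1)) \<le> tr"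
      using tr_max[OF orthogonal_transformation_compose[OF orthogonal_transformation_householder
          orthogonal_transformation_householder], of u v] that by simp
    ultimately have "?a * ?b * (u \<bullet> v) * (u \<bullet> (H *v v)) \<le> ?b * (v \<bullet> (H *v v)) + ?a * (u \<bullet> (H *v u))"
      by simp
    then show ?thesis using pos by (simp add: field_simps)
  qed
  have sym: "H $ i $ j = H $ j $ i" for i j
  proof (cases "i = j")
    case False
    let ?u = "axis i 1 :: real^'n" and ?w = "axis j 1 :: real^'n"
    have ip: "?u \<bullet> ?u = 1" "?w \<bullet> ?w = 1" "?u \<bullet> ?w = 0" "?w \<bullet> ?u = 0"
      using False by (simp_all add: inner_axis_axis)
    have H_ip: "axis a 1 \<bullet> (H *v axis b 1) = H $ a $ b" for a b
      by (simp add: inner_axis' matrix_vector_mult_basis column_def)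
    \<comment> \<open>The previous inequality for a standard basis vector and its perturbation by
      \<open>x\<close> times another one; the constant term cancels, so the linear coefficient, the
      asymmetry of \<open>H\<close>, must be 0.\<close>
    have "0 + 2 * ((H $ j $ i - H $ i $ j) / 2) * x + (H $ i $ i + H $ j $ j) * x\<^sup>2 \<ge> 0" for x
    proof -
      have "?u + x *\<^sub>R ?w \<noteq> 0"
      proof
        assume "?u + x *\<^sub>R ?w = 0"
        then have "(?u + x *\<^sub>R ?w) \<bullet> ?u = 0" by simp
        then show False by (simp add: inner_add_left ip)
      qed
      from two[OF _ this, of ?u] show ?thesis
        by (simp add: inner_add_left inner_add_right matrix_vector_right_distrib
            matrix_vector_mult_scaleR ip H_ip power2_eq_square algebra_simps diff_divide_distrib)
    qed
    from discriminant_bound[OF this] show ?thesis by simp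
  qed simp
  show thesis
  proof (rule that[OF Q])
    show "transpose (transpose Q ** A) = transpose Q ** A"
      unfolding H_def[symmetric] using sym by (simp add: transpose_def vec_eq_iff)
    show "\<And>v. 0 \<le> v \<bullet> ((transpose Q ** A) *v v)" using psd by (simp add: H_def)
  qed
qed

section \<open>Distance to the orthogonal group\<close>

lemma matrix_sub_ldistrib: "A ** (B - C) = A ** B - A ** C" for A :: "real^'n^'m"
  by (simp add: matrix_matrix_mult_def vec_eq_iff right_diff_distrib sum_subtractf)

lemma matrix_sub_rdistrib: "(B - C) ** A = B ** A - C ** A" for A :: "real^'k^'n"
  by (simp add: matrix_matrix_mult_def vec_eq_iff left_diff_distrib sum_subtractf)

text \<open>With the polar decomposition A = Q H and X = I - H, orthogonal invariance reduces the
  claim to ||X|| <= ||I - H^2||. Here I - H^2 = X + X H, and <X, X H> >= 0 because the rows of X H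
  are H applied to the rows of X.\<close>

lemma nearest_orthogonal_matrix:
  fixes A :: "real^'n^'n"
  shows "\<exists>Q. orthogonal_matrix Q \<and> norm (A - Q) \<le> norm (mat 1 - A ** transpose A)"
proof -
  obtain Q where Q: "orthogonal_matrix Q" "transpose (transpose Q ** A) = transpose Q ** A"
    "\<And>v. 0 \<le> v \<bullet> ((transpose Q ** A) *v v)"
    by (rule polar_factor_exists[of A]) blast
  define H where "H = transpose Q ** A"
  define X where "X = mat 1 - H"
  have QQ: "Q ** transpose Q = mat 1" using Q(1) by (simp add: orthogonal_matrix_def)
  have A: "A = Q ** H" by (simp add: H_def matrix_mul_assoc QQ)
  have H: "transpose H = H" using Q(2) by (simp add: H_def)
  have "mat 1 - A ** transpose A = Q ** (mat 1 - H ** H) ** transpose Q"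
    by (simp add: A matrix_transpose_mul H matrix_mul_assoc QQ matrix_sub_rdistrib matrix_sub_ldistrib)
  then have "norm (mat 1 - A ** transpose A) = norm (mat 1 - H ** H)"
    using Q(1) by (simp add: norm_orthogonal_mult_right norm_orthogonal_mult_left)
  also have "mat 1 - H ** H = X + X ** H"
    by (simp add: X_def matrix_sub_rdistrib)
  also have "(norm (X + X ** H))\<^sup>2 = (norm X)\<^sup>2 + 2 * (X \<bullet> (X ** H)) + (norm (X ** H))\<^sup>2"
    by (simp add: power2_norm_eq_inner inner_add_left inner_add_right inner_commute)
  moreover have "X \<bullet> (X ** H) \<ge> 0"
  proof -
    have "(X ** H) $ i = H *v (X $ i)" for i
    proof -
      have "H $ k $ j = H $ j $ k" for k j using H by (simp add: transpose_def vec_eq_iff)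
      then show ?thesis
        by (simp add: vec_eq_iff matrix_matrix_mult_def matrix_vector_mult_def mult.commute)
    qed
    then show ?thesis
      using Q(3) by (simp add: inner_vec_def[of X] H_def sum_nonneg)
  qed
  ultimately have "(norm X)\<^sup>2 \<le> (norm (mat 1 - A ** transpose A))\<^sup>2" by simp
  then have "norm X \<le> norm (mat 1 - A ** transpose A)" by (rule power2_le_imp_le) simp
  moreover have "norm (A - Q) = norm X"
  proof -
    have "Q - A = Q ** X" by (simp add: A X_def matrix_sub_ldistrib)
    then have "norm (Q - A) = norm X" using norm_orthogonal_mult_left[OF Q(1)] by simp
    then show ?thesis by (simp add: norm_minus_commute)
  qed
  ultimately show ?thesis using Q(1) by auto
qed

section \<open>Alignment loss under linear admissibility\<close>

lemma power2_norm_vec: "(norm x)\<^sup>2 = (\<Sum>i\<in>UNIV. (x $ i)\<^sup>2)" for x :: "real^'n"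
  unfolding power2_norm_eq_inner inner_vec_def by (simp add: power2_eq_square)

lemma L2_fun_component:
  fixes u :: "'a \<Rightarrow> real^'n"
  assumes "integrable P (\<lambda>z. (norm (u z))\<^sup>2)" "u \<in> borel_measurable P"
  shows "L2_fun P (\<lambda>z. u z $ i)"
  unfolding L2_fun_def
proof
  have "(\<lambda>x :: real^'n. x $ i) \<in> borel_measurable borel"
    by (intro borel_measurable_continuous_onI continuous_intros)
  from measurable_compose[OF assms(2) this]
  show [measurable]: "(\<lambda>z. u z $ i) \<in> borel_measurable P" .
  have *: "(u z $ i)\<^sup>2 \<le> (norm (u z))\<^sup>2" for z
    using component_le_norm_cart[of "u z" i] by (simp flip: abs_le_square_iff)
  show "integrable P (\<lambda>z. (u z $ i)\<^sup>2)"
  proof (rule Bochner_Integration.integrable_bound[OF assms(1)])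
    show "AE z in P. norm ((u z $ i)\<^sup>2) \<le> norm ((norm (u z))\<^sup>2)" using * by (intro AE_I2) simp
  qed measurable
qed

lemma L2_normsq_vec:
  fixes u :: "'a \<Rightarrow> real^'n"
  assumes "\<And>i. L2_fun P (\<lambda>z. u z $ i)"
  shows "L2_normsq P u = (\<Sum>i\<in>UNIV. L2_inner P (\<lambda>z. u z $ i) (\<lambda>z. u z $ i))"
  using L2_fun_integrable_mult[OF assms assms]
  unfolding L2_normsq_def power2_norm_vec L2_inner_def by (simp add: power2_eq_square)

text \<open>The square is expanded under \<open>k z\<close>; stationarity gives the terms at the
  initial and at the final point the same integral, leaving only the correlation.\<close>

lemma (in stationary_kernel) alignment_loss_eq:
  fixes g :: "'a \<Rightarrow> real^'n"
  assumes g: "\<And>i. L2_fun M (\<lambda>z. g z $ i)"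
  shows "alignment_loss M k g = 2 * L2_normsq M g
    - 2 * (\<Sum>i\<in>UNIV. L2_inner M (T (\<lambda>z. g z $ i)) (\<lambda>z. g z $ i))"
proof -
  let ?sq = "\<lambda>i z. (g z $ i)\<^sup>2"
  have sq: "integrable M (?sq i)" for i using g by (simp add: L2_fun_def)
  note Tg = T_L2(1)[OF g]
  have "AE z in M. \<forall>i. integrable (k z) (?sq i)"
    by (intro AE_all_countable[THEN iffD2] allI T_L2(3)[OF g])
  moreover have "AE z in M. \<forall>i. integrable (k z) (\<lambda>y. g y $ i)"
    by (intro AE_all_countable[THEN iffD2] allI T_integral(1) L2_fun_integrable g)
  ultimately have inner: "AE z in M. (\<integral>y. (norm (g y - g z))\<^sup>2 \<partial>k z)
      = (\<Sum>i\<in>UNIV. T (?sq i) z + ?sq i z - 2 * (T (\<lambda>y. g y $ i) z * g z $ i))"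
    using AE_space
  proof eventually_elim
    case (elim z)
    interpret kz: prob_space "k z" by (rule kernel_prob[OF elim(3)])
    have "(\<integral>y. (norm (g y - g z))\<^sup>2 \<partial>k z) = (\<integral>y. (\<Sum>i\<in>UNIV. ?sq i y + ?sq i z - 2 * (g y $ i * g z $ i)) \<partial>k z)"
      by (simp add: power2_norm_vec power2_diff mult.assoc)
    also have "\<dots> = (\<Sum>i\<in>UNIV. (\<integral>y. ?sq i y + ?sq i z - 2 * (g y $ i * g z $ i) \<partial>k z))"
      using elim by (intro Bochner_Integration.integral_sum) simp
    also have "\<dots> = (\<Sum>i\<in>UNIV. T (?sq i) z + ?sq i z - 2 * (T (\<lambda>y. g y $ i) z * g z $ i))"
      using elim by (intro sum.cong refl) (simp add: transition_operator_def kz.prob_space)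
    finally show ?case .
  qed
  have "alignment_loss M k g
      = (\<integral>z. (\<Sum>i\<in>UNIV. T (?sq i) z + ?sq i z - 2 * (T (\<lambda>y. g y $ i) z * g z $ i)) \<partial>M)"
    unfolding alignment_loss_def
  proof (rule integral_cong_AE[OF _ _ inner])
    have [measurable]: "(\<lambda>z. g z $ i) \<in> borel_measurable M" for i using g by (simp add: L2_fun_def)
    then have [measurable]: "g \<in> borel_measurable M"
      by (subst borel_measurable_euclidean_space) (auto simp: Basis_vec_def inner_axis)
    \<comment> \<open>Rewriting as a nonnegative integral makes available the measurability theorem
      for integrands and kernels that both depend on \<open>z\<close>.\<close>
    show "(\<lambda>z. \<integral>y. (norm (g y - g z))\<^sup>2 \<partial>k z) \<in> borel_measurable M"
    proof (subst measurable_cong)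
      fix z assume z: "z \<in> space M"
      then have "g \<in> borel_measurable (k z)" using kernel_sets[of z] \<open>g \<in> borel_measurable M\<close> by (simp cong: measurable_cong_sets)
      then show "(\<integral>y. (norm (g y - g z))\<^sup>2 \<partial>k z) = enn2real (\<integral>\<^sup>+y. ennreal ((norm (g y - g z))\<^sup>2) \<partial>k z)"
        by (intro integral_eq_nn_integral) auto
    next
      have "(\<lambda>z. \<integral>\<^sup>+y. ennreal ((norm (g y - g z))\<^sup>2) \<partial>k z) \<in> borel_measurable M"
        by (rule nn_integral_measurable_subprob_algebra2[OF _ kernel_subprob]) measurable
      then show "(\<lambda>z. enn2real (\<integral>\<^sup>+y. ennreal ((norm (g y - g z))\<^sup>2) \<partial>k z)) \<in> borel_measurable M"
        by measurable
    qed
    show "(\<lambda>z. \<Sum>i\<in>UNIV. T (?sq i) z + ?sq i z - 2 * (T (\<lambda>y. g y $ i) z * g z $ i)) \<in> borel_measurable M"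
      by measurable
  qed
  also have "\<dots> = (\<Sum>i\<in>UNIV. (\<integral>z. T (?sq i) z \<partial>M) + (\<integral>z. ?sq i z \<partial>M)
      - 2 * L2_inner M (T (\<lambda>y. g y $ i)) (\<lambda>z. g z $ i))"
    using T_integral(2)[OF sq] sq L2_fun_integrable_mult[OF Tg g]
    by (simp add: Bochner_Integration.integral_sum L2_inner_def)
  also have "\<dots> = (\<Sum>i\<in>UNIV. 2 * L2_inner M (\<lambda>z. g z $ i) (\<lambda>z. g z $ i)
      - 2 * L2_inner M (T (\<lambda>y. g y $ i)) (\<lambda>z. g z $ i))"
  proof -
    have "(\<integral>z. ?sq i z \<partial>M) = L2_inner M (\<lambda>z. g z $ i) (\<lambda>z. g z $ i)" for i
      by (simp add: L2_inner_def power2_eq_square)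
    then show ?thesis by (simp only: T_integral(3)[OF sq] mult_2)
  qed
  finally show ?thesis by (simp add: L2_normsq_vec[OF g] sum_subtractf sum_distrib_left)
qed

text \<open>This is all that the geometry contributes: the coordinates are isotropic eigenfunctions,
  the two intervals between successive eigenvalues lie in the resolvent set, and the eigenspaces at
  0 and \<open>l\<close> contain only constants and linear functions.\<close>

locale linear_spectral_gap = L2_semigroup P G K for P :: "(real^'d) measure" and G K +
  fixes c l lnl :: real
  assumes c: "c > 0" and l: "l > 0" and lnl: "l < lnl"
    and coordinate: "(\<lambda>z. z $ i, \<lambda>z. l * z $ i) \<in> G"
    and isotropic: "L2_inner P (\<lambda>z. z $ i) (\<lambda>z. z $ j) = (if i = j then c else 0)"
    and gap: "{0<..<l} \<subseteq> resolvent_set P G" "{l<..<lnl} \<subseteq> resolvent_set P G"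
    and kernel_0: "(f, \<lambda>z. 0) \<in> G \<Longrightarrow> \<exists>a. AE z in P. f z = a"
    and kernel_l: "(f, \<lambda>z. l * f z) \<in> G \<Longrightarrow> \<exists>a. AE z in P. f z = a \<bullet> z"
begin

text \<open>\<open>None\<close> indexes the constant function; division by the root of
  \<open>c\<close> normalizes, since each coordinate has second moment \<open>c\<close>.\<close>

primrec basis :: "'d option \<Rightarrow> real^'d \<Rightarrow> real" where
  "basis None = (\<lambda>z. 1)"
| "basis (Some i) = (\<lambda>z. z $ i / sqrt c)"

primrec basis_eigenvalue :: "'d option \<Rightarrow> real" where
  "basis_eigenvalue None = 0"
| "basis_eigenvalue (Some i) = l"

lemma coordinate_L2: "L2_fun P (\<lambda>z. z $ i)"
  by (rule graph_L2(1)[OF coordinate])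

lemma eigen_orthogonal_const:
  assumes "(f, \<lambda>z. \<mu> * f z) \<in> G" "\<mu> \<noteq> 0"
  shows "L2_inner P f (\<lambda>z. 1) = 0"
  using graph_symmetric[OF assms(1) const_graph[of 1]] assms(2)
  by (simp add: L2_inner_linear)

sublocale eigensystem: L2_eigensystem P G UNIV basis basis_eigenvalue
proof unfold_locales
  fix i j :: "'d option"
  show "(basis i, \<lambda>z. basis_eigenvalue i * basis i z) \<in> G"
  proof (cases i)
    case None
    then show ?thesis using const_graph[of 1] by simp
  next
    case (Some k)
    show ?thesis
      using graph_linear[OF const_graph[of 0] coordinate[of k], of "1 / sqrt c"] by (simp add: Some)
  qed
  have 1: "L2_inner P (\<lambda>z. z $ k) (\<lambda>z. 1) = 0" for k
    using eigen_orthogonal_const[OF coordinate] l by simp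
  show "L2_inner P (basis i) (basis j) = (if i = j then 1 else 0)"
    using c 1 L2_inner_commute[of P "\<lambda>z. 1"]
    by (cases i; cases j)
      (simp_all add: L2_inner_divide_left L2_inner_divide_right isotropic prob_space L2_inner_def[of P "\<lambda>z. 1" "\<lambda>z. 1"])
qed simp

lemma orth_iff:
  "eigensystem.orth f \<longleftrightarrow> L2_fun P f \<and> L2_inner P f (\<lambda>z. 1) = 0 \<and> (\<forall>i. L2_inner P f (\<lambda>z. z $ i) = 0)"
  using c by (simp add: eigensystem.orth_def split_option_all L2_inner_divide_right)

lemma orth_linear_functional:
  assumes "eigensystem.orth f"
  shows "L2_inner P f (\<lambda>z. a \<bullet> z) = 0"
proof -
  have "L2_inner P f (\<lambda>z. a \<bullet> z) = L2_inner P f (\<lambda>z. \<Sum>i\<in>UNIV. a $ i * z $ i)"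
    by (simp add: inner_vec_def)
  also have "\<dots> = (\<Sum>i\<in>UNIV. a $ i * L2_inner P f (\<lambda>z. z $ i))"
    using assms by (simp add: L2_inner_sum_right L2_inner_scale_right L2_fun_intros coordinate_L2 orth_iff)
  finally show ?thesis using assms by (simp add: orth_iff)
qed

text \<open>The bound climbs from 0 to \<open>l\<close> and then from \<open>l\<close> to
  \<open>lnl\<close>. Eigenfunctions at 0 and at \<open>l\<close> are constant or linear, so the
  complement contains only the zero one.\<close>

lemma orth_lower_bound:
  assumes "(f, g) \<in> G" "eigensystem.orth f"
  shows "lnl * L2_inner P f f \<le> L2_inner P g f"
proof -
  \<comment> \<open>A function orthogonal to its own representative \<open>k\<close> vanishes, as
    one factor in ||f||^2 may be replaced by \<open>k\<close>.\<close>
  have AE0: "AE z in P. f z = 0" if f: "eigensystem.orth f" and eq: "AE z in P. f z = k z" and k: "k \<in> borel_measurable P"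
    and fk: "L2_inner P f k = 0" for f k :: "real^'d \<Rightarrow> real"
  proof -
    have "L2_inner P f f = L2_inner P f k"
      using f eq k by (intro L2_inner_cong_AE) (auto simp: orth_iff L2_fun_def)
    then show ?thesis using fk L2_inner_self_eq_0_iff[of P f] f by (simp add: orth_iff)
  qed
  have lower_l: "l * L2_inner P f f \<le> L2_inner P g f" if "(f, g) \<in> G" "eigensystem.orth f" for f g
  proof (rule eigensystem.lower_bound_gap[OF l gap(1) _ _ that])
    show "0 * L2_inner P f f \<le> L2_inner P g f" if "(f, g) \<in> G" for f g
      using graph_nonneg[OF that] by simp
    show "AE z in P. f z = 0" if fG: "(f, \<lambda>z. 0 * f z) \<in> G" and f: "eigensystem.orth f" for f
    proof -
      obtain a where "AE z in P. f z = a" using kernel_0[of f] fG by auto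
      moreover have "L2_inner P f (\<lambda>z. a) = 0"
        using f L2_inner_scale_right[of P f a "\<lambda>z. 1"] by (simp add: orth_iff)
      ultimately show ?thesis by (intro AE0[OF f, of "\<lambda>z. a"]) auto
    qed
  qed
  show ?thesis
  proof (rule eigensystem.lower_bound_gap[OF lnl gap(2) lower_l _ assms])
    show "AE z in P. f z = 0" if fG: "(f, \<lambda>z. l * f z) \<in> G" and f: "eigensystem.orth f" for f
    proof -
      obtain a where a: "AE z in P. f z = a \<bullet> z" using kernel_l[OF fG] by auto
      have "L2_fun P (\<lambda>z. \<Sum>i\<in>UNIV. a $ i * z $ i)" by (intro L2_fun_intros coordinate_L2)
      then have "(\<lambda>z. a \<bullet> z) \<in> borel_measurable P" by (simp add: inner_vec_def L2_fun_def)
      then show ?thesis by (intro AE0[OF f a] orth_linear_functional f)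
    qed
  qed
qed

sublocale L2_semigroup_eigensystem P G K UNIV basis basis_eigenvalue lnl
  by unfold_locales (rule orth_lower_bound)

lemma linear_graph: "(\<lambda>z. a \<bullet> z, \<lambda>z. l * (a \<bullet> z)) \<in> G"
proof -
  have "(\<lambda>z. 0 + (\<Sum>i\<in>UNIV. a $ i * z $ i), \<lambda>z. 0 + (\<Sum>i\<in>UNIV. a $ i * (l * z $ i))) \<in> G"
    by (intro graph_sum const_graph coordinate finite)
  then show ?thesis by (simp add: inner_vec_def sum_distrib_left mult_ac)
qed

lemma linear_L2: "L2_fun P (\<lambda>z. a \<bullet> z)"
  by (rule graph_L2(1)[OF linear_graph])

lemma inner_linear: "L2_inner P (\<lambda>z. a \<bullet> z) (\<lambda>z. b \<bullet> z) = c * (a \<bullet> b)"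
proof -
  have "L2_inner P (\<lambda>z. a \<bullet> z) (\<lambda>z. b \<bullet> z)
      = L2_inner P (\<lambda>z. \<Sum>i\<in>UNIV. a $ i * z $ i) (\<lambda>z. \<Sum>j\<in>UNIV. b $ j * z $ j)"
    by (simp add: inner_vec_def)
  also have "\<dots> = (\<Sum>i\<in>UNIV. a $ i * (\<Sum>j\<in>UNIV. b $ j * (if i = j then c else 0)))"
    by (simp add: L2_inner_sum_left L2_inner_sum_right L2_inner_scale_left L2_inner_scale_right
        L2_fun_intros coordinate_L2 isotropic)
  also have "\<dots> = c * (a \<bullet> b)"
    by (simp add: if_distrib inner_vec_def sum_distrib_left mult_ac cong: if_cong)
  finally show ?thesis .
qed

section \<open>Decomposition of a map and of its loss\<close>

lemma decomposition_remainder: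
  assumes "spectral_decomposition P g A r"
  shows "L2_fun P (\<lambda>z. g z $ i)" "eigensystem.orth (\<lambda>z. r z $ i)"
    "z \<in> space P \<Longrightarrow> g z $ i = A $ i \<bullet> z + r z $ i"
proof -
  have [measurable]: "g \<in> borel_measurable P" and int: "integrable P (\<lambda>z. (norm (g z))\<^sup>2)"
    and eq: "\<And>z. z \<in> space P \<Longrightarrow> g z = A *v z + r z"
    using assms by (auto simp: spectral_decomposition_def)
  have g_i: "L2_fun P (\<lambda>z. g z $ i)" for i
    by (rule L2_fun_component) (rule int, measurable)
  show "L2_fun P (\<lambda>z. g z $ i)" by (rule g_i)
  have eq_i: "g z $ i = A $ i \<bullet> z + r z $ i" if "z \<in> space P" for z i
    using eq[OF that] by (simp add: matrix_vector_mult_def inner_vec_def)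
  show "z \<in> space P \<Longrightarrow> g z $ i = A $ i \<bullet> z + r z $ i" by (rule eq_i)
  \<comment> \<open>Square integrability of \<open>r\<close> is inherited from g - A z, with which
    it agrees on \<open>space P\<close>.\<close>
  have "L2_fun P (\<lambda>z. g z $ i - A $ i \<bullet> z)" by (intro L2_fun_diff g_i linear_L2)
  moreover have "g z $ i - A $ i \<bullet> z = r z $ i" if "z \<in> space P" for z using eq_i[OF that] by simp
  ultimately have "L2_fun P (\<lambda>z. r z $ i)"
    unfolding L2_fun_def by (auto cong: measurable_cong Bochner_Integration.integrable_cong)
  then show "eigensystem.orth (\<lambda>z. r z $ i)"
    using assms by (simp add: orth_iff spectral_decomposition_def)
qed

lemma decomposition_inner:
  assumes "spectral_decomposition P g A r"
  shows "L2_inner P (\<lambda>z. g z $ i) (\<lambda>z. g z $ j)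
    = c * (A $ i \<bullet> A $ j) + L2_inner P (\<lambda>z. r z $ i) (\<lambda>z. r z $ j)"
proof -
  note dec = decomposition_remainder[OF assms]
  note r = dec(2)[THEN eigensystem.orth_L2]
  have "L2_inner P (\<lambda>z. g z $ i) (\<lambda>z. g z $ j)
      = L2_inner P (\<lambda>z. A $ i \<bullet> z + r z $ i) (\<lambda>z. A $ j \<bullet> z + r z $ j)"
    unfolding L2_inner_def by (intro Bochner_Integration.integral_cong refl) (simp add: dec(3))
  also have "\<dots> = c * (A $ i \<bullet> A $ j) + L2_inner P (\<lambda>z. r z $ i) (\<lambda>z. r z $ j)"
    by (simp add: L2_inner_linear L2_fun_intros linear_L2 r inner_linear orth_linear_functional dec(2)
        L2_inner_commute[of P "\<lambda>z. A $ i \<bullet> z" "\<lambda>z. r z $ j"])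
  finally show ?thesis .
qed

text \<open>The linear part is scaled by exactly exp(-l t), and the evolved remainder stays
  orthogonal to linear functions, so cross terms vanish. The correlation of the remainder is left
  unevaluated because the inequality and its equality case treat it differently.\<close>

lemma alignment_loss_decomposition:
  assumes dec: "spectral_decomposition P g A r" and t: "t > 0"
  shows "alignment_loss P (K t) g = 2 * (1 - exp (- l * t)) * L2_normsq P g
    + 2 * exp (- l * t) * L2_normsq P r - 2 * (\<Sum>i\<in>UNIV. L2_inner P (T t (\<lambda>z. r z $ i)) (\<lambda>z. r z $ i))"
proof -
  interpret t: stationary_kernel P "K t" by (rule stationary_kernel) (use t in simp)
  note rem = decomposition_remainder[OF dec]
  note r = rem(2)[THEN eigensystem.orth_L2]
  have "L2_inner P (T t (\<lambda>z. g z $ i)) (\<lambda>z. g z $ i)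
      = exp (- l * t) * (L2_inner P (\<lambda>z. g z $ i) (\<lambda>z. g z $ i) - L2_inner P (\<lambda>z. r z $ i) (\<lambda>z. r z $ i))
        + L2_inner P (T t (\<lambda>z. r z $ i)) (\<lambda>z. r z $ i)" for i
  proof -
    let ?a = "\<lambda>z. A $ i \<bullet> z" and ?r = "\<lambda>z. r z $ i"
    have "AE z in P. g z $ i = ?a z + 1 * ?r z" by (intro AE_I2) (simp add: rem(3))
    then have "AE z in P. T t (\<lambda>z. g z $ i) z = T t (\<lambda>z. ?a z + 1 * ?r z) z"
      using rem(1) L2_fun_add[OF linear_L2 r] by (intro t.T_cong_AE) (auto simp: L2_fun_def)
    moreover note t.T_linear[OF linear_L2[of "A $ i"] r[of i], of 1]
    moreover note T_eigenfunction[OF linear_graph[of "A $ i"] less_imp_le[OF t]]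
    ultimately have T_g: "AE z in P. T t (\<lambda>z. g z $ i) z = exp (- l * t) * ?a z + T t ?r z"
      by eventually_elim simp
    have g: "AE z in P. g z $ i = ?a z + ?r z" by (intro AE_I2) (simp add: rem(3))
    note L2 = linear_L2[of "A $ i"] r[of i] rem(1)[of i] t.T_L2(1)[OF r[of i]] t.T_L2(1)[OF rem(1)[of i]]
    have meas [measurable]: "?a \<in> borel_measurable P" "?r \<in> borel_measurable P" "(\<lambda>z. g z $ i) \<in> borel_measurable P"
      "T t ?r \<in> borel_measurable P" "T t (\<lambda>z. g z $ i) \<in> borel_measurable P"
      using L2 by (simp_all add: L2_fun_def)
    have "L2_inner P (T t (\<lambda>z. g z $ i)) (\<lambda>z. g z $ i)
        = L2_inner P (\<lambda>z. exp (- l * t) * ?a z + T t ?r z) (\<lambda>z. ?a z + ?r z)"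
      by (intro L2_inner_cong_AE T_g g meas) simp_all
    also have "\<dots> = exp (- l * t) * L2_inner P ?a ?a + L2_inner P (T t ?r) ?r"
      using orth_linear_functional[OF rem(2)[of i], of "A $ i"]
        orth_linear_functional[OF T_orth(1)[OF rem(2)[of i] t], of "A $ i"] L2
      by (simp add: L2_inner_linear L2_fun_intros L2_inner_commute[of P ?a ?r])
    also have "L2_inner P ?a ?a = L2_inner P (\<lambda>z. g z $ i) (\<lambda>z. g z $ i) - L2_inner P ?r ?r"
      by (simp add: decomposition_inner[OF dec] inner_linear)
    finally show ?thesis .
  qed
  then have "(\<Sum>i\<in>UNIV. L2_inner P (T t (\<lambda>z. g z $ i)) (\<lambda>z. g z $ i))
      = exp (- l * t) * (L2_normsq P g - L2_normsq P r) + (\<Sum>i\<in>UNIV. L2_inner P (T t (\<lambda>z. r z $ i)) (\<lambda>z. r z $ i))"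
    by (simp add: L2_normsq_vec[OF rem(1)] L2_normsq_vec[OF r] sum.distrib sum_subtractf
        flip: sum_distrib_left)
  then show ?thesis
    by (simp add: t.alignment_loss_eq[OF rem(1)] algebra_simps)
qed

text \<open>Cauchy-Schwarz and the decay on the complement bound the correlation of each remainder
  component by exp(-lnl t) times its squared norm.\<close>

theorem alignment_loss_ge:
  assumes dec: "spectral_decomposition P g A r" and t: "t > 0"
  shows "alignment_loss P (K t) g \<ge> 2 * (1 - exp (- l * t)) * L2_normsq P g
    + 2 * (exp (- l * t) - exp (- lnl * t)) * L2_normsq P r"
proof -
  note rem = decomposition_remainder(2)[OF dec]
  have "L2_inner P (T t (\<lambda>z. r z $ i)) (\<lambda>z. r z $ i) \<le> exp (- lnl * t) * L2_inner P (\<lambda>z. r z $ i) (\<lambda>z. r z $ i)" for i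
  proof (rule power2_le_imp_le)
    let ?r = "\<lambda>z. r z $ i"
    have "(L2_inner P (T t ?r) ?r)\<^sup>2 \<le> L2_inner P (T t ?r) (T t ?r) * L2_inner P ?r ?r"
      using t by (intro L2_Cauchy_Schwarz T_L2 eigensystem.orth_L2[OF rem]) simp
    also have "\<dots> \<le> (exp (- lnl * t))\<^sup>2 * L2_inner P ?r ?r * L2_inner P ?r ?r"
      by (intro mult_right_mono T_orth(2) rem t L2_inner_self_nonneg)
    finally show "(L2_inner P (T t ?r) ?r)\<^sup>2 \<le> (exp (- lnl * t) * L2_inner P ?r ?r)\<^sup>2"
      by (simp add: power2_eq_square mult_ac)
  qed (simp add: L2_inner_self_nonneg)
  then have "(\<Sum>i\<in>UNIV. L2_inner P (T t (\<lambda>z. r z $ i)) (\<lambda>z. r z $ i)) \<le> exp (- lnl * t) * L2_normsq P r"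
    by (simp add: L2_normsq_vec[OF eigensystem.orth_L2[OF rem]] sum_distrib_left sum_mono)
  then show ?thesis by (simp add: alignment_loss_decomposition[OF dec t] algebra_simps)
qed

theorem alignment_loss_eq:
  assumes dec: "spectral_decomposition P g A r" and t: "t > 0"
    and r: "\<And>i. (\<lambda>z. r z $ i, \<lambda>z. lnl * r z $ i) \<in> G"
  shows "alignment_loss P (K t) g = 2 * (1 - exp (- l * t)) * L2_normsq P g
    + 2 * (exp (- l * t) - exp (- lnl * t)) * L2_normsq P r"
proof -
  note r_L2 = graph_L2(1)[OF r]
  have "L2_inner P (T t (\<lambda>z. r z $ i)) (\<lambda>z. r z $ i) = exp (- lnl * t) * L2_inner P (\<lambda>z. r z $ i) (\<lambda>z. r z $ i)" for i
  proof -
    have "L2_inner P (T t (\<lambda>z. r z $ i)) (\<lambda>z. r z $ i)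
        = L2_inner P (\<lambda>z. exp (- lnl * t) * r z $ i) (\<lambda>z. r z $ i)"
      using T_eigenfunction[OF r[of i]] T_measurable[OF _ r_L2] t r_L2 L2_fun_scale[OF r_L2]
      by (intro L2_inner_cong_AE) (auto simp: L2_fun_def)
    then show ?thesis by (simp add: L2_inner_scale_left)
  qed
  then have "(\<Sum>i\<in>UNIV. L2_inner P (T t (\<lambda>z. r z $ i)) (\<lambda>z. r z $ i)) = exp (- lnl * t) * L2_normsq P r"
    by (simp add: L2_normsq_vec[OF r_L2] sum_distrib_left)
  then show ?thesis by (simp add: alignment_loss_decomposition[OF dec t] algebra_simps)
qed

text \<open>The entries of \<open>A\<close> are the Fourier coefficients along the coordinates;
  orthogonality of the remainder to constants comes from the zero mean of \<open>g\<close>.\<close>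

lemma spectral_decomposition_exists:
  fixes g :: "real^'d \<Rightarrow> real^'d"
  assumes g: "g \<in> borel_measurable P" "integrable P (\<lambda>z. (norm (g z))\<^sup>2)"
    and L2: "\<And>i. L2_fun P (\<lambda>z. g z $ i)" and mean: "\<And>i. (\<integral>z. g z $ i \<partial>P) = 0"
  shows "\<exists>A r. spectral_decomposition P g A r"
proof -
  define A :: "real^'d^'d" where "A = (\<chi> i j. L2_inner P (\<lambda>z. g z $ i) (\<lambda>z. z $ j) / c)"
  define r where "r z = g z - A *v z" for z
  have r_i: "(\<lambda>z. r z $ i) = (\<lambda>z. g z $ i - A $ i \<bullet> z)" for i
    by (simp add: r_def matrix_vector_mult_def inner_vec_def)
  have "L2_inner P (\<lambda>z. A $ i \<bullet> z) (\<lambda>z. 1) = 0" for i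
    using eigen_orthogonal_const[OF linear_graph] l by simp
  moreover have "L2_inner P (\<lambda>z. g z $ i) (\<lambda>z. 1) = 0" for i
    using mean by (simp add: L2_inner_def)
  ultimately have "L2_inner P (\<lambda>z. r z $ i) (\<lambda>z. 1) = 0" for i
    by (simp add: r_i L2_inner_diff_left L2 linear_L2 L2_fun_const)
  moreover have "L2_inner P (\<lambda>z. r z $ i) (\<lambda>z. z $ j) = 0" for i j
  proof -
    have "L2_inner P (\<lambda>z. A $ i \<bullet> z) (\<lambda>z. z $ j) = c * A $ i $ j"
      using inner_linear[of "A $ i" "axis j 1"] by (simp add: inner_axis inner_axis')
    then show ?thesis
      using c by (simp add: r_i L2_inner_diff_left L2 linear_L2 coordinate_L2) (simp add: A_def)
  qed
  ultimately have "spectral_decomposition P g A r"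
    using g by (simp add: spectral_decomposition_def r_def)
  then show ?thesis by blast
qed

text \<open>Isotropy of \<open>g\<close> gives I - A A^T = Cov r / c. By Pythagoras the error of
  \<open>Q\<close> is c ||A - Q||^2 + ||r||^2, and for the polar factor ||A - Q|| is at most ||r||^2
  / c.\<close>

theorem orthogonal_approximation:
  assumes dec: "spectral_decomposition P g A r"
    and cov: "\<And>i j. L2_inner P (\<lambda>z. g z $ i) (\<lambda>z. g z $ j) = (if i = j then c else 0)"
  shows "\<exists>Q. orthogonal_matrix Q \<and> L2_normsq P (\<lambda>z. g z - Q *v z) \<le> L2_normsq P r + (L2_normsq P r)\<^sup>2 / c"
proof -
  note rem = decomposition_remainder[OF dec]
  note r = rem(2)[THEN eigensystem.orth_L2]
  let ?N = "L2_normsq P r"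
  let ?S = "mat 1 - A ** transpose A"
  have N: "?N = (\<Sum>i\<in>UNIV. L2_inner P (\<lambda>z. r z $ i) (\<lambda>z. r z $ i))"
    by (rule L2_normsq_vec[OF r])
  have N0: "?N \<ge> 0" by (simp add: N sum_nonneg L2_inner_self_nonneg)
  have S: "?S $ i $ j = L2_inner P (\<lambda>z. r z $ i) (\<lambda>z. r z $ j) / c" for i j
  proof -
    have "(A ** transpose A) $ i $ j = A $ i \<bullet> A $ j"
      by (simp add: matrix_matrix_mult_def transpose_def inner_vec_def)
    then show ?thesis
      using decomposition_inner[OF dec, of i j] cov[of i j] c
      by (cases "i = j") (simp_all add: mat_def field_simps)
  qed
  have "(norm ?S)\<^sup>2 = (\<Sum>i\<in>UNIV. \<Sum>j\<in>UNIV. (?S $ i $ j)\<^sup>2)"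
    unfolding power2_norm_eq_inner matrix_inner_sum by (simp only: power2_eq_square)
  \<comment> \<open>Each squared covariance is at most the product of the two variances, and the
    double sum of these products factors into the squared trace.\<close>
  also have "\<dots> \<le> (\<Sum>i\<in>UNIV. \<Sum>j\<in>UNIV. L2_inner P (\<lambda>z. r z $ i) (\<lambda>z. r z $ i) / c * (L2_inner P (\<lambda>z. r z $ j) (\<lambda>z. r z $ j) / c))"
    unfolding S using L2_Cauchy_Schwarz[OF r r] c
    by (intro sum_mono) (simp add: power_divide power2_eq_square divide_right_mono)
  also have "\<dots> = (?N / c)\<^sup>2"
    by (simp add: N power2_eq_square sum_product sum_divide_distrib)
  finally have S_le: "norm ?S \<le> ?N / c"
    by (rule power2_le_imp_le) (use c N0 in simp)
  obtain Q where Q: "orthogonal_matrix Q" "norm (A - Q) \<le> norm ?S"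
    using nearest_orthogonal_matrix[of A] by blast
  let ?D = "A - Q"
  have gQ: "(g z - Q *v z) $ i = ?D $ i \<bullet> z + r z $ i" if "z \<in> space P" for z i
    using rem(3)[OF that, of i] by (simp add: matrix_vector_mult_def inner_vec_def left_diff_distrib sum_subtractf)
  have "L2_normsq P (\<lambda>z. g z - Q *v z) = L2_normsq P (\<lambda>z. \<chi> i. ?D $ i \<bullet> z + r z $ i)"
    unfolding L2_normsq_def
  proof (intro Bochner_Integration.integral_cong refl)
    fix z assume "z \<in> space P"
    then have "g z - Q *v z = (\<chi> i. ?D $ i \<bullet> z + r z $ i)" using gQ by (simp add: vec_eq_iff)
    then show "(norm (g z - Q *v z))\<^sup>2 = (norm (\<chi> i. ?D $ i \<bullet> z + r z $ i))\<^sup>2" by simp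
  qed
  also have "\<dots> = (\<Sum>i\<in>UNIV. L2_inner P (\<lambda>z. ?D $ i \<bullet> z + r z $ i) (\<lambda>z. ?D $ i \<bullet> z + r z $ i))"
    by (subst L2_normsq_vec) (auto intro!: L2_fun_add linear_L2 r simp del: vector_minus_component)
  also have "\<dots> = (\<Sum>i\<in>UNIV. c * (?D $ i \<bullet> ?D $ i) + L2_inner P (\<lambda>z. r z $ i) (\<lambda>z. r z $ i))"
  proof (intro sum.cong refl)
    fix i
    show "L2_inner P (\<lambda>z. ?D $ i \<bullet> z + r z $ i) (\<lambda>z. ?D $ i \<bullet> z + r z $ i)
        = c * (?D $ i \<bullet> ?D $ i) + L2_inner P (\<lambda>z. r z $ i) (\<lambda>z. r z $ i)"
      using orth_linear_functional[OF rem(2)[of i], of "?D $ i"]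
      by (simp add: L2_inner_add_left L2_inner_add_right linear_L2 r L2_fun_add inner_linear
          L2_inner_commute[of P "\<lambda>z. ?D $ i \<bullet> z" "\<lambda>z. r z $ i"] del: vector_minus_component)
  qed
  also have "\<dots> = c * (norm ?D)\<^sup>2 + ?N"
    by (simp add: N sum.distrib power2_norm_eq_inner inner_vec_def[of ?D] sum_distrib_left del: vector_minus_component)
  also have "\<dots> \<le> c * (?N / c)\<^sup>2 + ?N"
    using Q(2) S_le c by (intro add_right_mono mult_left_mono power_mono) auto
  also have "\<dots> = ?N + ?N\<^sup>2 / c" using c by (simp add: power2_eq_square)
  finally show ?thesis using Q(1) by blast
qed

end

text \<open>The kernels live on the Borel space of the manifold, the L2 theory on \<open>P\<close>;
  only the sigma-algebra matters, and it is the same.\<close>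

lemma markov_semigroup_cong:
  assumes "sets S = sets P" "markov_semigroup S K"
  shows "markov_semigroup P K"
proof -
  have "prob_algebra S = prob_algebra P"
    by (simp add: prob_algebra_def subprob_algebra_cong[OF assms(1)])
  then have "S \<rightarrow>\<^sub>M prob_algebra S = P \<rightarrow>\<^sub>M prob_algebra P"
    by (intro measurable_cong_sets assms(1)) simp
  moreover have "return S = return P" using return_cong[OF assms(1)] by blast
  ultimately show ?thesis
    using assms(2) sets_eq_imp_space_eq[OF assms(1)] by (simp add: markov_semigroup_def)
qed

section \<open>Linearly admissible manifolds\<close>

theorem theorem4p4:
  fixes M :: "(real^'d) set"
    and p :: "real^'d \<Rightarrow> real"
    and vol P :: "(real^'d) measure"
    and K :: "real \<Rightarrow> real^'d \<Rightarrow> (real^'d) measure"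
    and h :: "real^'d \<Rightarrow> real^'d"
    and c t l lnl rho rhonl eps :: real
  assumes manifold: "properly_embedded_submanifold TYPE('m::finite) M" "connected M"
    and volume: "riemannian_volume TYPE('m) M vol"
    and density: "smooth_function M p" "\<forall>z\<in>M. p z > 0"
      "P = density vol (\<lambda>z. ennreal (p z))" "prob_space P"
    and moments: "c > 0" "centered_isotropic P c"
    and spectral: "self_adjoint P (neg_weighted_operator M p P)"
      "discrete_spectrum P (neg_weighted_operator M p P)"
    and kernels: "langevin_transition_kernels M p P K" "stationary P K"
    and time: "t > 0"
    and admissible: "l > 0" "linearly_admissible M p P l"
    and gap: "next_eigenvalue P (neg_weighted_operator M p P) l lnl"
    and rho: "rho = exp (- l * t)" "rhonl = exp (- lnl * t)"
    and h: "h \<in> borel_on M \<rightarrow>\<^sub>M borel_on M" "distr P (borel_on M) h = P"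
    and loss: "alignment_loss P (K t) h \<le> 2 * real CARD('d) * c * (1 - rho) + eps"
  shows
    "(\<exists>A :: real^'d^'d. L2_normsq P (\<lambda>z. h z - A *v z) \<le> eps / (2 * (rho - rhonl))) \<and>
     (\<exists>Q :: real^'d^'d. orthogonal_matrix Q \<and>
        (let eta = eps / (2 * (rho - rhonl)) in
          L2_normsq P (\<lambda>z. h z - Q *v z) \<le> eta + eta\<^sup>2 / c)) \<and>
     \<comment> \<open>the underlying spectral inequality, which uses only \<open>\<parallel>g\<parallel>\<^sup>2 = d c\<close> and the decomposition,\<close>
     (\<forall>g A r. spectral_decomposition P g A r \<and> L2_normsq P g = real CARD('d) * c \<longrightarrow>
        alignment_loss P (K t) g
          \<ge> 2 * real CARD('d) * c * (1 - rho) + 2 * (rho - rhonl) * L2_normsq P r) \<and>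
     \<comment> \<open>is an equality if the remainder lies in the next eigenspace,\<close>
     (\<forall>g A r. spectral_decomposition P g A r \<and> L2_normsq P g = real CARD('d) * c \<and>
        (\<forall>i. (\<lambda>z. r z $ i) \<in> eigenspace P (neg_weighted_operator M p P) lnl) \<longrightarrow>
        alignment_loss P (K t) g
          = 2 * real CARD('d) * c * (1 - rho) + 2 * (rho - rhonl) * L2_normsq P r) \<and>
     \<comment> \<open>so that no smaller constant than \<open>1 / (2 (rho - rhonl))\<close> is possible at this level\<close>
     (\<forall>C. (\<forall>g A r e. spectral_decomposition P g A r \<and> L2_normsq P g = real CARD('d) * c \<and>
             alignment_loss P (K t) g \<le> 2 * real CARD('d) * c * (1 - rho) + e \<longrightarrow>
             L2_normsq P r \<le> C * e) \<longrightarrow>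
          1 / (2 * (rho - rhonl)) \<le> C)"
proof -
  let ?G = "neg_weighted_operator M p P"
  interpret prob_space P by (rule density)
  have sets_P: "sets (borel_on M) = sets P"
    using volume by (simp add: density(3) riemannian_volume_def)
  interpret L2_semigroup P ?G K
    using spectral(1) markov_semigroup_cong[OF sets_P] kernels
    by unfold_locales (auto simp: langevin_transition_kernels_def)
  have coordinate: "(\<lambda>z. z $ i, \<lambda>z. l * z $ i) \<in> ?G" for i
    using admissible(2) by (simp add: linearly_admissible_def eigenspace_def)
  have first: "\<exists>a. AE z in P. f z = a" if "(f, \<lambda>z. \<mu> * f z) \<in> ?G" "\<mu> < l" for f \<mu>
    using that graph_L2(1)[OF that(1)] admissible(2)
    by (auto simp: linearly_admissible_def first_nonconstant_eigenvalue_def eigenspace_def ae_constant_def)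
  \<comment> \<open>Discreteness makes every spectral value an eigenvalue, so the absence of an
    eigenvalue yields a resolvent point.\<close>
  have resolventI: "\<mu> \<in> resolvent_set P ?G" if "\<not> eigenvalue P ?G \<mu>" for \<mu>
    using that spectral(2) by (auto simp: discrete_spectrum_def spectrum_def)
  have orth_const: "L2_inner P f (\<lambda>z. 1) = 0" if "(f, \<lambda>z. \<mu> * f z) \<in> ?G" "\<mu> \<noteq> 0" for f \<mu>
    using graph_symmetric[OF that(1) const_graph[of 1]] that(2) by (simp add: L2_inner_linear)
  have nonlinear: "eigenvalue P ?G lnl" using gap by (simp add: next_eigenvalue_def)
  interpret linear_spectral_gap P ?G K c l lnl
  proof unfold_locales
    show "c > 0" "l > 0" "l < lnl" using moments admissible gap by (auto simp: next_eigenvalue_def)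
    show "(\<lambda>z. z $ i, \<lambda>z. l * z $ i) \<in> ?G" for i by (rule coordinate)
    show "L2_inner P (\<lambda>z. z $ i) (\<lambda>z. z $ j) = (if i = j then c else 0)" for i j
    proof -
      \<comment> \<open>Obtained componentwise from orthogonality of eigenfunctions, to match the
        scalar integrals in \<open>covariance_matrix\<close>.\<close>
      have "(\<integral>x. x $ k \<partial>P) = 0" for k
        using orth_const[OF coordinate, of k] admissible(1) by (simp add: L2_inner_def)
      moreover have "covariance_matrix P $ i $ j = mat c $ i $ j"
        using moments(2) by (simp add: centered_isotropic_def)
      ultimately show ?thesis by (simp add: covariance_matrix_def L2_inner_def mat_def)
    qed
    show "{0<..<l} \<subseteq> resolvent_set P ?G"
    proof
      fix \<mu> assume \<mu>: "\<mu> \<in> {0<..<l}"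
      \<comment> \<open>An eigenfunction strictly between 0 and \<open>l\<close> would be almost
        everywhere constant and orthogonal to constants, hence zero.\<close>
      have "\<not> eigenvalue P ?G \<mu>"
      proof
        assume "eigenvalue P ?G \<mu>"
        then obtain f where f: "(f, \<lambda>z. \<mu> * f z) \<in> ?G" "\<not> (AE z in P. f z = 0)"
          by (auto simp: eigenvalue_def eigenspace_def)
        obtain a where a: "AE z in P. f z = a" using first[OF f(1)] \<mu> by auto
        have "L2_inner P f (\<lambda>z. 1) = L2_inner P (\<lambda>z. a) (\<lambda>z. 1)"
          using a graph_L2[OF f(1)] by (intro L2_inner_cong_AE) (auto simp: L2_fun_def)
        then have "a = 0" using orth_const[OF f(1)] \<mu> by (simp add: L2_inner_def prob_space)
        then show False using a f(2) by simp
      qed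
      then show "\<mu> \<in> resolvent_set P ?G" by (rule resolventI)
    qed
    show "{l<..<lnl} \<subseteq> resolvent_set P ?G"
      using gap by (auto intro!: resolventI simp: next_eigenvalue_def)
    show "\<exists>a. AE z in P. f z = a" if "(f, \<lambda>z. 0) \<in> ?G" for f
      using first[of f 0] that admissible(1) by simp
    show "\<exists>a. AE z in P. f z = a \<bullet> z" if "(f, \<lambda>z. l * f z) \<in> ?G" for f
      using that graph_L2(1)[OF that] admissible(2) by (auto simp: linearly_admissible_def eigenspace_def)
  qed
  have gap_pos: "rho - rhonl > 0" using lnl time by (simp add: rho)
  let ?D = "real CARD('d) * c"
  define eta where "eta = eps / (2 * (rho - rhonl))"
  have ge: "alignment_loss P (K t) g
      \<ge> 2 * real CARD('d) * c * (1 - rho) + 2 * (rho - rhonl) * L2_normsq P r"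
    if "spectral_decomposition P g A r" "L2_normsq P g = ?D" for g A r
    using alignment_loss_ge[OF that(1) time] that(2) by (simp add: rho mult_ac)
  have eq: "alignment_loss P (K t) g
      = 2 * real CARD('d) * c * (1 - rho) + 2 * (rho - rhonl) * L2_normsq P r"
    if "spectral_decomposition P g A r" "L2_normsq P g = ?D"
      "\<And>i. (\<lambda>z. r z $ i) \<in> eigenspace P ?G lnl" for g A r
    using alignment_loss_eq[OF that(1) time] that(2,3) by (simp add: rho mult_ac eigenspace_def)
  have h_P: "h \<in> P \<rightarrow>\<^sub>M borel_on M" using h(1) measurable_cong_sets[OF sets_P refl] by blast
  \<comment> \<open>Preservation of the law in integral form; it transfers the moments of the
    coordinates to the components of \<open>h\<close>.\<close>
  have h_transport: "(\<integral>z. F (h z) \<partial>P) = (\<integral>z. F z \<partial>P)" "integrable P F \<Longrightarrow> integrable P (\<lambda>z. F (h z))"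
    if "F \<in> borel_measurable P" for F :: "real^'d \<Rightarrow> real"
  proof -
    have F: "F \<in> borel_measurable (borel_on M)" using that measurable_cong_sets[OF sets_P refl] by blast
    show "(\<integral>z. F (h z) \<partial>P) = (\<integral>z. F z \<partial>P)" using integral_distr[OF h_P F] by (simp add: h(2))
    show "integrable P F \<Longrightarrow> integrable P (\<lambda>z. F (h z))" using integrable_distr_eq[OF h_P F] by (simp add: h(2))
  qed
  have coord_meas [measurable]: "(\<lambda>z. z $ i) \<in> borel_measurable P" for i
    using coordinate_L2 by (simp add: L2_fun_def)
  have h_meas: "h \<in> borel_measurable P" using h_P by (simp add: measurable_restrict_space2_iff)
  have h_int: "integrable P (\<lambda>z. (norm (h z))\<^sup>2)"
  proof -
    have "integrable P (\<lambda>z. (norm z)\<^sup>2)" using moments(2) by (simp add: centered_isotropic_def)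
    then show ?thesis by (intro h_transport(2)[of "\<lambda>z. (norm z)\<^sup>2"] borel_measurable_integrable)
  qed
  have h_L2: "L2_fun P (\<lambda>z. h z $ i)" for i by (rule L2_fun_component[OF h_int h_meas])
  have h_mean: "(\<integral>z. h z $ i \<partial>P) = 0" for i
    using h_transport(1)[OF coord_meas, of i] orth_const[OF coordinate, of i] admissible(1)
    by (simp add: L2_inner_def)
  have h_cov: "L2_inner P (\<lambda>z. h z $ i) (\<lambda>z. h z $ j) = (if i = j then c else 0)" for i j
    using h_transport(1)[of "\<lambda>z. z $ i * z $ j"] isotropic[of i j] by (simp add: L2_inner_def)
  have h_norm: "L2_normsq P h = ?D" by (simp add: L2_normsq_vec[OF h_L2] h_cov)
  obtain A r where dec: "spectral_decomposition P h A r"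
    using spectral_decomposition_exists[OF h_meas h_int h_L2 h_mean] by blast
  have r_le: "L2_normsq P r \<le> eta"
    using ge[OF dec h_norm] loss gap_pos by (simp add: eta_def pos_le_divide_eq mult.commute)
  have r0: "L2_normsq P r \<ge> 0" by (simp add: L2_normsq_def)
  have "L2_normsq P (\<lambda>z. h z - A *v z) = L2_normsq P r"
    unfolding L2_normsq_def using dec
    by (intro Bochner_Integration.integral_cong refl) (simp add: spectral_decomposition_def)
  then have part1: "L2_normsq P (\<lambda>z. h z - A *v z) \<le> eta" using r_le by simp
  obtain Q where Q: "orthogonal_matrix Q"
    "L2_normsq P (\<lambda>z. h z - Q *v z) \<le> L2_normsq P r + (L2_normsq P r)\<^sup>2 / c"
    using orthogonal_approximation[OF dec h_cov] by blast
  \<comment> \<open>x + x^2 / c is increasing for nonnegative x.\<close>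
  have "L2_normsq P r + (L2_normsq P r)\<^sup>2 / c \<le> eta + eta\<^sup>2 / c"
    using r_le r0 c by (intro add_mono divide_right_mono power_mono) auto
  then have part2: "L2_normsq P (\<lambda>z. h z - Q *v z) \<le> eta + eta\<^sup>2 / c" using Q(2) by simp
  have optimal: "1 / (2 * (rho - rhonl)) \<le> C"
    if C: "\<And>g A r e. spectral_decomposition P g A r \<Longrightarrow> L2_normsq P g = ?D \<Longrightarrow>
       alignment_loss P (K t) g \<le> 2 * real CARD('d) * c * (1 - rho) + e \<Longrightarrow> L2_normsq P r \<le> C * e" for C
  proof -
    \<comment> \<open>The extremal map is a pure remainder, with A = 0: an eigenfunction at
      \<open>lnl\<close> placed in a single component. It only has to satisfy the norm condition and
      need not take values in the manifold.\<close>
    obtain f where f: "(f, \<lambda>z. lnl * f z) \<in> ?G" "\<not> (AE z in P. f z = 0)"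
      using nonlinear by (auto simp: eigenvalue_def eigenspace_def)
    note f_L2 = graph_L2(1)[OF f(1)]
    have ff: "L2_inner P f f > 0"
      using L2_inner_self_eq_0_iff[OF f_L2] f(2) L2_inner_self_nonneg[of P f] by simp
    have f_const: "L2_inner P f (\<lambda>z. 1) = 0" using orth_const[OF f(1)] l lnl by simp
    have f_coord: "L2_inner P f (\<lambda>z. z $ i) = 0" for i
      using graph_symmetric[OF f(1) coordinate, of i] lnl by (simp add: L2_inner_linear)
    \<comment> \<open>The scale gives the extremal map the squared norm d c.\<close>
    define s where "s = sqrt (?D / L2_inner P f f)"
    have s: "s\<^sup>2 * L2_inner P f f = ?D" using ff c by (simp add: s_def)
    fix k :: 'd
    define r :: "real^'d \<Rightarrow> real^'d" where "r z = (s * f z) *\<^sub>R axis k 1" for z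
    have r_i: "(\<lambda>z. r z $ i) = (\<lambda>z. (if i = k then s else 0) * f z)" for i
      by (auto simp: r_def axis_def)
    have r_G: "(\<lambda>z. r z $ i, \<lambda>z. lnl * r z $ i) \<in> ?G" for i
      using graph_linear[OF const_graph[of 0] f(1), of "if i = k then s else 0"]
      unfolding fun_cong[OF r_i] by (simp add: r_i mult_ac)
    note r_L2 = graph_L2(1)[OF r_G]
    have "L2_inner P (\<lambda>z. r z $ i) (\<lambda>z. r z $ i) = (if i = k then ?D else 0)" for i
      unfolding r_i L2_inner_scale_left L2_inner_scale_right using s by (simp add: power2_eq_square)
    then have norm_r: "L2_normsq P r = ?D" by (simp add: L2_normsq_vec[OF r_L2])
    have "f \<in> borel_measurable P" using f_L2 by (simp add: L2_fun_def)
    then have "r \<in> borel_measurable P" unfolding r_def[abs_def] by measurable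
    moreover have "integrable P (\<lambda>z. (norm (r z))\<^sup>2)"
      using L2_fun_scale[OF f_L2, of s] by (simp add: r_def L2_fun_def)
    ultimately have dec: "spectral_decomposition P r 0 r"
      by (simp add: spectral_decomposition_def r_i L2_inner_linear f_const f_coord)
    \<comment> \<open>Equality in the spectral inequality identifies the excess as 2 (rho - rhonl) d
      c while the squared remainder is d c; cancelling d c leaves the bound on
      \<open>C\<close>.\<close>
    have "?D \<le> C * (2 * (rho - rhonl) * ?D)"
      using C[OF dec norm_r, of "2 * (rho - rhonl) * ?D"] eq[OF dec norm_r] r_G r_L2
      by (simp add: norm_r eigenspace_def)
    then have "1 * ?D \<le> (C * (2 * (rho - rhonl))) * ?D" by (simp add: mult.assoc)
    then have "1 \<le> C * (2 * (rho - rhonl))" using c by (intro mult_right_le_imp_le[of 1 ?D]) simp_all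
    then show ?thesis using gap_pos by (simp add: pos_divide_le_eq)
  qed
  show ?thesis
    using part1 part2 Q(1) ge eq optimal unfolding Let_def eta_def by blast
qed

end
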